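(* Let $N$ be a smooth $2$-dimensional manifold and let $M=T^*N$ with its canonical symplectic form $\Omega$. To any symplectic Monge-Ampère equation $\Delta_\omega=0$ of divergent type, with $\omega\in\Omega^2(M)$, corresponds a Hitchin pair $(\omega,\Omega)$ on $M$, and therefore a generalized complex structure on the $4$-dimensional manifold $M$. Here the $2$-form $\omega$ representing the equation is chosen closed: the original form is replaced, if necessary, by its sum with $\mu\Omega$ for a function $\mu$ on $M$, which defines the same equation. For this closed $\omega$, the generalized complex structure is $$\mathbb{J}=\begin{pmatrix} A & \Omega^{-1}\\ \tilde\omega & -A^*\end{pmatrix}: TM\oplus T^*M\to TM\oplus T^*M,$$ where $A$ is defined by $\omega=\Omega(A\cdot,\cdot)$ and $\tilde\omega=-\Omega((1+A^2)\cdot,\cdot)$; it is an integrable almost generalized complex structure.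
   Context: In local coordinates $(q_1,q_2)$ on $N$ and the associated coordinates $(q_1,q_2,p_1,p_2)$ on $M=T^*N$, $\Omega=dq_1\wedge dp_1+dq_2\wedge dp_2$. Monge-Ampère operator: for a $2$-form $\omega$ on $M=T^*N$, $\Delta_\omega(f)=(df)^*\omega\in\Omega^2(N)$ for $f\in C^\infty(N)$, where $df:N\to T^*N$ is the section defined by $f$. A generalized solution of $\Delta_\omega=0$ is a Lagrangian submanifold $L$ of $(M,\Omega)$ with $\omega|_L=0$; adding a function multiple of $\Omega$ to $\omega$ does not change the equation. Euler operator: the map $\alpha\mapsto\alpha\wedge\Omega$ is an isomorphism $\Omega^1(M)\to\Omega^3(M)$; let $\bot:\Omega^3(M)\to\Omega^1(M)$ be its inverse, so $\bot(\alpha\wedge\Omega)=\alpha$. The Euler operator is $\mathcal{E}:\Omega^2(M)\to\Omega^2(M)$, $\mathcal{E}(\omega)=d\,\bot\,d\omega$. The equation $\Delta_\omega=0$ is of divergent type if $\mathcal{E}(\omega)=0$. Hitchin pair: a pair $(\omega,\Omega)$ with $\Omega$ a symplectic form and $\omega$ a $2$-form with $d\omega=0$. Conventions for $\mathbb{J}$: a $2$-form $\sigma$ is identified with the bundle map $T\to T^*$, $X\mapsto\iota_X\sigma=\sigma(X,\cdot)$; $\Omega^{-1}:T^*\to T$ is the inverse of $X\mapsto\iota_X\Omega$; $A^*:T^*\to T^*$ is the dual map, $(A^*\xi)(X)=\xi(AX)$. Generalized complex structures: on $T\oplus T^*$ use the indefinite inner product $(X+\xi,Y+\eta)=\frac12(\xi(Y)+\eta(X))$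 and the Courant bracket $[X+\xi,Y+\eta]=[X,Y]+L_X\eta-L_Y\xi-\frac12 d(\iota_X\eta-\iota_Y\xi)$ on sections. An almost generalized complex structure is a bundle map $\mathbb{J}:T\oplus T^*\to T\oplus T^*$ with $\mathbb{J}^2=-1$ and $(\mathbb{J}\cdot,\cdot)=-(\cdot,\mathbb{J}\cdot)$. It is integrable if the spaces of sections of its two eigenspaces (for the eigenvalues $\pm i$, in the complexification of $T\oplus T^*$) are closed under the Courant bracket; a generalized complex structure is an integrable almost generalized complex structure.
   Formalization: A function μ making ω+μΩ closed need not exist on all of M (N a torus, ω=p₂dq₁∧dq₂); it is proved to exist over a neighbourhood of each point of N and on open sets where closed 1-forms are exact, and the other claims are proved for every such μ on any open subset of M. *)

theory Defs
  imports "HOL-Analysis.Analysis" "HOL-Library.Function_Algebras"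
begin

instantiation "fun" :: (type, real_vector) real_vector
begin

definition scaleR_fun :: "real \<Rightarrow> ('a \<Rightarrow> 'b) \<Rightarrow> 'a \<Rightarrow> 'b"
  where "scaleR_fun a f = (\<lambda>x. a *\<^sub>R f x)"

instance
  by standard (auto simp: scaleR_fun_def plus_fun_def scaleR_add_right scaleR_add_left)

end

definition linear_on :: "'a::real_vector set \<Rightarrow> ('a \<Rightarrow> 'b::real_vector) \<Rightarrow> bool"
  where "linear_on S f \<longleftrightarrow>
    (\<forall>u\<in>S. \<forall>v\<in>S. f (u + v) = f u + f v) \<and> (\<forall>a. \<forall>u\<in>S. f (a *\<^sub>R u) = a *\<^sub>R f u)"

definition restrict0 :: "'a set \<Rightarrow> ('a \<Rightarrow> real) \<Rightarrow> 'a \<Rightarrow> real"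
  where "restrict0 S f = (\<lambda>x. if x \<in> S then f x else 0)"

abbreviation D :: "('a::real_normed_vector \<Rightarrow> 'b::real_normed_vector) \<Rightarrow> 'a \<Rightarrow> 'a \<Rightarrow> 'b"
  where "D f x \<equiv> frechet_derivative f (at x)"

text \<open>\<open>Ck_on k S f\<close> and \<open>smooth_on S f\<close> are meant for open \<open>S\<close>.\<close>

primrec Ck_on ::
    "nat \<Rightarrow> 'a::euclidean_space set \<Rightarrow> ('a \<Rightarrow> 'b::real_normed_vector) \<Rightarrow> bool"
  where
    "Ck_on 0 S f = continuous_on S f"
  | "Ck_on (Suc k) S f = ((\<forall>x\<in>S. f differentiable at x) \<and> (\<forall>v. Ck_on k S (\<lambda>x. D f x v)))"

definition smooth_on :: "'a::euclidean_space set \<Rightarrow> ('a \<Rightarrow> 'b::real_normed_vector) \<Rightarrow> bool"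
  where "smooth_on S f \<longleftrightarrow> (\<forall>k. Ck_on k S f)"

text \<open>
  A manifold is given by an atlas.  A chart is its domain together with a coordinate map into the
  model space (only the values on the domain matter); the underlying set and the topology are
  determined by the atlas.
\<close>

type_synonym ('m, 'e) chart = "'m set \<times> ('m \<Rightarrow> 'e)"

definition chart_inv :: "('m, 'e) chart \<Rightarrow> 'e \<Rightarrow> 'm"
  where "chart_inv c = inv_into (fst c) (snd c)"

definition transition :: "('m, 'e) chart \<Rightarrow> ('m, 'e) chart \<Rightarrow> 'e \<Rightarrow> 'e"
  where "transition c c' = snd c' \<circ> chart_inv c"

definition points :: "('m, 'e) chart set \<Rightarrow> 'm set"
  where "points A = \<Union> (fst ` A)"

definition smooth_atlas :: "('m, 'e::euclidean_space) chart set \<Rightarrow> bool"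
  where "smooth_atlas A \<longleftrightarrow>
    (\<forall>c\<in>A. inj_on (snd c) (fst c) \<and> open (snd c ` fst c)) \<and>
    (\<forall>c\<in>A. \<forall>c'\<in>A. open (snd c ` (fst c \<inter> fst c')) \<and>
       smooth_on (snd c ` (fst c \<inter> fst c')) (transition c c'))"

definition atlas_topology :: "('m, 'e::euclidean_space) chart set \<Rightarrow> 'm topology"
  where "atlas_topology A =
    topology (\<lambda>W. W \<subseteq> points A \<and> (\<forall>c\<in>A. open (snd c ` (fst c \<inter> W))))"

definition smooth_manifold :: "('m, 'e::euclidean_space) chart set \<Rightarrow> bool"
  where "smooth_manifold A \<longleftrightarrow>
    smooth_atlas A \<and> Hausdorff_space (atlas_topology A) \<and> second_countable (atlas_topology A)"

lemma openin_atlas_topology: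
  assumes "smooth_atlas A"
  shows "openin (atlas_topology A) W \<longleftrightarrow>
    W \<subseteq> points A \<and> (\<forall>c\<in>A. open (snd c ` (fst c \<inter> W)))"
proof -
  have inj: "inj_on (snd c) (fst c)" if "c \<in> A" for c
    using assms that by (auto simp: smooth_atlas_def)
  have int: "snd c ` (fst c \<inter> (S \<inter> T)) = snd c ` (fst c \<inter> S) \<inter> snd c ` (fst c \<inter> T)"
    if "c \<in> A" for c S T
    using inj[OF that] by (auto simp: inj_on_def)
  have un: "snd c ` (fst c \<inter> \<Union>K) = (\<Union>W\<in>K. snd c ` (fst c \<inter> W))" for c :: "('a, 'b) chart" and K
    by auto
  have "istopology (\<lambda>W. W \<subseteq> points A \<and> (\<forall>c\<in>A. open (snd c ` (fst c \<inter> W))))"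
    unfolding istopology_def by (auto simp: int un intro!: open_Int open_UN)
  then show ?thesis
    by (simp add: atlas_topology_def)
qed

definition charts_at :: "('m, 'e) chart set \<Rightarrow> 'm \<Rightarrow> ('m, 'e) chart set"
  where "charts_at A x = {c \<in> A. x \<in> fst c}"

definition chart_at :: "('m, 'e) chart set \<Rightarrow> 'm \<Rightarrow> ('m, 'e) chart"
  where "chart_at A x = (SOME c. c \<in> charts_at A x)"

text \<open>
  A tangent vector at \<open>x\<close> is a family of components, one for each chart around \<open>x\<close>, which
  transforms under the derivatives of the transition maps.
\<close>

type_synonym ('m, 'e) tvec = "('m, 'e) chart \<Rightarrow> 'e"
type_synonym ('m, 'e) covec = "('m, 'e) tvec \<Rightarrow> real"

definition tangent_space :: "('m, 'e::euclidean_space) chart set \<Rightarrow> 'm \<Rightarrow> ('m, 'e) tvec set"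
  where "tangent_space A x = {v.
    (\<forall>c. c \<notin> charts_at A x \<longrightarrow> v c = 0) \<and>
    (\<forall>c\<in>charts_at A x. \<forall>c'\<in>charts_at A x. v c' = D (transition c c') (snd c x) (v c))}"

text \<open>The tangent vector at \<open>x\<close> whose components in the chart \<open>c\<close> are \<open>e\<close>.\<close>

definition coord_vector ::
    "('m, 'e::euclidean_space) chart set \<Rightarrow> ('m, 'e) chart \<Rightarrow> 'm \<Rightarrow> 'e \<Rightarrow> ('m, 'e) tvec"
  where "coord_vector A c x e =
    (\<lambda>c'. if c' \<in> charts_at A x then D (transition c c') (snd c x) e else 0)"

text \<open>Covectors are set to zero outside the tangent space, so that equality is equality on it.\<close>

definition cotangent_space :: "('m, 'e::euclidean_space) chart set \<Rightarrow> 'm \<Rightarrow> ('m, 'e) covec set"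
  where "cotangent_space A x =
    {\<xi>. linear_on (tangent_space A x) \<xi> \<and> (\<forall>v. v \<notin> tangent_space A x \<longrightarrow> \<xi> v = 0)}"

type_synonym ('m, 'e) form2 = "'m \<Rightarrow> ('m, 'e) tvec \<Rightarrow> ('m, 'e) tvec \<Rightarrow> real"
type_synonym ('m, 'e) form3 = "'m \<Rightarrow> ('m, 'e) tvec \<Rightarrow> ('m, 'e) tvec \<Rightarrow> ('m, 'e) tvec \<Rightarrow> real"

definition local1 :: "('m, 'e::euclidean_space) chart set \<Rightarrow> ('m, 'e) chart \<Rightarrow>
    ('m \<Rightarrow> ('m, 'e) covec) \<Rightarrow> 'e \<Rightarrow> 'e \<Rightarrow> real"
  where "local1 A c \<alpha> y a =
    \<alpha> (chart_inv c y) (coord_vector A c (chart_inv c y) a)"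

definition local2 :: "('m, 'e::euclidean_space) chart set \<Rightarrow> ('m, 'e) chart \<Rightarrow>
    ('m, 'e) form2 \<Rightarrow> 'e \<Rightarrow> 'e \<Rightarrow> 'e \<Rightarrow> real"
  where "local2 A c \<sigma> y a b =
    \<sigma> (chart_inv c y) (coord_vector A c (chart_inv c y) a) (coord_vector A c (chart_inv c y) b)"

definition smooth_fun :: "('m, 'e::euclidean_space) chart set \<Rightarrow> 'm set \<Rightarrow> ('m \<Rightarrow> real) \<Rightarrow> bool"
  where "smooth_fun A U f \<longleftrightarrow> (\<forall>c\<in>A. smooth_on (snd c ` (fst c \<inter> U)) (f \<circ> chart_inv c))"

definition vector_field ::
    "('m, 'e::euclidean_space) chart set \<Rightarrow> 'm set \<Rightarrow> ('m \<Rightarrow> ('m, 'e) tvec) \<Rightarrow> bool"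
  where "vector_field A U X \<longleftrightarrow>
    (\<forall>x\<in>U. X x \<in> tangent_space A x) \<and>
    (\<forall>c\<in>A. smooth_on (snd c ` (fst c \<inter> U)) (\<lambda>y. X (chart_inv c y) c))"

definition one_form ::
    "('m, 'e::euclidean_space) chart set \<Rightarrow> 'm set \<Rightarrow> ('m \<Rightarrow> ('m, 'e) covec) \<Rightarrow> bool"
  where "one_form A U \<alpha> \<longleftrightarrow>
    (\<forall>x\<in>U. \<alpha> x \<in> cotangent_space A x) \<and>
    (\<forall>c\<in>A. \<forall>a. smooth_on (snd c ` (fst c \<inter> U)) (\<lambda>y. local1 A c \<alpha> y a))"

definition two_form ::
    "('m, 'e::euclidean_space) chart set \<Rightarrow> 'm set \<Rightarrow> ('m, 'e) form2 \<Rightarrow> bool"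
  where "two_form A U \<sigma> \<longleftrightarrow>
    (\<forall>x\<in>U. \<forall>u\<in>tangent_space A x.
       linear_on (tangent_space A x) (\<sigma> x u) \<and>
       linear_on (tangent_space A x) (\<lambda>v. \<sigma> x v u) \<and> \<sigma> x u u = 0) \<and>
    (\<forall>c\<in>A. \<forall>a b. smooth_on (snd c ` (fst c \<inter> U)) (\<lambda>y. local2 A c \<sigma> y a b))"

text \<open>
  The exterior derivatives and the Lie bracket are given by their coordinate expressions in some
  chart around the point; for smooth fields the result does not depend on the chart.
  Conventions: \<open>(\<alpha> \<and> \<beta>)(u, v) = \<alpha>(u) \<beta>(v) - \<alpha>(v) \<beta>(u)\<close> and
  \<open>d\<alpha>(X, Y) = X(\<alpha>(Y)) - Y(\<alpha>(X)) - \<alpha>([X, Y])\<close>, with no factors 1/2.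
\<close>

definition d0 :: "('m, 'e::euclidean_space) chart set \<Rightarrow> ('m \<Rightarrow> real) \<Rightarrow> 'm \<Rightarrow> ('m, 'e) covec"
  where "d0 A f x = restrict0 (tangent_space A x)
    (\<lambda>v. let c = chart_at A x in D (f \<circ> chart_inv c) (snd c x) (v c))"

definition d1 ::
    "('m, 'e::euclidean_space) chart set \<Rightarrow> ('m \<Rightarrow> ('m, 'e) covec) \<Rightarrow> ('m, 'e) form2"
  where "d1 A \<alpha> x u v = (let c = chart_at A x; y = snd c x in
    D (\<lambda>z. local1 A c \<alpha> z (v c)) y (u c) - D (\<lambda>z. local1 A c \<alpha> z (u c)) y (v c))"

definition d2 :: "('m, 'e::euclidean_space) chart set \<Rightarrow> ('m, 'e) form2 \<Rightarrow> ('m, 'e) form3"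
  where "d2 A \<sigma> x u v w = (let c = chart_at A x; y = snd c x in
    D (\<lambda>z. local2 A c \<sigma> z (v c) (w c)) y (u c)
    - D (\<lambda>z. local2 A c \<sigma> z (u c) (w c)) y (v c)
    + D (\<lambda>z. local2 A c \<sigma> z (u c) (v c)) y (w c))"

definition closed1 ::
    "('m, 'e::euclidean_space) chart set \<Rightarrow> 'm set \<Rightarrow> ('m \<Rightarrow> ('m, 'e) covec) \<Rightarrow> bool"
  where "closed1 A U \<alpha> \<longleftrightarrow>
    (\<forall>x\<in>U. \<forall>u\<in>tangent_space A x. \<forall>v\<in>tangent_space A x. d1 A \<alpha> x u v = 0)"

definition closed2 :: "('m, 'e::euclidean_space) chart set \<Rightarrow> 'm set \<Rightarrow> ('m, 'e) form2 \<Rightarrow> bool"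
  where "closed2 A U \<sigma> \<longleftrightarrow>
    (\<forall>x\<in>U. \<forall>u\<in>tangent_space A x. \<forall>v\<in>tangent_space A x. \<forall>w\<in>tangent_space A x.
       d2 A \<sigma> x u v w = 0)"

definition closed_one_forms_exact :: "('m, 'e::euclidean_space) chart set \<Rightarrow> 'm set \<Rightarrow> bool"
  where "closed_one_forms_exact A U \<longleftrightarrow>
    (\<forall>\<alpha>. one_form A U \<alpha> \<and> closed1 A U \<alpha> \<longrightarrow>
       (\<exists>f. smooth_fun A U f \<and> (\<forall>x\<in>U. d0 A f x = \<alpha> x)))"

definition lie_bracket ::
    "('m, 'e::euclidean_space) chart set \<Rightarrow> ('m \<Rightarrow> ('m, 'e) tvec) \<Rightarrow> ('m \<Rightarrow> ('m, 'e) tvec) \<Rightarrow>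
      'm \<Rightarrow> ('m, 'e) tvec"
  where "lie_bracket A X Y x = (let c = chart_at A x; y = snd c x in
    coord_vector A c x
      (D (\<lambda>z. Y (chart_inv c z) c) y (X x c) - D (\<lambda>z. X (chart_inv c z) c) y (Y x c)))"

text \<open>The covector \<open>\<iota>\<^sub>X \<sigma> = \<sigma>(X, _)\<close>.\<close>

definition flat ::
    "('m, 'e::euclidean_space) chart set \<Rightarrow> ('m, 'e) form2 \<Rightarrow> 'm \<Rightarrow> ('m, 'e) tvec \<Rightarrow> ('m, 'e) covec"
  where "flat A \<sigma> x X = restrict0 (tangent_space A x) (\<sigma> x X)"

text \<open>Cartan's formula \<open>L\<^sub>X \<eta> = \<iota>\<^sub>X d\<eta> + d(\<iota>\<^sub>X \<eta>)\<close>.\<close>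

definition lie_derivative ::
    "('m, 'e::euclidean_space) chart set \<Rightarrow> ('m \<Rightarrow> ('m, 'e) tvec) \<Rightarrow> ('m \<Rightarrow> ('m, 'e) covec) \<Rightarrow>
      'm \<Rightarrow> ('m, 'e) covec"
  where "lie_derivative A X \<eta> x = flat A (d1 A \<eta>) x (X x) + d0 A (\<lambda>p. \<eta> p (X p)) x"

type_synonym ('m, 'e) gvec = "('m, 'e) tvec \<times> ('m, 'e) covec"

definition gspace :: "('m, 'e::euclidean_space) chart set \<Rightarrow> 'm \<Rightarrow> ('m, 'e) gvec set"
  where "gspace A x = tangent_space A x \<times> cotangent_space A x"

definition gsection ::
    "('m, 'e::euclidean_space) chart set \<Rightarrow> 'm set \<Rightarrow> ('m \<Rightarrow> ('m, 'e) gvec) \<Rightarrow> bool"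
  where "gsection A U S \<longleftrightarrow> vector_field A U (fst \<circ> S) \<and> one_form A U (snd \<circ> S)"

definition pairing :: "('m, 'e) gvec \<Rightarrow> ('m, 'e) gvec \<Rightarrow> real"
  where "pairing z w = 1 / 2 * (snd z (fst w) + snd w (fst z))"

definition courant ::
    "('m, 'e::euclidean_space) chart set \<Rightarrow> ('m \<Rightarrow> ('m, 'e) gvec) \<Rightarrow> ('m \<Rightarrow> ('m, 'e) gvec) \<Rightarrow>
      'm \<Rightarrow> ('m, 'e) gvec"
  where "courant A S T x =
    (let X = fst \<circ> S; \<xi> = snd \<circ> S; Y = fst \<circ> T; \<eta> = snd \<circ> T in
      (lie_bracket A X Y x,
       lie_derivative A X \<eta> x - lie_derivative A Y \<xi> x
         - (1 / 2) *\<^sub>R d0 A (\<lambda>p. \<eta> p (X p) - \<xi> p (Y p)) x))"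

text \<open>
  An element \<open>z + i w\<close> of a complexification is represented by the pair \<open>(z, w)\<close>; a section of the
  complexified bundle is a pair of sections, and real operations are extended complex
  (bi)linearly.
\<close>

definition cscale :: "complex \<Rightarrow> 'a::real_vector \<times> 'a \<Rightarrow> 'a \<times> 'a"
  where "cscale \<kappa> z =
    (Re \<kappa> *\<^sub>R fst z - Im \<kappa> *\<^sub>R snd z, Re \<kappa> *\<^sub>R snd z + Im \<kappa> *\<^sub>R fst z)"

definition ccourant ::
    "('m, 'e::euclidean_space) chart set \<Rightarrow>
      ('m \<Rightarrow> ('m, 'e) gvec) \<times> ('m \<Rightarrow> ('m, 'e) gvec) \<Rightarrow>
      ('m \<Rightarrow> ('m, 'e) gvec) \<times> ('m \<Rightarrow> ('m, 'e) gvec) \<Rightarrow>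
      ('m \<Rightarrow> ('m, 'e) gvec) \<times> ('m \<Rightarrow> ('m, 'e) gvec)"
  where "ccourant A Z W =
    (\<lambda>x. courant A (fst Z) (fst W) x - courant A (snd Z) (snd W) x,
     \<lambda>x. courant A (fst Z) (snd W) x + courant A (snd Z) (fst W) x)"

definition eigen_section ::
    "('m, 'e::euclidean_space) chart set \<Rightarrow> 'm set \<Rightarrow> ('m \<Rightarrow> ('m, 'e) gvec \<Rightarrow> ('m, 'e) gvec) \<Rightarrow>
      complex \<Rightarrow> ('m \<Rightarrow> ('m, 'e) gvec) \<times> ('m \<Rightarrow> ('m, 'e) gvec) \<Rightarrow> bool"
  where "eigen_section A U J \<kappa> Z \<longleftrightarrow>
    gsection A U (fst Z) \<and> gsection A U (snd Z) \<and>
    (\<forall>x\<in>U. (J x (fst Z x), J x (snd Z x)) = cscale \<kappa> (fst Z x, snd Z x))"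

text \<open>
  Smoothness of a fibrewise linear map of \<open>T \<oplus> T\<^sup>*\<close> is expressed by its mapping smooth local
  sections to smooth local sections.
\<close>

definition bundle_map ::
    "('m, 'e::euclidean_space) chart set \<Rightarrow> 'm set \<Rightarrow> ('m \<Rightarrow> ('m, 'e) gvec \<Rightarrow> ('m, 'e) gvec) \<Rightarrow> bool"
  where "bundle_map A U J \<longleftrightarrow>
    (\<forall>x\<in>U. J x ` gspace A x \<subseteq> gspace A x \<and> linear_on (gspace A x) (J x)) \<and>
    (\<forall>V S. openin (atlas_topology A) V \<and> V \<subseteq> U \<and> gsection A V S \<longrightarrow>
       gsection A V (\<lambda>x. J x (S x)))"

definition almost_generalized_complex ::
    "('m, 'e::euclidean_space) chart set \<Rightarrow> 'm set \<Rightarrow> ('m \<Rightarrow> ('m, 'e) gvec \<Rightarrow> ('m, 'e) gvec) \<Rightarrow> bool"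
  where "almost_generalized_complex A U J \<longleftrightarrow> bundle_map A U J \<and>
    (\<forall>x\<in>U. \<forall>z\<in>gspace A x. J x (J x z) = - z) \<and>
    (\<forall>x\<in>U. \<forall>z\<in>gspace A x. \<forall>w\<in>gspace A x. pairing (J x z) w = - pairing z (J x w))"

definition integrable_gcs ::
    "('m, 'e::euclidean_space) chart set \<Rightarrow> 'm set \<Rightarrow> ('m \<Rightarrow> ('m, 'e) gvec \<Rightarrow> ('m, 'e) gvec) \<Rightarrow> bool"
  where "integrable_gcs A U J \<longleftrightarrow>
    (\<forall>\<kappa>\<in>{\<i>, - \<i>}. \<forall>Z W. eigen_section A U J \<kappa> Z \<and> eigen_section A U J \<kappa> W \<longrightarrow>
       eigen_section A U J \<kappa> (ccourant A Z W))"

definition generalized_complex_structure ::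
    "('m, 'e::euclidean_space) chart set \<Rightarrow> 'm set \<Rightarrow> ('m \<Rightarrow> ('m, 'e) gvec \<Rightarrow> ('m, 'e) gvec) \<Rightarrow> bool"
  where "generalized_complex_structure A U J \<longleftrightarrow>
    almost_generalized_complex A U J \<and> integrable_gcs A U J"

definition symplectic_form ::
    "('m, 'e::euclidean_space) chart set \<Rightarrow> 'm set \<Rightarrow> ('m, 'e) form2 \<Rightarrow> bool"
  where "symplectic_form A U \<Omega> \<longleftrightarrow> two_form A U \<Omega> \<and> closed2 A U \<Omega> \<and>
    (\<forall>x\<in>U. \<forall>u\<in>tangent_space A x. (\<forall>v\<in>tangent_space A x. \<Omega> x u v = 0) \<longrightarrow> u = 0)"

definition hitchin_pair ::
    "('m, 'e::euclidean_space) chart set \<Rightarrow> 'm set \<Rightarrow> ('m, 'e) form2 \<Rightarrow> ('m, 'e) form2 \<Rightarrow> bool"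
  where "hitchin_pair A U \<omega> \<Omega> \<longleftrightarrow>
    symplectic_form A U \<Omega> \<and> two_form A U \<omega> \<and> closed2 A U \<omega>"

definition wedge12 :: "('m \<Rightarrow> ('m, 'e) covec) \<Rightarrow> ('m, 'e) form2 \<Rightarrow> ('m, 'e) form3"
  where "wedge12 \<alpha> \<sigma> x u v w =
    \<alpha> x u * \<sigma> x v w - \<alpha> x v * \<sigma> x u w + \<alpha> x w * \<sigma> x u v"

text \<open>The inverse of \<open>\<alpha> \<mapsto> \<alpha> \<and> \<Omega>\<close>, written \<open>\<bottom>\<close> in the Euler operator \<open>d \<bottom> d\<close>.\<close>

definition wedge_inv ::
    "('m, 'e::euclidean_space) chart set \<Rightarrow> ('m, 'e) form2 \<Rightarrow> ('m, 'e) form3 \<Rightarrow> 'm \<Rightarrow> ('m, 'e) covec"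
  where "wedge_inv A \<Omega> \<tau> x = (THE \<xi>. \<xi> \<in> cotangent_space A x \<and>
    (\<forall>u\<in>tangent_space A x. \<forall>v\<in>tangent_space A x. \<forall>w\<in>tangent_space A x.
       wedge12 (\<lambda>_. \<xi>) \<Omega> x u v w = \<tau> x u v w))"

definition euler ::
    "('m, 'e::euclidean_space) chart set \<Rightarrow> ('m, 'e) form2 \<Rightarrow> ('m, 'e) form2 \<Rightarrow> ('m, 'e) form2"
  where "euler A \<Omega> \<omega> = d1 A (wedge_inv A \<Omega> (d2 A \<omega>))"

definition divergent_type ::
    "('m, 'e::euclidean_space) chart set \<Rightarrow> ('m, 'e) form2 \<Rightarrow> ('m, 'e) form2 \<Rightarrow> bool"
  where "divergent_type A \<Omega> \<omega> \<longleftrightarrow>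
    (\<forall>x\<in>points A. \<forall>u\<in>tangent_space A x. \<forall>v\<in>tangent_space A x. euler A \<Omega> \<omega> x u v = 0)"

definition add_multiple ::
    "('m, 'e) form2 \<Rightarrow> ('m \<Rightarrow> real) \<Rightarrow> ('m, 'e) form2 \<Rightarrow> ('m, 'e) form2"
  where "add_multiple \<omega> \<mu> \<Omega> = (\<lambda>x u v. \<omega> x u v + \<mu> x * \<Omega> x u v)"

definition flat_inv ::
    "('m, 'e::euclidean_space) chart set \<Rightarrow> ('m, 'e) form2 \<Rightarrow> 'm \<Rightarrow> ('m, 'e) covec \<Rightarrow> ('m, 'e) tvec"
  where "flat_inv A \<Omega> x = the_inv_into (tangent_space A x) (flat A \<Omega> x)"

text \<open>The endomorphism \<open>B\<close> of the tangent bundle with \<open>\<omega> = \<Omega>(B _, _)\<close>.\<close>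

definition endo ::
    "('m, 'e::euclidean_space) chart set \<Rightarrow> ('m, 'e) form2 \<Rightarrow> ('m, 'e) form2 \<Rightarrow>
      'm \<Rightarrow> ('m, 'e) tvec \<Rightarrow> ('m, 'e) tvec"
  where "endo A \<Omega> \<omega> x X = (THE Y. Y \<in> tangent_space A x \<and>
    (\<forall>Z\<in>tangent_space A x. \<omega> x X Z = \<Omega> x Y Z))"

definition dual_map ::
    "('m, 'e::euclidean_space) chart set \<Rightarrow> ('m \<Rightarrow> ('m, 'e) tvec \<Rightarrow> ('m, 'e) tvec) \<Rightarrow>
      'm \<Rightarrow> ('m, 'e) covec \<Rightarrow> ('m, 'e) covec"
  where "dual_map A B x \<xi> = restrict0 (tangent_space A x) (\<lambda>X. \<xi> (B x X))"

definition gcs_map ::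
    "('m, 'e::euclidean_space) chart set \<Rightarrow> ('m, 'e) form2 \<Rightarrow> ('m, 'e) form2 \<Rightarrow>
      'm \<Rightarrow> ('m, 'e) gvec \<Rightarrow> ('m, 'e) gvec"
  where "gcs_map A \<Omega> \<omega> x z =
    (let B = endo A \<Omega> \<omega>;
         \<omega>t = (\<lambda>p X Y. - \<Omega> p (X + B p (B p X)) Y)
     in (B x (fst z) + flat_inv A \<Omega> x (snd z),
         flat A \<omega>t x (fst z) - dual_map A B x (snd z)))"

type_synonym ('n, 'e) cpoint = "'n \<times> ('n, 'e) covec"

text \<open>
  A chart with coordinates \<open>q\<close> of the base induces the chart with coordinates \<open>(q, p)\<close>, where
  \<open>p\<^sub>i = \<xi>(\<partial>/\<partial>q\<^sub>i)\<close>, that is \<open>\<xi> = \<Sum> p\<^sub>i dq\<^sub>i\<close>.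
\<close>

definition cotangent_chart ::
    "('n, 'e::euclidean_space) chart set \<Rightarrow> ('n, 'e) chart \<Rightarrow> (('n, 'e) cpoint, 'e \<times> 'e) chart"
  where "cotangent_chart A c =
    ({(x, \<xi>). x \<in> fst c \<and> \<xi> \<in> cotangent_space A x},
     \<lambda>(x, \<xi>). (snd c x, \<Sum>b\<in>Basis. \<xi> (coord_vector A c x b) *\<^sub>R b))"

definition cotangent_bundle ::
    "('n, 'e::euclidean_space) chart set \<Rightarrow> (('n, 'e) cpoint, 'e \<times> 'e) chart set"
  where "cotangent_bundle A = cotangent_chart A ` A"

definition cotangent_over ::
    "('n, 'e::euclidean_space) chart set \<Rightarrow> 'n set \<Rightarrow> ('n, 'e) cpoint set"
  where "cotangent_over A V = {(x, \<xi>). x \<in> V \<and> \<xi> \<in> cotangent_space A x}"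

text \<open>\<open>\<Omega> = \<Sum> dq\<^sub>i \<and> dp\<^sub>i\<close>, evaluated in some chart induced from the base (the value does not
  depend on this chart).\<close>

definition canonical_form ::
    "('n, 'e::euclidean_space) chart set \<Rightarrow> (('n, 'e) cpoint, 'e \<times> 'e) form2"
  where "canonical_form A m u v = (let c = chart_at (cotangent_bundle A) m in
    \<Sum>b\<in>Basis. (fst (u c) \<bullet> b) * (snd (v c) \<bullet> b) - (fst (v c) \<bullet> b) * (snd (u c) \<bullet> b))"

definition pushforward ::
    "('m, 'e::euclidean_space) chart set \<Rightarrow> ('k, 'f::euclidean_space) chart set \<Rightarrow>
      ('m \<Rightarrow> 'k) \<Rightarrow> 'm \<Rightarrow> ('m, 'e) tvec \<Rightarrow> ('k, 'f) tvec"
  where "pushforward A A' F x v = (let c = chart_at A x; c' = chart_at A' (F x) in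
    coord_vector A' c' (F x) (D (snd c' \<circ> F \<circ> chart_inv c) (snd c x) (v c)))"

definition pullback2 ::
    "('m, 'e::euclidean_space) chart set \<Rightarrow> ('k, 'f::euclidean_space) chart set \<Rightarrow>
      ('m \<Rightarrow> 'k) \<Rightarrow> ('k, 'f) form2 \<Rightarrow> ('m, 'e) form2"
  where "pullback2 A A' F \<sigma> x u v =
    \<sigma> (F x) (pushforward A A' F x u) (pushforward A A' F x v)"

definition diff_section ::
    "('n, 'e::euclidean_space) chart set \<Rightarrow> ('n \<Rightarrow> real) \<Rightarrow> 'n \<Rightarrow> ('n, 'e) cpoint"
  where "diff_section A f x = (x, d0 A f x)"

definition monge_ampere ::
    "('n, 'e::euclidean_space) chart set \<Rightarrow> (('n, 'e) cpoint, 'e \<times> 'e) form2 \<Rightarrow>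
      ('n \<Rightarrow> real) \<Rightarrow> ('n, 'e) form2"
  where "monge_ampere A \<omega> f = pullback2 A (cotangent_bundle A) (diff_section A f) \<omega>"

text \<open>
  \<open>g\<close> is a parametrization, defined on the open set \<open>W\<close>, of a relatively open part of \<open>L\<close>: a smooth
  immersion that is a homeomorphism onto its image.
\<close>

definition parametrization ::
    "('m, 'e::euclidean_space) chart set \<Rightarrow> 'm set \<Rightarrow> 'd::euclidean_space set \<Rightarrow> ('d \<Rightarrow> 'm) \<Rightarrow> bool"
  where "parametrization A L W g \<longleftrightarrow>
    open W \<and> openin (subtopology (atlas_topology A) L) (g ` W) \<and>
    homeomorphic_map (top_of_set W) (subtopology (atlas_topology A) (g ` W)) g \<and>
    (\<forall>c\<in>A. smooth_on (W \<inter> g -` fst c) (snd c \<circ> g) \<and>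
       (\<forall>s\<in>W \<inter> g -` fst c. inj (D (snd c \<circ> g) s)))"

definition surface :: "('m, 'e::euclidean_space) chart set \<Rightarrow> 'm set \<Rightarrow> bool"
  where "surface A L \<longleftrightarrow> L \<subseteq> points A \<and>
    (\<forall>m\<in>L. \<exists>W (g :: real^2 \<Rightarrow> 'm). parametrization A L W g \<and> m \<in> g ` W)"

definition surface_tangent ::
    "('m, 'e::euclidean_space) chart set \<Rightarrow> 'm set \<Rightarrow> 'm \<Rightarrow> ('m, 'e) tvec set"
  where "surface_tangent A L m =
    {coord_vector A c m (D (snd c \<circ> g) s e) | c W (g :: real^2 \<Rightarrow> 'm) s e.
       c \<in> charts_at A m \<and> parametrization A L W g \<and> s \<in> W \<and> g s = m}"

definition isotropic_at ::
    "('m, 'e::euclidean_space) chart set \<Rightarrow> 'm set \<Rightarrow> ('m, 'e) form2 \<Rightarrow> 'm \<Rightarrow> bool"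
  where "isotropic_at A L \<sigma> m \<longleftrightarrow>
    (\<forall>u\<in>surface_tangent A L m. \<forall>v\<in>surface_tangent A L m. \<sigma> m u v = 0)"

text \<open>In the four-dimensional case a Lagrangian submanifold is a surface on which \<open>\<Omega>\<close> vanishes.\<close>

definition generalized_solution ::
    "('m, 'e::euclidean_space) chart set \<Rightarrow> ('m, 'e) form2 \<Rightarrow> ('m, 'e) form2 \<Rightarrow> 'm set \<Rightarrow> bool"
  where "generalized_solution A \<Omega> \<omega> L \<longleftrightarrow>
    surface A L \<and> (\<forall>m\<in>L. isotropic_at A L \<Omega> m) \<and> (\<forall>m\<in>L. isotropic_at A L \<omega> m)"

text \<open>
  \<open>\<omega>\<close> and \<open>\<omega>'\<close> define the same equation over the open set \<open>U\<close> of the cotangent bundle: their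
  Monge-Ampere operators agree wherever the graph of \<open>df\<close> lies in \<open>U\<close>, and they have the same
  generalized solutions contained in \<open>U\<close>.
\<close>

definition same_equation ::
    "('n, 'e::euclidean_space) chart set \<Rightarrow> ('n, 'e) cpoint set \<Rightarrow>
      (('n, 'e) cpoint, 'e \<times> 'e) form2 \<Rightarrow> (('n, 'e) cpoint, 'e \<times> 'e) form2 \<Rightarrow> bool"
  where "same_equation A U \<omega> \<omega>' \<longleftrightarrow>
    (\<forall>V f. openin (atlas_topology A) V \<and> smooth_fun A V f \<longrightarrow>
       (\<forall>x\<in>V. diff_section A f x \<in> U \<longrightarrow>
         (\<forall>u\<in>tangent_space A x. \<forall>v\<in>tangent_space A x.
            monge_ampere A \<omega> f x u v = monge_ampere A \<omega>' f x u v))) \<and>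
    (\<forall>L\<subseteq>U. generalized_solution (cotangent_bundle A) (canonical_form A) \<omega> L \<longleftrightarrow>
       generalized_solution (cotangent_bundle A) (canonical_form A) \<omega>' L)"

end

theory Submission
  imports Defs
begin

text \<open>
  \<^bold>\<open>The closed representative.\<close>  Put \<open>\<alpha> = \<bottom> d\<omega>\<close>, so that \<open>\<alpha> \<and> \<Omega> = d\<omega>\<close>.  Divergent type says
  \<open>d\<alpha> = 0\<close>.  If \<open>\<alpha> = df\<close>, then \<open>\<mu> = - f\<close> gives \<open>d(\<omega> + \<mu> \<Omega>) = d\<omega> - df \<and> \<Omega> = 0\<close>
  (\<open>closed_add_multiple\<close>).  A primitive \<open>f\<close> exists wherever closed one-forms are exact, in particular
  over a ball in a chart of the base: the induced chart of the cotangent bundle maps the part over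
  the ball onto a ball times the space of momenta, which is convex
  (\<open>closed_one_forms_exact_convex\<close>).  The dimension enters through \<open>\<bottom>\<close>: on a four-dimensional
  space the one-form \<open>\<bottom> \<tau>\<close> is the contraction of \<open>\<tau>\<close> with the symplectic form
  (\<open>wedge_symp_contraction\<close>), so it exists, is unique, and is smooth.

  \<^bold>\<open>The equation.\<close>  A multiple of \<open>\<Omega>\<close> vanishes on the graph of \<open>df\<close>, because the graph is
  Lagrangian (\<open>pullback_canonical_form_diff_section\<close>), and on every Lagrangian surface by
  definition, so \<open>\<omega>\<close> and \<open>\<omega> + \<mu> \<Omega>\<close> define the same equation.

  \<^bold>\<open>The generalized complex structure.\<close>  Let now \<open>\<omega>\<close> be closed and read two-forms as maps from
  vectors to covectors.  Then \<open>J (X + \<xi>) = W - \<Omega> X - \<omega> W\<close>, where \<open>W\<close> solves \<open>\<Omega> W = \<omega> X + \<xi>\<close>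
  (\<open>gcs_map_eq\<close>); from this \<open>J\<^sup>2 = - 1\<close> and skewness are one-line computations.  For \<open>\<epsilon> = 1\<close> or
  \<open>\<epsilon> = - 1\<close>, the eigenspace for \<open>i \<epsilon>\<close> consists of all \<open>X + \<iota>\<^sub>X \<sigma>\<close> with \<open>X\<close> a complex vector and
  \<open>\<sigma> = i \<epsilon> \<Omega> - \<omega>\<close> (\<open>eigenvector_iff_graph\<close>).  The Courant bracket satisfies
  \<open>[X + \<iota>\<^sub>X \<sigma>, Y + \<iota>\<^sub>Y \<sigma>] = [X, Y] + \<iota>\<^bsub>[X, Y]\<^esub> \<sigma>\<close> as soon as \<open>d\<sigma> = 0\<close>
  (\<open>half_lie_flat_closed\<close>), so closedness of \<open>\<omega>\<close> and \<open>\<Omega>\<close> gives integrability.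

  \<^bold>\<open>Coordinates.\<close>  All differential operators are defined through one chart chosen at each point,
  and the choice may jump from point to point.  Every smoothness claim therefore rests on their
  being computable in any chart (\<open>d0_chart\<close>, \<open>d1_chart\<close>, \<open>d2_chart\<close>, \<open>lie_bracket_chart\<close>), which
  comes down to the chain rule and the symmetry of second derivatives of transition maps.  The same symmetry
  makes the transition maps of the cotangent bundle symplectic, so that \<open>\<Omega>\<close> has constant
  coefficients in all induced charts (\<open>canonical_form_chart\<close>).
\<close>

section \<open>Smooth maps between Euclidean spaces\<close>

lemma D_eqI: "(f has_derivative f') (at x) \<Longrightarrow> D f x = f'"
  by (rule frechet_derivative_at[symmetric])

lemma has_derivative_D: "f differentiable at x \<Longrightarrow> (f has_derivative D f x) (at x)"
  by (simp add: frechet_derivative_works)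

lemma D_cong_open:
  assumes "open S" "x \<in> S" "\<And>y. y \<in> S \<Longrightarrow> f y = g y"
  shows "D f x = D g x"
proof -
  have "(g has_derivative h) (at x)" if "(f has_derivative h) (at x)" for h
    by (rule has_derivative_transform_within_open[OF that assms])
  moreover have "(f has_derivative h) (at x)" if "(g has_derivative h) (at x)" for h
    by (rule has_derivative_transform_within_open[OF that assms(1,2)]) (simp add: assms(3))
  ultimately have "(f has_derivative h) (at x) \<longleftrightarrow> (g has_derivative h) (at x)" for h
    by blast
  then show ?thesis by (simp add: frechet_derivative_def)
qed

lemma differentiable_cong_open:
  assumes "open S" "x \<in> S" "\<And>y. y \<in> S \<Longrightarrow> f y = g y" "f differentiable at x"
  shows "g differentiable at x"
proof -
  obtain f' where "(f has_derivative f') (at x)" using assms(4) by (auto simp: differentiable_def)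
  then have "(g has_derivative f') (at x)"
    by (rule has_derivative_transform_within_open) (use assms in auto)
  then show ?thesis by (auto simp: differentiable_def)
qed

lemma Ck_on_cong:
  assumes "open S" "\<And>x. x \<in> S \<Longrightarrow> f x = g x" "Ck_on k S f"
  shows "Ck_on k S g"
  using assms(2,3)
proof (induction k arbitrary: f g)
  case 0
  then show ?case using continuous_on_cong[of S S f g] by auto
next
  case (Suc k)
  have d: "\<forall>x\<in>S. g differentiable at x"
    using Suc.prems differentiable_cong_open[OF assms(1), of _ f g] by auto
  have "Ck_on k S (\<lambda>x. D g x v)" for v
  proof (rule Suc.IH)
    show "Ck_on k S (\<lambda>x. D f x v)" using Suc.prems by simp
    show "D f x v = D g x v" if "x \<in> S" for x
      using D_cong_open[OF assms(1) that, of f g] Suc.prems by simp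
  qed
  with d show ?case by simp
qed

lemma Ck_on_subset: "Ck_on k S f \<Longrightarrow> T \<subseteq> S \<Longrightarrow> Ck_on k T f"
  by (induction k arbitrary: f) (auto intro: continuous_on_subset)

lemma Ck_on_imp_continuous_on: "Ck_on k S f \<Longrightarrow> continuous_on S f"
  by (cases k) (auto intro!: continuous_at_imp_continuous_on differentiable_imp_continuous_within)

lemma Ck_on_Suc_imp: "Ck_on (Suc k) S f \<Longrightarrow> Ck_on k S f"
proof (induction k arbitrary: f)
  case 0
  then show ?case using Ck_on_imp_continuous_on[of "Suc 0"] by simp
next
  case (Suc k)
  then show ?case by auto
qed

lemma Ck_on_const: "Ck_on k S (\<lambda>x. c)"
  by (induction k arbitrary: c) auto

lemma Ck_on_bounded_linear:
  assumes S: "open S" and L: "bounded_linear L" and f: "Ck_on k S f"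
  shows "Ck_on k S (\<lambda>x. L (f x))"
  using f
proof (induction k arbitrary: f)
  case 0
  then show ?case using bounded_linear.continuous_on[OF L] by auto
next
  case (Suc k)
  have h: "((\<lambda>x. L (f x)) has_derivative (\<lambda>v. L (D f x v))) (at x)" if "x \<in> S" for x
    using Suc.prems that
    by (intro bounded_linear.has_derivative[OF L] has_derivative_D) auto
  have "Ck_on k S (\<lambda>x. D (\<lambda>x. L (f x)) x v)" for v
    by (rule Ck_on_cong[OF S, of "\<lambda>x. L (D f x v)"]) (use Suc D_eqI[OF h] in auto)
  then show ?case using h by (auto simp: differentiable_def)
qed

lemma Ck_on_add:
  assumes S: "open S" and "Ck_on k S f" "Ck_on k S g"
  shows "Ck_on k S (\<lambda>x. f x + g x)"
  using assms(2,3)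
proof (induction k arbitrary: f g)
  case 0
  then show ?case by (auto intro: continuous_intros)
next
  case (Suc k)
  have h: "((\<lambda>x. f x + g x) has_derivative (\<lambda>v. D f x v + D g x v)) (at x)" if "x \<in> S" for x
    using Suc.prems that by (intro has_derivative_add has_derivative_D) auto
  have "Ck_on k S (\<lambda>x. D (\<lambda>x. f x + g x) x v)" for v
    by (rule Ck_on_cong[OF S, of "\<lambda>x. D f x v + D g x v"]) (use Suc D_eqI[OF h] in auto)
  then show ?case using h by (auto simp: differentiable_def)
qed

lemma Ck_on_bounded_bilinear:
  assumes S: "open S" and B: "bounded_bilinear B" and "Ck_on k S f" "Ck_on k S g"
  shows "Ck_on k S (\<lambda>x. B (f x) (g x))"
  using assms(3,4)
proof (induction k arbitrary: f g)
  case 0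
  then show ?case using bounded_bilinear.continuous_on[OF B] by auto
next
  case (Suc k)
  have h: "((\<lambda>x. B (f x) (g x)) has_derivative (\<lambda>v. B (f x) (D g x v) + B (D f x v) (g x))) (at x)"
    if "x \<in> S" for x
    using Suc.prems that by (intro bounded_bilinear.FDERIV[OF B] has_derivative_D) auto
  have "Ck_on k S f" "Ck_on k S g" using Suc.prems Ck_on_Suc_imp by blast+
  then have "Ck_on k S (\<lambda>x. B (f x) (D g x v) + B (D f x v) (g x))" for v
    using Suc by (intro Ck_on_add[OF S] Suc.IH) auto
  then have "Ck_on k S (\<lambda>x. D (\<lambda>x. B (f x) (g x)) x v)" for v
    by (rule Ck_on_cong[OF S, rotated]) (use D_eqI[OF h] in auto)
  then show ?case using h by (auto simp: differentiable_def)
qed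

lemma Ck_on_sum:
  assumes S: "open S" and "\<And>i. i \<in> I \<Longrightarrow> Ck_on k S (f i)"
  shows "Ck_on k S (\<lambda>x. \<Sum>i\<in>I. f i x)"
  using assms(2)
  by (induction I rule: infinite_finite_induct) (auto intro: Ck_on_const Ck_on_add[OF S])

lemma linear_expand_Basis:
  fixes v :: "'a::euclidean_space"
  assumes "linear L"
  shows "L v = (\<Sum>b\<in>Basis. (v \<bullet> b) *\<^sub>R L b)"
  using assms by (metis (no_types, lifting) euclidean_representation linear_scale linear_sum sum.cong)

lemma linear_functional_expand:
  fixes l :: "'a::euclidean_space \<Rightarrow> real"
  assumes "linear l"
  shows "(\<Sum>b\<in>Basis. l b *\<^sub>R b) \<bullet> a = l a"
  using linear_expand_Basis[OF assms, of a]
  by (simp add: inner_sum_left inner_commute[of a] mult.commute)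

lemma Ck_on_compose:
  fixes f :: "'a::euclidean_space \<Rightarrow> 'b::euclidean_space" and g :: "'b \<Rightarrow> 'c::real_normed_vector"
  assumes S: "open S" and "f ` S \<subseteq> T" "Ck_on k S f" "Ck_on k T g"
  shows "Ck_on k S (\<lambda>x. g (f x))"
  using assms(3,4)
proof (induction k arbitrary: g)
  case 0
  then show ?case using assms(2) continuous_on_compose2[of T g S f] by auto
next
  case (Suc k)
  have h: "((\<lambda>x. g (f x)) has_derivative (\<lambda>v. D g (f x) (D f x v))) (at x)" if "x \<in> S" for x
    by (rule has_derivative_compose[OF has_derivative_D has_derivative_D])
      (use Suc.prems that assms(2) in auto)
  have e: "D g (f x) (D f x v) = (\<Sum>b\<in>Basis. (D f x v \<bullet> b) *\<^sub>R D g (f x) b)" if "x \<in> S" for x v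
    using Suc.prems that assms(2)
    by (intro linear_expand_Basis linear_frechet_derivative) auto
  have fk: "Ck_on k S f" using Suc.prems Ck_on_Suc_imp by blast
  have "Ck_on k S (\<lambda>x. \<Sum>b\<in>Basis. (D f x v \<bullet> b) *\<^sub>R D g (f x) b)" for v
    using Suc.prems fk
    by (intro Ck_on_sum[OF S] Ck_on_bounded_bilinear[OF S bounded_bilinear_scaleR]
        Ck_on_bounded_linear[OF S bounded_linear_inner_left] Suc.IH) auto
  then have "Ck_on k S (\<lambda>x. D (\<lambda>x. g (f x)) x v)" for v
    by (rule Ck_on_cong[OF S, rotated]) (use e D_eqI[OF h] in auto)
  then show ?case using h by (auto simp: differentiable_def)
qed

lemma smooth_on_cong:
  "open S \<Longrightarrow> (\<And>x. x \<in> S \<Longrightarrow> f x = g x) \<Longrightarrow> smooth_on S f \<Longrightarrow> smooth_on S g"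
  unfolding smooth_on_def using Ck_on_cong by blast

lemma smooth_on_subset: "smooth_on S f \<Longrightarrow> T \<subseteq> S \<Longrightarrow> smooth_on T f"
  unfolding smooth_on_def using Ck_on_subset by blast

lemma smooth_on_const [intro, simp]: "smooth_on S (\<lambda>x. c)"
  by (simp add: smooth_on_def Ck_on_const)

lemma smooth_on_bounded_linear:
  "open S \<Longrightarrow> bounded_linear L \<Longrightarrow> smooth_on S f \<Longrightarrow> smooth_on S (\<lambda>x. L (f x))"
  by (simp add: smooth_on_def Ck_on_bounded_linear)

lemma smooth_on_add: "open S \<Longrightarrow> smooth_on S f \<Longrightarrow> smooth_on S g \<Longrightarrow> smooth_on S (\<lambda>x. f x + g x)"
  by (simp add: smooth_on_def Ck_on_add)

lemma smooth_on_bounded_bilinear: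
  "open S \<Longrightarrow> bounded_bilinear B \<Longrightarrow> smooth_on S f \<Longrightarrow> smooth_on S g \<Longrightarrow>
    smooth_on S (\<lambda>x. B (f x) (g x))"
  by (simp add: smooth_on_def Ck_on_bounded_bilinear)

lemma smooth_on_scaleR:
  "open S \<Longrightarrow> smooth_on S f \<Longrightarrow> smooth_on S g \<Longrightarrow> smooth_on S (\<lambda>x. f x *\<^sub>R g x)"
  by (rule smooth_on_bounded_bilinear[OF _ bounded_bilinear_scaleR])

lemma smooth_on_mult:
  fixes f g :: "'a::euclidean_space \<Rightarrow> real"
  shows "open S \<Longrightarrow> smooth_on S f \<Longrightarrow> smooth_on S g \<Longrightarrow> smooth_on S (\<lambda>x. f x * g x)"
  by (rule smooth_on_bounded_bilinear[OF _ bounded_bilinear_mult])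

lemma smooth_on_minus: "open S \<Longrightarrow> smooth_on S f \<Longrightarrow> smooth_on S (\<lambda>x. - f x)"
  by (rule smooth_on_bounded_linear[OF _ bounded_linear_minus[OF bounded_linear_ident]])

lemma smooth_on_diff: "open S \<Longrightarrow> smooth_on S f \<Longrightarrow> smooth_on S g \<Longrightarrow> smooth_on S (\<lambda>x. f x - g x)"
  using smooth_on_add[OF _ _ smooth_on_minus, of S f g] by simp

lemma smooth_on_inner_left: "open S \<Longrightarrow> smooth_on S f \<Longrightarrow> smooth_on S (\<lambda>x. f x \<bullet> c)"
  by (rule smooth_on_bounded_linear[OF _ bounded_linear_inner_left])

lemma smooth_on_sum:
  "open S \<Longrightarrow> (\<And>i. i \<in> I \<Longrightarrow> smooth_on S (f i)) \<Longrightarrow> smooth_on S (\<lambda>x. \<Sum>i\<in>I. f i x)"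
  by (simp add: smooth_on_def Ck_on_sum)

lemma smooth_on_compose:
  fixes f :: "'a::euclidean_space \<Rightarrow> 'b::euclidean_space" and g :: "'b \<Rightarrow> 'c::real_normed_vector"
  shows "open S \<Longrightarrow> f ` S \<subseteq> T \<Longrightarrow> smooth_on S f \<Longrightarrow> smooth_on T g \<Longrightarrow> smooth_on S (\<lambda>x. g (f x))"
  by (simp add: smooth_on_def Ck_on_compose)

lemma smooth_on_linear: "bounded_linear L \<Longrightarrow> smooth_on S L"
proof -
  assume L: "bounded_linear L"
  have "Ck_on k UNIV L" for k
    using L
  proof (induction k)
    case 0
    then show ?case by (simp add: linear_continuous_on)
  next
    case (Suc k)
    have "D L x = L" for x using bounded_linear_imp_has_derivative[OF L] D_eqI by blast
    then show ?case
      using bounded_linear_imp_differentiable[OF L] by (simp add: Ck_on_const)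
  qed
  then show "smooth_on S L" unfolding smooth_on_def using Ck_on_subset by blast
qed

lemma smooth_on_Pair:
  fixes f :: "'a::euclidean_space \<Rightarrow> 'b::real_normed_vector" and g :: "'a \<Rightarrow> 'c::real_normed_vector"
  assumes S: "open S" and f: "smooth_on S f" and g: "smooth_on S g"
  shows "smooth_on S (\<lambda>x. (f x, g x))"
proof -
  have 1: "bounded_linear (\<lambda>u::'b. (u, 0::'c))" and 2: "bounded_linear (\<lambda>u::'c. (0::'b, u))"
    by (intro bounded_linear_Pair bounded_linear_ident bounded_linear_zero)+
  show ?thesis
    using smooth_on_add[OF S smooth_on_bounded_linear[OF S 1 f] smooth_on_bounded_linear[OF S 2 g]]
    by simp
qed

lemma smooth_on_imp_continuous_on: "smooth_on S f \<Longrightarrow> continuous_on S f"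
  using Ck_on_imp_continuous_on by (auto simp: smooth_on_def)

lemma smooth_on_imp_differentiable: "smooth_on S f \<Longrightarrow> x \<in> S \<Longrightarrow> f differentiable at x"
  unfolding smooth_on_def using Ck_on.simps(2) by blast

lemma smooth_on_has_derivative: "smooth_on S f \<Longrightarrow> x \<in> S \<Longrightarrow> (f has_derivative D f x) (at x)"
  by (intro has_derivative_D smooth_on_imp_differentiable)

lemma smooth_on_D: "smooth_on S f \<Longrightarrow> smooth_on S (\<lambda>x. D f x v)"
  unfolding smooth_on_def using Ck_on.simps(2) by blast

section \<open>Smooth families of linear and bilinear maps\<close>

text \<open>A family of linear maps is tested for smoothness on each fixed argument; expanding an argument in
  the standard basis then yields the product rule.\<close>
definition lin_field :: "'a::euclidean_space set \<Rightarrow>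
    ('a \<Rightarrow> 'b::euclidean_space \<Rightarrow> 'c::real_normed_vector) \<Rightarrow> bool"
  where "lin_field S L \<longleftrightarrow> (\<forall>z\<in>S. linear (L z)) \<and> (\<forall>a. smooth_on S (\<lambda>z. L z a))"

lemma lin_fieldD:
  assumes "lin_field S L"
  shows "z \<in> S \<Longrightarrow> linear (L z)" "smooth_on S (\<lambda>z. L z a)"
  using assms by (auto simp: lin_field_def)

lemma lin_field_D:
  assumes "smooth_on S f" shows "lin_field S (D f)"
  using assms by (auto simp: lin_field_def intro: smooth_on_D linear_frechet_derivative
      smooth_on_imp_differentiable)

lemma smooth_on_lin_field:
  assumes S: "open S" and L: "lin_field S L" and f: "smooth_on S f"
  shows "smooth_on S (\<lambda>z. L z (f z))"
proof (rule smooth_on_cong[OF S])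
  show "smooth_on S (\<lambda>z. \<Sum>b\<in>Basis. (f z \<bullet> b) *\<^sub>R L z b)"
    using f L by (intro smooth_on_sum smooth_on_scaleR smooth_on_inner_left S) (auto simp: lin_field_def)
  show "(\<Sum>b\<in>Basis. (f z \<bullet> b) *\<^sub>R L z b) = L z (f z)" if "z \<in> S" for z
    using linear_expand_Basis[of "L z" "f z"] L that by (auto simp: lin_field_def)
qed

lemma continuous_on_lin_field:
  assumes L: "lin_field S L" and f: "continuous_on X f" "f ` X \<subseteq> S" and g: "continuous_on X g"
  shows "continuous_on X (\<lambda>p. L (f p) (g p))"
proof -
  have "continuous_on X (\<lambda>p. L (f p) b)" for b
    by (rule continuous_on_compose2[OF smooth_on_imp_continuous_on[OF lin_fieldD(2)[OF L]] f])
  then have "continuous_on X (\<lambda>p. \<Sum>b\<in>Basis. (g p \<bullet> b) *\<^sub>R L (f p) b)"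
    by (intro continuous_on_sum continuous_on_scaleR continuous_on_inner g continuous_on_const)
  moreover have "(\<Sum>b\<in>Basis. (g p \<bullet> b) *\<^sub>R L (f p) b) = L (f p) (g p)" if "p \<in> X" for p
    by (rule linear_expand_Basis[symmetric]) (use lin_fieldD(1)[OF L] f(2) that in auto)
  ultimately show ?thesis by (rule continuous_on_eq)
qed

lemma lin_field_has_derivative:
  assumes S: "open S" and L: "lin_field S L" and x: "x \<in> S" and f: "(f has_derivative f') (at x)"
  shows "((\<lambda>z. L z (f z)) has_derivative (\<lambda>u. D (\<lambda>z. L z (f x)) x u + L x (f' u))) (at x)"
proof -
  have h: "((\<lambda>z. L z b) has_derivative D (\<lambda>z. L z b) x) (at x)" for b
    using L x by (intro smooth_on_has_derivative) (auto simp: lin_field_def)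
  have e: "L z c = (\<Sum>b\<in>Basis. (c \<bullet> b) *\<^sub>R L z b)" if "z \<in> S" for z c
    using linear_expand_Basis[of "L z" c] L that by (auto simp: lin_field_def)
  have h2: "((\<lambda>z. \<Sum>b\<in>Basis. (f x \<bullet> b) *\<^sub>R L z b) has_derivative
      (\<lambda>u. \<Sum>b\<in>Basis. (f x \<bullet> b) *\<^sub>R D (\<lambda>z. L z b) x u)) (at x)"
    by (intro has_derivative_sum has_derivative_scaleR_right h)
  have Dfx: "D (\<lambda>z. L z (f x)) x = (\<lambda>u. \<Sum>b\<in>Basis. (f x \<bullet> b) *\<^sub>R D (\<lambda>z. L z b) x u)"
    by (rule D_eqI, rule has_derivative_transform_within_open[OF h2 S x]) (simp add: e)
  have "((\<lambda>z. \<Sum>b\<in>Basis. (f z \<bullet> b) *\<^sub>R L z b) has_derivative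
      (\<lambda>u. \<Sum>b\<in>Basis. (f x \<bullet> b) *\<^sub>R D (\<lambda>z. L z b) x u + (f' u \<bullet> b) *\<^sub>R L x b)) (at x)"
    by (intro has_derivative_sum has_derivative_scaleR h has_derivative_inner_left f)
  then have "((\<lambda>z. L z (f z)) has_derivative
      (\<lambda>u. \<Sum>b\<in>Basis. (f x \<bullet> b) *\<^sub>R D (\<lambda>z. L z b) x u + (f' u \<bullet> b) *\<^sub>R L x b)) (at x)"
    by (rule has_derivative_transform_within_open[OF _ S x]) (simp add: e[symmetric])
  then show ?thesis
    by (simp add: Dfx sum.distrib e[OF x, symmetric])
qed

lemma lin_field_D_apply:
  assumes "open S" "lin_field S L" "x \<in> S" "smooth_on S f"
  shows "D (\<lambda>z. L z (f z)) x u = D (\<lambda>z. L z (f x)) x u + L x (D f x u)"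
  using D_eqI[OF lin_field_has_derivative[OF assms(1-3) smooth_on_has_derivative[OF assms(4,3)]]]
  by simp

text \<open>The derivative of a smooth family of linear maps is again such a family: the derivative in a
  fixed direction depends linearly on the argument of the map.\<close>

lemma lin_field_deriv:
  assumes S: "open S" and L: "lin_field S L"
  shows "lin_field S (\<lambda>z a. D (\<lambda>z. L z a) z u)"
  unfolding lin_field_def
proof (intro conjI ballI allI)
  fix z assume z: "z \<in> S"
  have h: "((\<lambda>z. L z b) has_derivative D (\<lambda>z. L z b) z) (at z)" for b
    using L z by (intro smooth_on_has_derivative) (auto simp: lin_field_def)
  have "D (\<lambda>z. L z (a + b)) z u = D (\<lambda>z. L z a) z u + D (\<lambda>z. L z b) z u" for a b
  proof -
    have "D (\<lambda>z. L z (a + b)) z = (\<lambda>u. D (\<lambda>z. L z a) z u + D (\<lambda>z. L z b) z u)"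
      by (rule D_eqI, rule has_derivative_transform_within_open[OF has_derivative_add[OF h h] S z])
        (use L in \<open>auto simp: lin_field_def linear_add\<close>)
    then show ?thesis by simp
  qed
  moreover have "D (\<lambda>z. L z (r *\<^sub>R a)) z u = r *\<^sub>R D (\<lambda>z. L z a) z u" for r a
  proof -
    have "D (\<lambda>z. L z (r *\<^sub>R a)) z = (\<lambda>u. r *\<^sub>R D (\<lambda>z. L z a) z u)"
      by (rule D_eqI, rule has_derivative_transform_within_open[OF has_derivative_scaleR_right[OF h] S z])
        (use L in \<open>auto simp: lin_field_def linear_scale\<close>)
    then show ?thesis by simp
  qed
  ultimately show "linear (\<lambda>a. D (\<lambda>z. L z a) z u)" by (intro linearI) auto
qed (use L in \<open>auto intro: smooth_on_D simp: lin_field_def\<close>)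

text \<open>Freezing either argument leaves a smooth family of linear maps, so the rules for those can be
  applied to one argument at a time.\<close>
definition bilin_field :: "'a::euclidean_space set \<Rightarrow>
    ('a \<Rightarrow> 'b::euclidean_space \<Rightarrow> 'b \<Rightarrow> 'c::real_normed_vector) \<Rightarrow> bool"
  where "bilin_field S s \<longleftrightarrow> (\<forall>a. lin_field S (\<lambda>z b. s z a b) \<and> lin_field S (\<lambda>z b. s z b a))"

lemma bilin_fieldD:
  assumes "bilin_field S s"
  shows "lin_field S (\<lambda>z b. s z a b)" "lin_field S (\<lambda>z b. s z b a)"
  using assms by (auto simp: bilin_field_def)

lemma bilin_field_insert:
  assumes S: "open S" and s: "bilin_field S s" and f: "smooth_on S f"
  shows "lin_field S (\<lambda>z. s z (f z))"
  unfolding lin_field_def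
proof (intro conjI ballI allI)
  show "linear (s z (f z))" if "z \<in> S" for z
    using bilin_fieldD(1)[OF s] that by (auto simp: lin_field_def)
  show "smooth_on S (\<lambda>z. s z (f z) a)" for a
    by (rule smooth_on_lin_field[OF S bilin_fieldD(2)[OF s] f])
qed

lemma bilin_field_D_apply:
  assumes S: "open S" and s: "bilin_field S s" and x: "x \<in> S"
    and f: "smooth_on S f" and g: "smooth_on S g"
  shows "D (\<lambda>z. s z (f z) (g z)) x u =
    D (\<lambda>z. s z (f x) (g x)) x u + s x (D f x u) (g x) + s x (f x) (D g x u)"
  using lin_field_D_apply[OF S bilin_field_insert[OF S s f] x g, of u]
    lin_field_D_apply[OF S bilin_fieldD(2)[OF s] x f, of "g x" u] by simp

section \<open>Symmetry of second derivatives\<close>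

lemma has_real_derivative_along_line:
  fixes g :: "'a::real_normed_vector \<Rightarrow> real"
  assumes g: "(g has_derivative g') (at (p s))" and p: "(p has_derivative (\<lambda>r. r *\<^sub>R u)) (at s)"
  shows "((\<lambda>s. g (p s)) has_real_derivative g' u) (at s)"
  using has_derivative_compose[OF p g]
  by (simp add: has_field_derivative_def linear_scale[OF has_derivative_linear[OF g]] mult.commute[of _ "g' u"])

text \<open>Two applications of the mean value theorem to the second difference
  \<open>f (x + h u + h v) - f (x + h u) - f (x + h v) + f x\<close>, which is symmetric in \<open>u\<close> and \<open>v\<close>.\<close>

lemma second_difference_mvt:
  fixes f :: "'a::euclidean_space \<Rightarrow> real"
  assumes f: "smooth_on S f" and h: "0 < h"
    and sub: "\<And>s t. 0 \<le> s \<Longrightarrow> s \<le> h \<Longrightarrow> 0 \<le> t \<Longrightarrow> t \<le> h \<Longrightarrow> x + s *\<^sub>R u + t *\<^sub>R v \<in> S"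
  shows "\<exists>s t. 0 \<le> s \<and> s \<le> h \<and> 0 \<le> t \<and> t \<le> h \<and>
    f (x + h *\<^sub>R u + h *\<^sub>R v) - f (x + h *\<^sub>R u) - f (x + h *\<^sub>R v) + f x =
    h * h * D (\<lambda>z. D f z u) (x + s *\<^sub>R u + t *\<^sub>R v) v"
proof -
  define G where "G s = f (x + s *\<^sub>R u + h *\<^sub>R v) - f (x + s *\<^sub>R u + 0 *\<^sub>R v)" for s
  have line: "((\<lambda>s. g (x + s *\<^sub>R u + t *\<^sub>R v)) has_real_derivative D g (x + s *\<^sub>R u + t *\<^sub>R v) u) (at s)"
    if "smooth_on S g" "0 \<le> s" "s \<le> h" "0 \<le> t" "t \<le> h" for g :: "'a \<Rightarrow> real" and s t
  proof -
    have g: "(g has_derivative D g (x + s *\<^sub>R u + t *\<^sub>R v)) (at (x + s *\<^sub>R u + t *\<^sub>R v))"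
      using that sub by (intro smooth_on_has_derivative) auto
    show ?thesis
      by (rule has_real_derivative_along_line[where p="\<lambda>s. x + s *\<^sub>R u + t *\<^sub>R v", OF g])
        (auto intro!: derivative_eq_intros)
  qed
  have line': "((\<lambda>t. g (x + s *\<^sub>R u + t *\<^sub>R v)) has_real_derivative D g (x + s *\<^sub>R u + t *\<^sub>R v) v) (at t)"
    if "smooth_on S g" "0 \<le> s" "s \<le> h" "0 \<le> t" "t \<le> h" for g :: "'a \<Rightarrow> real" and s t
  proof -
    have g: "(g has_derivative D g (x + s *\<^sub>R u + t *\<^sub>R v)) (at (x + s *\<^sub>R u + t *\<^sub>R v))"
      using that sub by (intro smooth_on_has_derivative) auto
    show ?thesis
      by (rule has_real_derivative_along_line[where p="\<lambda>t. x + s *\<^sub>R u + t *\<^sub>R v", OF g])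
        (auto intro!: derivative_eq_intros)
  qed
  have "\<exists>s>0. s < h \<and> G h - G 0 =
      (h - 0) * (D f (x + s *\<^sub>R u + h *\<^sub>R v) u - D f (x + s *\<^sub>R u + 0 *\<^sub>R v) u)"
    unfolding G_def using h by (intro MVT2 DERIV_diff line f) auto
  then obtain s where s: "0 < s" "s < h" and
    G: "G h - G 0 = h * (D f (x + s *\<^sub>R u + h *\<^sub>R v) u - D f (x + s *\<^sub>R u + 0 *\<^sub>R v) u)"
    by auto
  have "\<exists>t>0. t < h \<and> D f (x + s *\<^sub>R u + h *\<^sub>R v) u - D f (x + s *\<^sub>R u + 0 *\<^sub>R v) u =
      (h - 0) * D (\<lambda>z. D f z u) (x + s *\<^sub>R u + t *\<^sub>R v) v"
    using h s by (intro MVT2 line'[of "\<lambda>z. D f z u"] smooth_on_D f) auto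
  then obtain t where t: "0 < t" "t < h" and
    E: "D f (x + s *\<^sub>R u + h *\<^sub>R v) u - D f (x + s *\<^sub>R u + 0 *\<^sub>R v) u =
      h * D (\<lambda>z. D f z u) (x + s *\<^sub>R u + t *\<^sub>R v) v"
    by auto
  have "f (x + h *\<^sub>R u + h *\<^sub>R v) - f (x + h *\<^sub>R u) - f (x + h *\<^sub>R v) + f x =
    h * (h * D (\<lambda>z. D f z u) (x + s *\<^sub>R u + t *\<^sub>R v) v)"
    using G unfolding E G_def by simp
  with s t show ?thesis by (intro exI[of _ s] exI[of _ t]) (simp add: mult.assoc)
qed

text \<open>If the two mixed derivatives differed at \<open>x\<close>, continuity would keep them apart on a small ball,
  while second differences of small step equal values of either one inside that ball.\<close>
lemma second_derivative_symmetric_real: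
  fixes f :: "'a::euclidean_space \<Rightarrow> real"
  assumes S: "open S" and f: "smooth_on S f" and x: "x \<in> S"
  shows "D (\<lambda>z. D f z u) x v = D (\<lambda>z. D f z v) x u"
proof (rule ccontr)
  let ?p = "\<lambda>z. D (\<lambda>z. D f z u) z v" and ?q = "\<lambda>z. D (\<lambda>z. D f z v) z u"
  assume ne: "?p x \<noteq> ?q x"
  define e where "e = \<bar>?p x - ?q x\<bar> / 2"
  have e: "e > 0" using ne by (simp add: e_def)
  have "continuous_on S ?p" "continuous_on S ?q"
    by (intro smooth_on_imp_continuous_on smooth_on_D f)+
  then have "isCont ?p x" "isCont ?q x"
    using S x by (simp_all add: continuous_on_eq_continuous_at)
  then have "\<exists>d>0. \<forall>y. dist y x < d \<longrightarrow> dist (?p y) (?p x) < e"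
    "\<exists>d>0. \<forall>y. dist y x < d \<longrightarrow> dist (?q y) (?q x) < e"
    using e by (simp_all add: continuous_at_eps_delta)
  then obtain d1 d2 where d: "d1 > 0" "\<And>y. dist y x < d1 \<Longrightarrow> dist (?p y) (?p x) < e"
      "d2 > 0" "\<And>y. dist y x < d2 \<Longrightarrow> dist (?q y) (?q x) < e"
    by metis
  obtain d3 where d3: "d3 > 0" "ball x d3 \<subseteq> S" using S x openE by blast
  define d where "d = min d1 (min d2 d3)"
  have dpos: "d > 0" using d d3 by (simp add: d_def)
  define h where "h = d / (2 * (norm u + norm v + 1))"
  have h: "h > 0" using dpos by (simp add: h_def add_nonneg_pos)
  have close: "dist (x + s *\<^sub>R a + t *\<^sub>R b) x < d"
    if "0 \<le> s" "s \<le> h" "0 \<le> t" "t \<le> h" "norm a + norm b = norm u + norm v" for s t a b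
  proof -
    have "dist (x + s *\<^sub>R a + t *\<^sub>R b) x = norm (s *\<^sub>R a + t *\<^sub>R b)" by (simp add: dist_norm add.assoc)
    also have "\<dots> \<le> s * norm a + t * norm b"
      using that by (intro order.trans[OF norm_triangle_ineq]) simp
    also have "\<dots> \<le> h * norm a + h * norm b" using that by (intro add_mono mult_right_mono) auto
    also have "\<dots> = h * (norm u + norm v)" using that by (simp flip: distrib_left)
    also have "\<dots> < h * (2 * (norm u + norm v + 1))"
      by (intro mult_strict_left_mono h) (smt (verit) norm_ge_zero)
    also have "\<dots> = d" by (simp add: h_def add_nonneg_eq_0_iff)
    finally show ?thesis .
  qed
  have inS: "x + s *\<^sub>R a + t *\<^sub>R b \<in> S"
    if "0 \<le> s" "s \<le> h" "0 \<le> t" "t \<le> h" "norm a + norm b = norm u + norm v" for s t a b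
    using close[OF that] d3 by (auto simp: d_def dist_commute subset_iff)
  obtain s t where 1: "0 \<le> s" "s \<le> h" "0 \<le> t" "t \<le> h"
    "f (x + h *\<^sub>R u + h *\<^sub>R v) - f (x + h *\<^sub>R u) - f (x + h *\<^sub>R v) + f x = h * h * ?p (x + s *\<^sub>R u + t *\<^sub>R v)"
    using second_difference_mvt[OF f h, of x u v] inS by auto
  obtain s' t' where 2: "0 \<le> s'" "s' \<le> h" "0 \<le> t'" "t' \<le> h"
    "f (x + h *\<^sub>R v + h *\<^sub>R u) - f (x + h *\<^sub>R v) - f (x + h *\<^sub>R u) + f x = h * h * ?q (x + s' *\<^sub>R v + t' *\<^sub>R u)"
    using second_difference_mvt[OF f h, of x v u] inS by (auto simp: add.commute)
  have "f (x + h *\<^sub>R v + h *\<^sub>R u) = f (x + h *\<^sub>R u + h *\<^sub>R v)" by (simp add: algebra_simps)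
  then have "h * h * ?p (x + s *\<^sub>R u + t *\<^sub>R v) = h * h * ?q (x + s' *\<^sub>R v + t' *\<^sub>R u)"
    using 1(5) 2(5) by linarith
  then have eq: "?p (x + s *\<^sub>R u + t *\<^sub>R v) = ?q (x + s' *\<^sub>R v + t' *\<^sub>R u)" using h by simp
  have "dist (?p (x + s *\<^sub>R u + t *\<^sub>R v)) (?p x) < e"
    using close[OF 1(1-4), of u v] by (intro d(2)) (auto simp: d_def)
  moreover have "dist (?q (x + s' *\<^sub>R v + t' *\<^sub>R u)) (?q x) < e"
    using close[OF 2(1-4), of v u] by (intro d(4)) (auto simp: d_def)
  ultimately have "dist (?p x) (?q x) < e + e"
    unfolding eq by (intro dist_triangle_less_add[of _ "?q (x + s' *\<^sub>R v + t' *\<^sub>R u)"])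
      (simp_all add: dist_commute)
  then show False by (simp add: e_def dist_real_def)
qed

lemma second_derivative_symmetric:
  fixes f :: "'a::euclidean_space \<Rightarrow> 'b::euclidean_space"
  assumes S: "open S" and f: "smooth_on S f" and x: "x \<in> S"
  shows "D (\<lambda>z. D f z u) x v = D (\<lambda>z. D f z v) x u"
proof (rule euclidean_eqI)
  fix b :: 'b assume "b \<in> Basis"
  have i: "D (\<lambda>z. g z \<bullet> b) z w = D g z w \<bullet> b" if "smooth_on S g" "z \<in> S" for g :: "'a \<Rightarrow> 'b" and z w
    using D_eqI[OF has_derivative_inner_left[OF smooth_on_has_derivative[OF that]]] by simp
  have j: "D (\<lambda>z. D f z w) x w' \<bullet> b = D (\<lambda>z. D (\<lambda>z. f z \<bullet> b) z w) x w'" for w w'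
  proof -
    have "D (\<lambda>z. D f z w) x w' \<bullet> b = D (\<lambda>z. D f z w \<bullet> b) x w'"
      by (rule i[symmetric]) (use f x in \<open>auto intro: smooth_on_D\<close>)
    also have "\<dots> = D (\<lambda>z. D (\<lambda>z. f z \<bullet> b) z w) x w'"
      by (subst D_cong_open[OF S x, of _ "\<lambda>z. D (\<lambda>z. f z \<bullet> b) z w"]) (use i[OF f] in auto)
    finally show ?thesis .
  qed
  show "D (\<lambda>z. D f z u) x v \<bullet> b = D (\<lambda>z. D f z v) x u \<bullet> b"
    unfolding j by (rule second_derivative_symmetric_real[OF S smooth_on_inner_left[OF S f] x])
qed

section \<open>The Poincare lemma on convex open sets\<close>

text \<open>The primitive is the integral of \<open>\<alpha>\<close> along the segments that start at a fixed point.  Its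
  derivative is found by differentiating under the integral sign; closedness turns the integrand
  into a total derivative in the parameter of the segment.\<close>
lemma poincare_lemma_convex:
  fixes \<alpha> :: "'a::euclidean_space \<Rightarrow> 'a \<Rightarrow> real"
  assumes S: "open S" "convex S" and a: "lin_field S \<alpha>"
    and closed: "\<And>z u v. z \<in> S \<Longrightarrow> D (\<lambda>z. \<alpha> z v) z u = D (\<lambda>z. \<alpha> z u) z v"
  shows "\<exists>f. smooth_on S f \<and> (\<forall>z\<in>S. \<forall>v. D f z v = \<alpha> z v)"
proof (cases "S = {}")
  case True
  then show ?thesis by (auto intro!: exI[of _ "\<lambda>_. 0"])
next
  case False
  then obtain x0 where x0: "x0 \<in> S" by auto
  define \<gamma> where "\<gamma> x t = x0 + t *\<^sub>R (x - x0)" for x and t :: real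
  have \<gamma>: "\<gamma> x t \<in> S" if "x \<in> S" "t \<in> cbox 0 1" for x t
  proof -
    have "\<gamma> x t = (1 - t) *\<^sub>R x0 + t *\<^sub>R x" by (simp add: \<gamma>_def algebra_simps)
    then show ?thesis using that convexD_alt[OF S(2) x0 that(1), of t] by simp
  qed
  define f where "f x = integral (cbox 0 1) (\<lambda>t. \<alpha> (\<gamma> x t) (x - x0))" for x
  define F where "F x t v = t * D (\<lambda>z. \<alpha> z v) (\<gamma> x t) (x - x0) + \<alpha> (\<gamma> x t) v" for x t v
  have linF: "bounded_linear (F x t)" if "x \<in> S" "t \<in> cbox 0 1" for x t
  proof -
    have "linear (\<lambda>v. t *\<^sub>R D (\<lambda>z. \<alpha> z v) (\<gamma> x t) (x - x0) + \<alpha> (\<gamma> x t) v)"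
      using lin_field_deriv[OF S(1) a] a \<gamma>[OF that]
      by (intro linear_compose_add linear_compose_scale_right) (auto simp: lin_field_def)
    then show ?thesis unfolding F_def[abs_def] by (simp add: linear_conv_bounded_linear)
  qed
  have der: "((\<lambda>x. \<alpha> (\<gamma> x t) (x - x0)) has_derivative F x t) (at x)"
    if x: "x \<in> S" and t: "t \<in> cbox 0 1" for x t
  proof -
    note g = \<gamma>[OF x t]
    show ?thesis
    proof (cases "t = 0")
      case True
      have "linear (\<alpha> x0)" using a x0 by (auto simp: lin_field_def)
      then have "bounded_linear (\<alpha> x0)" by (simp add: linear_conv_bounded_linear)
      moreover have "((\<lambda>x. x - x0) has_derivative (\<lambda>u. u)) (at x)"
        by (auto intro!: derivative_eq_intros)
      ultimately have "((\<lambda>x. \<alpha> x0 (x - x0)) has_derivative \<alpha> x0) (at x)"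
        by (rule bounded_linear.has_derivative)
      then show ?thesis using True by (simp add: F_def[abs_def] \<gamma>_def)
    next
      case False
      \<comment> \<open>in terms of \<open>z = \<gamma> x t\<close> the integrand is \<open>\<alpha> z ((z - x0) / t)\<close>\<close>
      have 1: "((\<lambda>z. \<alpha> z ((1/t) *\<^sub>R (z - x0))) has_derivative
          (\<lambda>u. D (\<lambda>z. \<alpha> z ((1/t) *\<^sub>R (\<gamma> x t - x0))) (\<gamma> x t) u + \<alpha> (\<gamma> x t) ((1/t) *\<^sub>R u))) (at (\<gamma> x t))"
        by (rule lin_field_has_derivative[OF S(1) a g]) (auto intro!: derivative_eq_intros)
      have 2: "((\<lambda>x. \<gamma> x t) has_derivative (\<lambda>u. t *\<^sub>R u)) (at x)"
        unfolding \<gamma>_def by (auto intro!: derivative_eq_intros)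
      have e: "(1/t) *\<^sub>R (\<gamma> y t - x0) = y - x0" for y using False by (simp add: \<gamma>_def)
      have "((\<lambda>x. \<alpha> (\<gamma> x t) (x - x0)) has_derivative
          (\<lambda>u. D (\<lambda>z. \<alpha> z (x - x0)) (\<gamma> x t) (t *\<^sub>R u) + \<alpha> (\<gamma> x t) u)) (at x)"
        using has_derivative_compose[OF 2 1] False unfolding e by simp
      moreover have "D (\<lambda>z. \<alpha> z (x - x0)) (\<gamma> x t) (t *\<^sub>R u) = t * D (\<lambda>z. \<alpha> z u) (\<gamma> x t) (x - x0)" for u
      proof -
        have "linear (D (\<lambda>z. \<alpha> z (x - x0)) (\<gamma> x t))"
          using a g by (intro linear_frechet_derivative smooth_on_imp_differentiable[of S])
            (auto simp: lin_field_def)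
        then show ?thesis using closed[OF g] by (simp add: linear_scale)
      qed
      ultimately show ?thesis by (simp add: F_def[abs_def])
    qed
  qed
  have cont\<gamma>: "continuous_on (S \<times> cbox 0 1) (\<lambda>p. \<gamma> (fst p) (snd p))"
    unfolding \<gamma>_def by (intro continuous_intros)
  have contF: "continuous_on (S \<times> cbox 0 1) (\<lambda>(x, t). Blinfun (F x t))"
  proof (rule continuous_on_blinfun_componentwise)
    fix b :: 'a
    have Db: "lin_field S (D (\<lambda>z. \<alpha> z b))" using a by (intro lin_field_D) (auto simp: lin_field_def)
    have im: "(\<lambda>p. \<gamma> (fst p) (snd p)) ` (S \<times> cbox 0 1) \<subseteq> S"
      using \<gamma> by auto
    have "continuous_on (S \<times> cbox 0 1)
        (\<lambda>p. D (\<lambda>z. \<alpha> z b) (\<gamma> (fst p) (snd p)) (fst p - x0))"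
      by (rule continuous_on_lin_field[OF Db cont\<gamma> im]) (intro continuous_intros)
    then have "continuous_on (S \<times> cbox 0 1) (\<lambda>p. F (fst p) (snd p) b)"
      unfolding F_def
      by (intro continuous_on_add continuous_on_mult continuous_on_snd continuous_on_id
          continuous_on_lin_field[OF a cont\<gamma> im continuous_on_const])
    moreover have "F (fst p) (snd p) b = blinfun_apply (case p of (x, t) \<Rightarrow> Blinfun (F x t)) b"
      if "p \<in> S \<times> cbox 0 1" for p
      using that linF by (auto simp: bounded_linear_Blinfun_apply)
    ultimately show "continuous_on (S \<times> cbox 0 1)
        (\<lambda>p. blinfun_apply (case p of (x, t) \<Rightarrow> Blinfun (F x t)) b)"
      by (rule continuous_on_eq)
  qed
  have contx: "continuous_on (cbox 0 1) (\<lambda>t. Blinfun (F x t))" if "x \<in> S" for x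
  proof -
    have "continuous_on (cbox 0 (1::real)) (Pair x)" by (intro continuous_intros)
    then show ?thesis
      using continuous_on_compose2[OF contF, of "cbox 0 1" "Pair x"] that by auto
  qed
  have main: "(f has_derivative \<alpha> x) (at x)" if x: "x \<in> S" for x
  proof -
    have "(f has_derivative blinfun_apply (integral (cbox 0 1) (\<lambda>t. Blinfun (F x t)))) (at x within S)"
      unfolding f_def
    proof (rule leibniz_rule[OF _ _ contF x S(2)])
      show "((\<lambda>x. \<alpha> (\<gamma> x t) (x - x0)) has_derivative blinfun_apply (Blinfun (F y t))) (at y within S)"
        if "y \<in> S" "t \<in> cbox 0 1" for y t
        using der[OF that] linF[OF that]
        by (simp add: bounded_linear_Blinfun_apply has_derivative_at_withinI)
      show "(\<lambda>t. \<alpha> (\<gamma> y t) (y - x0)) integrable_on cbox 0 1" if "y \<in> S" for y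
        by (intro integrable_continuous continuous_on_lin_field[OF a] continuous_on_const)
          (use \<gamma>[OF that] in \<open>auto simp: \<gamma>_def intro!: continuous_intros\<close>)
    qed
    moreover have eq: "blinfun_apply (integral (cbox 0 1) (\<lambda>t. Blinfun (F x t))) v = \<alpha> x v" for v
    proof -
      have "blinfun_apply (integral (cbox 0 1) (\<lambda>t. Blinfun (F x t))) v =
          integral (cbox 0 1) (\<lambda>t. blinfun_apply (Blinfun (F x t)) v)"
        by (intro blinfun_apply_integral integrable_continuous contx x)
      also have "\<dots> = integral (cbox 0 1) (\<lambda>t. F x t v)"
        using linF[OF x] by (intro integral_cong) (simp add: bounded_linear_Blinfun_apply)
      also have "\<dots> = integral {0..1} (\<lambda>t. F x t v)" by (simp add: cbox_interval)
      also have "\<dots> = 1 * \<alpha> (\<gamma> x 1) v - 0 * \<alpha> (\<gamma> x 0) v"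
      proof (intro integral_unique fundamental_theorem_of_calculus)
        \<comment> \<open>closedness of \<open>\<alpha>\<close> has made \<open>F x t v\<close> the derivative of \<open>t * \<alpha> (\<gamma> x t) v\<close>\<close>
        fix t :: real assume t: "t \<in> {0..1}"
        then have g: "\<gamma> x t \<in> S" using \<gamma>[OF x] by simp
        have s: "((\<lambda>z. \<alpha> z v) has_derivative D (\<lambda>z. \<alpha> z v) (\<gamma> x t)) (at (\<gamma> x t))"
          using a g by (intro smooth_on_has_derivative[of S]) (auto simp: lin_field_def)
        have "((\<lambda>t. \<alpha> (\<gamma> x t) v) has_real_derivative D (\<lambda>z. \<alpha> z v) (\<gamma> x t) (x - x0)) (at t)"
          by (rule has_real_derivative_along_line[where p="\<gamma> x", OF s])
            (auto simp: \<gamma>_def[abs_def] intro!: derivative_eq_intros)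
        then have "((\<lambda>t. t * \<alpha> (\<gamma> x t) v) has_real_derivative F x t v) (at t)"
          unfolding F_def by (auto intro!: derivative_eq_intros)
        then show "((\<lambda>t. t * \<alpha> (\<gamma> x t) v) has_vector_derivative F x t v) (at t within {0..1})"
          by (simp add: has_real_derivative_iff_has_vector_derivative has_vector_derivative_at_within)
      qed simp
      finally show ?thesis by (simp add: \<gamma>_def)
    qed
    moreover have "blinfun_apply (integral (cbox 0 1) (\<lambda>t. Blinfun (F x t))) = \<alpha> x"
      by (rule ext) (rule eq)
    ultimately show ?thesis using at_within_open[OF x S(1)] by simp
  qed
  have "Ck_on k S f" for k
  proof (cases k)
    case 0
    then show ?thesis
      using main S(1) by (auto intro!: has_derivative_continuous continuous_at_imp_continuous_on)
  next
    case (Suc j)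
    have "Ck_on j S (\<lambda>x. D f x v)" for v
      by (rule Ck_on_cong[OF S(1), of "\<lambda>x. \<alpha> x v"])
        (use a D_eqI[OF main] in \<open>auto simp: lin_field_def smooth_on_def\<close>)
    then show ?thesis using Suc main by (auto simp: differentiable_def)
  qed
  then show ?thesis using D_eqI[OF main] by (intro exI[of _ f]) (simp add: smooth_on_def)
qed

section \<open>Naturality of the exterior derivative and of the Lie bracket\<close>

lemma D_compose:
  assumes "smooth_on T g" "f x \<in> T" "f differentiable at x"
  shows "D (\<lambda>z. g (f z)) x u = D g (f x) (D f x u)"
  using D_eqI[OF has_derivative_compose[OF has_derivative_D[OF assms(3)]
        smooth_on_has_derivative[OF assms(1,2)]]] by simp

lemma lin_field_pullback:
  assumes S: "open S" and \<phi>: "smooth_on S \<phi>" "\<phi> ` S \<subseteq> T" and L: "lin_field T L"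
  shows "lin_field S (\<lambda>z. L (\<phi> z))"
  unfolding lin_field_def
proof (intro conjI ballI allI)
  show "linear (L (\<phi> z))" if "z \<in> S" for z
    using lin_fieldD(1)[OF L] \<phi>(2) that by blast
  show "smooth_on S (\<lambda>z. L (\<phi> z) a)" for a
    by (rule smooth_on_compose[OF S \<phi>(2,1) lin_fieldD(2)[OF L]])
qed

lemma bilin_field_pullback:
  assumes S: "open S" and \<phi>: "smooth_on S \<phi>" "\<phi> ` S \<subseteq> T" and s: "bilin_field T s"
  shows "bilin_field S (\<lambda>z. s (\<phi> z))"
  using s unfolding bilin_field_def
  by (auto intro: lin_field_pullback[OF S \<phi>, of "\<lambda>z b. s z a b" for a]
      lin_field_pullback[OF S \<phi>, of "\<lambda>z b. s z b a" for a])

text \<open>The derivative of \<open>D \<phi>\<close> enters symmetrically and cancels, whence \<open>d\<phi>\<^sup>*\<alpha> = \<phi>\<^sup>*d\<alpha>\<close>.\<close>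
lemma d1_pullback:
  fixes \<alpha> :: "'b::euclidean_space \<Rightarrow> 'b \<Rightarrow> 'c::real_normed_vector"
    and \<phi> :: "'a::euclidean_space \<Rightarrow> 'b"
  assumes S: "open S" and \<phi>: "smooth_on S \<phi>" "\<phi> ` S \<subseteq> T" and a: "lin_field T \<alpha>" and x: "x \<in> S"
  shows "D (\<lambda>z. \<alpha> (\<phi> z) (D \<phi> z v)) x u - D (\<lambda>z. \<alpha> (\<phi> z) (D \<phi> z u)) x v =
    D (\<lambda>z. \<alpha> z (D \<phi> x v)) (\<phi> x) (D \<phi> x u) - D (\<lambda>z. \<alpha> z (D \<phi> x u)) (\<phi> x) (D \<phi> x v)"
proof -
  have "D (\<lambda>z. \<alpha> (\<phi> z) (D \<phi> z v)) x u =
      D (\<lambda>z. \<alpha> z (D \<phi> x v)) (\<phi> x) (D \<phi> x u) + \<alpha> (\<phi> x) (D (\<lambda>z. D \<phi> z v) x u)" for u v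
  proof -
    have "D (\<lambda>z. \<alpha> (\<phi> z) (D \<phi> z v)) x u =
        D (\<lambda>z. \<alpha> (\<phi> z) (D \<phi> x v)) x u + \<alpha> (\<phi> x) (D (\<lambda>z. D \<phi> z v) x u)"
      by (rule lin_field_D_apply[OF S lin_field_pullback[OF S \<phi> a] x smooth_on_D[OF \<phi>(1)]])
    also have "D (\<lambda>z. \<alpha> (\<phi> z) (D \<phi> x v)) x u = D (\<lambda>z. \<alpha> z (D \<phi> x v)) (\<phi> x) (D \<phi> x u)"
      by (rule D_compose[OF lin_fieldD(2)[OF a]])
        (use \<phi> x in \<open>auto intro: smooth_on_imp_differentiable\<close>)
    finally show ?thesis .
  qed
  then show ?thesis using second_derivative_symmetric[OF S \<phi>(1) x, of u v] by simp
qed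

text \<open>The second derivatives of \<open>\<phi>\<close> cancel in pairs, by their symmetry and by the skewness of \<open>s\<close>.\<close>
lemma d2_pullback:
  fixes s :: "'b::euclidean_space \<Rightarrow> 'b \<Rightarrow> 'b \<Rightarrow> 'c::real_normed_vector"
    and \<phi> :: "'a::euclidean_space \<Rightarrow> 'b"
  assumes S: "open S" and \<phi>: "smooth_on S \<phi>" "\<phi> ` S \<subseteq> T" and s: "bilin_field T s" and x: "x \<in> S"
    and alt: "\<And>a b. s (\<phi> x) a b = - s (\<phi> x) b a"
  shows "D (\<lambda>z. s (\<phi> z) (D \<phi> z v) (D \<phi> z w)) x u - D (\<lambda>z. s (\<phi> z) (D \<phi> z u) (D \<phi> z w)) x v
      + D (\<lambda>z. s (\<phi> z) (D \<phi> z u) (D \<phi> z v)) x w =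
    D (\<lambda>z. s z (D \<phi> x v) (D \<phi> x w)) (\<phi> x) (D \<phi> x u)
      - D (\<lambda>z. s z (D \<phi> x u) (D \<phi> x w)) (\<phi> x) (D \<phi> x v)
      + D (\<lambda>z. s z (D \<phi> x u) (D \<phi> x v)) (\<phi> x) (D \<phi> x w)"
proof -
  have e: "D (\<lambda>z. s (\<phi> z) (D \<phi> z v) (D \<phi> z w)) x u =
      D (\<lambda>z. s z (D \<phi> x v) (D \<phi> x w)) (\<phi> x) (D \<phi> x u)
      + s (\<phi> x) (D (\<lambda>z. D \<phi> z v) x u) (D \<phi> x w) + s (\<phi> x) (D \<phi> x v) (D (\<lambda>z. D \<phi> z w) x u)"
    for u v w
  proof -
    have "D (\<lambda>z. s (\<phi> z) (D \<phi> z v) (D \<phi> z w)) x u =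
        D (\<lambda>z. s (\<phi> z) (D \<phi> x v) (D \<phi> x w)) x u
        + s (\<phi> x) (D (\<lambda>z. D \<phi> z v) x u) (D \<phi> x w) + s (\<phi> x) (D \<phi> x v) (D (\<lambda>z. D \<phi> z w) x u)"
      by (rule bilin_field_D_apply[OF S bilin_field_pullback[OF S \<phi> s] x
            smooth_on_D[OF \<phi>(1)] smooth_on_D[OF \<phi>(1)]])
    also have "D (\<lambda>z. s (\<phi> z) (D \<phi> x v) (D \<phi> x w)) x u =
        D (\<lambda>z. s z (D \<phi> x v) (D \<phi> x w)) (\<phi> x) (D \<phi> x u)"
      by (rule D_compose[OF lin_fieldD(2)[OF bilin_fieldD(1)[OF s]]])
        (use \<phi> x in \<open>auto intro: smooth_on_imp_differentiable\<close>)
    finally show ?thesis .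
  qed
  show ?thesis
    unfolding e
    using second_derivative_symmetric[OF S \<phi>(1) x, of u v]
      second_derivative_symmetric[OF S \<phi>(1) x, of u w]
      second_derivative_symmetric[OF S \<phi>(1) x, of v w]
      alt[of "D \<phi> x v" "D (\<lambda>z. D \<phi> z w) x u"]
    by simp
qed

text \<open>Differentiating \<open>Y' \<circ> \<phi> = D \<phi> Y\<close> along \<open>X\<close> and \<open>X' \<circ> \<phi> = D \<phi> X\<close> along \<open>Y\<close> produces the same
  term with second derivatives of \<open>\<phi>\<close>.\<close>
lemma lie_bracket_pushforward:
  fixes \<phi> :: "'a::euclidean_space \<Rightarrow> 'b::euclidean_space"
  assumes S: "open S" and \<phi>: "smooth_on S \<phi>" "\<phi> ` S \<subseteq> T" and x: "x \<in> S"
    and X: "smooth_on S X" "smooth_on T X'" "\<And>z. z \<in> S \<Longrightarrow> X' (\<phi> z) = D \<phi> z (X z)"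
    and Y: "smooth_on S Y" "smooth_on T Y'" "\<And>z. z \<in> S \<Longrightarrow> Y' (\<phi> z) = D \<phi> z (Y z)"
  shows "D Y' (\<phi> x) (X' (\<phi> x)) - D X' (\<phi> x) (Y' (\<phi> x)) = D \<phi> x (D Y x (X x) - D X x (Y x))"
proof -
  have e: "D Y' (\<phi> x) (D \<phi> x u) = D (\<lambda>z. D \<phi> z (Y x)) x u + D \<phi> x (D Y x u)"
    if "smooth_on S Y" "smooth_on T Y'" "\<And>z. z \<in> S \<Longrightarrow> Y' (\<phi> z) = D \<phi> z (Y z)" for Y Y' u
  proof -
    have "D Y' (\<phi> x) (D \<phi> x u) = D (\<lambda>z. Y' (\<phi> z)) x u"
      by (rule D_compose[OF that(2), symmetric])
        (use \<phi> x in \<open>auto intro: smooth_on_imp_differentiable\<close>)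
    also have "\<dots> = D (\<lambda>z. D \<phi> z (Y z)) x u"
      using D_cong_open[OF S x, of "\<lambda>z. Y' (\<phi> z)" "\<lambda>z. D \<phi> z (Y z)"] that(3) by simp
    also have "\<dots> = D (\<lambda>z. D \<phi> z (Y x)) x u + D \<phi> x (D Y x u)"
      by (rule lin_field_D_apply[OF S lin_field_D[OF \<phi>(1)] x that(1)])
    finally show ?thesis .
  qed
  have "linear (D \<phi> x)" using lin_fieldD(1)[OF lin_field_D[OF \<phi>(1)] x] .
  then show ?thesis
    using e[OF X, of "Y x"] e[OF Y, of "X x"] second_derivative_symmetric[OF S \<phi>(1) x, of "X x" "Y x"]
    by (simp add: linear_diff X(3)[OF x] Y(3)[OF x])
qed

section \<open>Charts and tangent vectors\<close>

lemma scaleR_fun_apply: "(r *\<^sub>R f) x = r *\<^sub>R f x"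
  by (simp add: scaleR_fun_def)

locale atlas =
  fixes A :: "('m, 'e::euclidean_space) chart set"
  assumes atlas: "smooth_atlas A"
begin

abbreviation coords :: "('m, 'e) chart \<Rightarrow> 'm set \<Rightarrow> 'e set"
  where "coords c U \<equiv> snd c ` (fst c \<inter> U)"

lemma chart_inv_chart [simp]: "c \<in> A \<Longrightarrow> x \<in> fst c \<Longrightarrow> chart_inv c (snd c x) = x"
  using atlas by (auto simp: smooth_atlas_def chart_inv_def intro: inv_into_f_f)

lemma coordsD:
  assumes "c \<in> A" "y \<in> coords c U"
  shows "chart_inv c y \<in> fst c" "chart_inv c y \<in> U" "snd c (chart_inv c y) = y"
  using assms by auto

lemma open_coords: "c \<in> A \<Longrightarrow> openin (atlas_topology A) U \<Longrightarrow> open (coords c U)"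
  by (simp add: openin_atlas_topology[OF atlas])

lemma open_overlap: "c \<in> A \<Longrightarrow> c' \<in> A \<Longrightarrow> open (coords c (fst c'))"
  using atlas by (simp add: smooth_atlas_def)

lemma openin_points: "openin (atlas_topology A) (points A)"
proof -
  have "fst c \<inter> points A = fst c" if "c \<in> A" for c using that by (auto simp: points_def)
  then show ?thesis using atlas by (simp add: openin_atlas_topology[OF atlas] smooth_atlas_def)
qed

lemma openin_subset_points: "openin (atlas_topology A) U \<Longrightarrow> U \<subseteq> points A"
  by (simp add: openin_atlas_topology[OF atlas])

lemma charts_atD: "c \<in> charts_at A x \<Longrightarrow> c \<in> A" "c \<in> charts_at A x \<Longrightarrow> x \<in> fst c"
  by (auto simp: charts_at_def)

lemma charts_at_point: "c \<in> charts_at A x \<Longrightarrow> x \<in> points A"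
  by (auto simp: charts_at_def points_def)

lemma charts_atI: "c \<in> A \<Longrightarrow> x \<in> fst c \<Longrightarrow> c \<in> charts_at A x"
  by (auto simp: charts_at_def)

lemma charts_at_coords: "c \<in> A \<Longrightarrow> y \<in> coords c U \<Longrightarrow> c \<in> charts_at A (chart_inv c y)"
  by (rule charts_atI) (auto simp: coordsD)

lemma chart_at: "x \<in> points A \<Longrightarrow> chart_at A x \<in> charts_at A x"
  unfolding chart_at_def by (rule someI_ex) (auto simp: points_def charts_at_def)

lemma snd_in_coords: "c \<in> charts_at A x \<Longrightarrow> x \<in> U \<Longrightarrow> snd c x \<in> coords c U"
  by (auto simp: charts_at_def)

lemma coords_Int: "c \<in> A \<Longrightarrow> coords c (U \<inter> V) = coords c U \<inter> coords c V"
  using atlas unfolding smooth_atlas_def inj_on_def by fastforce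

lemma transition_smooth: "c \<in> A \<Longrightarrow> c' \<in> A \<Longrightarrow> smooth_on (coords c (fst c')) (transition c c')"
  using atlas by (simp add: smooth_atlas_def)

lemma transition_chart: "c \<in> A \<Longrightarrow> x \<in> fst c \<Longrightarrow> transition c c' (snd c x) = snd c' x"
  by (simp add: transition_def)

lemma chart_inv_transition:
  "c \<in> A \<Longrightarrow> c' \<in> A \<Longrightarrow> y \<in> coords c (fst c') \<Longrightarrow> chart_inv c' (transition c c' y) = chart_inv c y"
  by (auto simp: transition_def)

lemma transition_in_coords:
  "c \<in> A \<Longrightarrow> c' \<in> A \<Longrightarrow> y \<in> coords c (fst c' \<inter> U) \<Longrightarrow> transition c c' y \<in> coords c' U"
  by (auto simp: transition_def)

lemma transition_has_derivative:
  assumes "c \<in> charts_at A x" "c' \<in> charts_at A x"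
  shows "(transition c c' has_derivative D (transition c c') (snd c x)) (at (snd c x))"
  using assms by (intro smooth_on_has_derivative[OF transition_smooth]) (auto simp: charts_at_def)

lemma transition_D_linear:
  "c \<in> charts_at A x \<Longrightarrow> c' \<in> charts_at A x \<Longrightarrow> linear (D (transition c c') (snd c x))"
  by (rule has_derivative_linear[OF transition_has_derivative])

lemma transition_D_compose:
  assumes c: "c \<in> charts_at A x" "c' \<in> charts_at A x" "c'' \<in> charts_at A x"
  shows "D (transition c' c'') (snd c' x) (D (transition c c') (snd c x) e) =
    D (transition c c'') (snd c x) e"
proof -
  have A: "c \<in> A" "c' \<in> A" "c'' \<in> A" and x: "x \<in> fst c" "x \<in> fst c'" "x \<in> fst c''"
    using c by (auto simp: charts_at_def)
  let ?S = "coords c (fst c' \<inter> fst c'')"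
  have S: "open ?S" unfolding coords_Int[OF A(1)] by (intro open_Int open_overlap A)
  have "D (\<lambda>z. transition c' c'' (transition c c' z)) (snd c x) e =
      D (transition c' c'') (transition c c' (snd c x)) (D (transition c c') (snd c x) e)"
    using x A transition_has_derivative[OF c(1,2)]
    by (intro D_compose[OF transition_smooth[OF A(2,3)]])
      (auto simp: transition_chart differentiable_def)
  moreover have "D (\<lambda>z. transition c' c'' (transition c c' z)) (snd c x) = D (transition c c'') (snd c x)"
    by (rule D_cong_open[OF S]) (use A x in \<open>auto simp: transition_def\<close>)
  ultimately show ?thesis by (simp add: transition_chart A x)
qed

lemma transition_D_self:
  assumes "c \<in> charts_at A x"
  shows "D (transition c c) (snd c x) e = e"
proof -
  have "D (transition c c) (snd c x) = D (\<lambda>z. z) (snd c x)"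
    by (rule D_cong_open[OF open_overlap[of c c]])
      (use assms in \<open>auto simp: charts_at_def transition_def\<close>)
  then show ?thesis by simp
qed

lemma tangent_component:
  "v \<in> tangent_space A x \<Longrightarrow> c \<in> charts_at A x \<Longrightarrow> c' \<in> charts_at A x \<Longrightarrow>
    v c' = D (transition c c') (snd c x) (v c)"
  unfolding tangent_space_def by blast

lemma coord_vector_component:
  "c' \<in> charts_at A x \<Longrightarrow> coord_vector A c x e c' = D (transition c c') (snd c x) e"
  by (simp add: coord_vector_def)

lemma coord_vector_self [simp]: "c \<in> charts_at A x \<Longrightarrow> coord_vector A c x e c = e"
  by (simp add: coord_vector_def transition_D_self)

lemma coord_vector_tangent [simp]:
  "c \<in> charts_at A x \<Longrightarrow> coord_vector A c x e \<in> tangent_space A x"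
  by (simp add: tangent_space_def coord_vector_def transition_D_compose)

lemma tangent_outside: "v \<in> tangent_space A x \<Longrightarrow> c \<notin> charts_at A x \<Longrightarrow> v c = 0"
  unfolding tangent_space_def by blast

lemma tangentI:
  assumes "\<And>c. c \<notin> charts_at A x \<Longrightarrow> v c = 0"
    and "\<And>c c'. c \<in> charts_at A x \<Longrightarrow> c' \<in> charts_at A x \<Longrightarrow> v c' = D (transition c c') (snd c x) (v c)"
  shows "v \<in> tangent_space A x"
  using assms unfolding tangent_space_def by blast

lemma coord_vector_components:
  assumes "c \<in> charts_at A x" "v \<in> tangent_space A x"
  shows "coord_vector A c x (v c) = v"
proof
  fix c'
  show "coord_vector A c x (v c) c' = v c'"
    using tangent_component[OF assms(2,1), of c'] tangent_outside[OF assms(2), of c']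
    by (simp add: coord_vector_def)
qed

lemma tangent_eqI:
  "c \<in> charts_at A x \<Longrightarrow> v \<in> tangent_space A x \<Longrightarrow> w \<in> tangent_space A x \<Longrightarrow> v c = w c \<Longrightarrow> v = w"
  by (metis coord_vector_components)

lemma coord_vector_change:
  assumes "c \<in> charts_at A x" "c' \<in> charts_at A x"
  shows "coord_vector A c x e = coord_vector A c' x (D (transition c c') (snd c x) e)"
  by (rule tangent_eqI[OF assms(2)]) (use assms in \<open>auto simp: coord_vector_component\<close>)

lemma tangent_scaleR: "v \<in> tangent_space A x \<Longrightarrow> r *\<^sub>R v \<in> tangent_space A x"
proof (rule tangentI)
  fix c c' assume v: "v \<in> tangent_space A x" and c: "c \<in> charts_at A x" "c' \<in> charts_at A x"
  show "(r *\<^sub>R v) c' = D (transition c c') (snd c x) ((r *\<^sub>R v) c)"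
    unfolding scaleR_fun_apply linear_scale[OF transition_D_linear[OF c]] tangent_component[OF v c] ..
qed (simp add: scaleR_fun_apply tangent_outside)

lemma tangent_add:
  "v \<in> tangent_space A x \<Longrightarrow> w \<in> tangent_space A x \<Longrightarrow> v + w \<in> tangent_space A x"
proof (rule tangentI)
  fix c c' assume v: "v \<in> tangent_space A x" "w \<in> tangent_space A x"
    and c: "c \<in> charts_at A x" "c' \<in> charts_at A x"
  show "(v + w) c' = D (transition c c') (snd c x) ((v + w) c)"
    unfolding plus_fun_apply linear_add[OF transition_D_linear[OF c]]
      tangent_component[OF v(1) c] tangent_component[OF v(2) c] ..
qed (simp add: tangent_outside)

lemma tangent_minus: "v \<in> tangent_space A x \<Longrightarrow> - v \<in> tangent_space A x"
  using tangent_scaleR[of v x "-1"] by simp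

lemma tangent_diff:
  "v \<in> tangent_space A x \<Longrightarrow> w \<in> tangent_space A x \<Longrightarrow> v - w \<in> tangent_space A x"
  using tangent_add[OF _ tangent_minus, of v x w] by simp

lemma coord_vector_add:
  assumes "c \<in> charts_at A x"
  shows "coord_vector A c x (a + b) = coord_vector A c x a + coord_vector A c x b"
  by (rule tangent_eqI[OF assms]) (use assms in \<open>auto intro: tangent_add\<close>)

lemma coord_vector_scaleR:
  assumes "c \<in> charts_at A x"
  shows "coord_vector A c x (r *\<^sub>R a) = r *\<^sub>R coord_vector A c x a"
  by (rule tangent_eqI[OF assms]) (use assms in \<open>auto intro: tangent_scaleR simp: scaleR_fun_apply\<close>)

lemma cotangentD:
  assumes "\<xi> \<in> cotangent_space A x"
  shows "\<And>u v. u \<in> tangent_space A x \<Longrightarrow> v \<in> tangent_space A x \<Longrightarrow> \<xi> (u + v) = \<xi> u + \<xi> v"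
    "\<And>r u. u \<in> tangent_space A x \<Longrightarrow> \<xi> (r *\<^sub>R u) = r * \<xi> u"
    "\<And>u. u \<notin> tangent_space A x \<Longrightarrow> \<xi> u = 0"
  using assms by (auto simp: cotangent_space_def linear_on_def)

lemma cotangent_add:
  "\<xi> \<in> cotangent_space A x \<Longrightarrow> \<eta> \<in> cotangent_space A x \<Longrightarrow> \<xi> + \<eta> \<in> cotangent_space A x"
  by (auto simp: cotangent_space_def linear_on_def algebra_simps)

lemma cotangent_scaleR: "\<xi> \<in> cotangent_space A x \<Longrightarrow> r *\<^sub>R \<xi> \<in> cotangent_space A x"
  by (auto simp: cotangent_space_def linear_on_def algebra_simps scaleR_fun_apply)

lemma cotangent_minus: "\<xi> \<in> cotangent_space A x \<Longrightarrow> - \<xi> \<in> cotangent_space A x"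
  using cotangent_scaleR[of \<xi> x "-1"] by simp

lemma cotangent_diff:
  "\<xi> \<in> cotangent_space A x \<Longrightarrow> \<eta> \<in> cotangent_space A x \<Longrightarrow> \<xi> - \<eta> \<in> cotangent_space A x"
  using cotangent_add[OF _ cotangent_minus, of \<xi> x \<eta>] by simp

lemma cotangent_eqI:
  assumes "\<xi> \<in> cotangent_space A x" "\<eta> \<in> cotangent_space A x"
    and "\<And>v. v \<in> tangent_space A x \<Longrightarrow> \<xi> v = \<eta> v"
  shows "\<xi> = \<eta>"
proof
  fix v show "\<xi> v = \<eta> v"
    using assms by (cases "v \<in> tangent_space A x") (auto simp: cotangentD)
qed

lemma cotangent_linear:
  "\<xi> \<in> cotangent_space A x \<Longrightarrow> c \<in> charts_at A x \<Longrightarrow> linear (\<lambda>a. \<xi> (coord_vector A c x a))"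
  by (intro linearI) (simp_all add: coord_vector_add coord_vector_scaleR cotangentD)

lemma restrict0_linear_cotangent:
  assumes "c \<in> charts_at A x" "linear l" "\<And>v. v \<in> tangent_space A x \<Longrightarrow> f v = l (v c)"
  shows "restrict0 (tangent_space A x) f \<in> cotangent_space A x"
  using assms
  by (auto simp: cotangent_space_def restrict0_def linear_on_def tangent_add tangent_scaleR
      linear_add linear_scale scaleR_fun_apply)

section \<open>Fields in coordinates\<close>

lemma local1_chart:
  "c \<in> charts_at A x \<Longrightarrow> local1 A c \<alpha> (snd c x) a = \<alpha> x (coord_vector A c x a)"
  by (simp add: local1_def charts_at_def)

lemma local2_chart:
  "c \<in> charts_at A x \<Longrightarrow>
    local2 A c \<sigma> (snd c x) a b = \<sigma> x (coord_vector A c x a) (coord_vector A c x b)"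
  by (simp add: local2_def charts_at_def)

lemma local1_components:
  assumes "c \<in> charts_at A x" "u \<in> tangent_space A x"
  shows "local1 A c \<alpha> (snd c x) (u c) = \<alpha> x u"
  using assms by (simp add: local1_chart coord_vector_components)

lemma local2_components:
  assumes "c \<in> charts_at A x" "u \<in> tangent_space A x" "v \<in> tangent_space A x"
  shows "local2 A c \<sigma> (snd c x) (u c) (v c) = \<sigma> x u v"
  using assms by (simp add: local2_chart coord_vector_components)

lemma overlap_charts_at:
  assumes "c \<in> A" "c' \<in> A" "y \<in> coords c (fst c')"
  shows "c \<in> charts_at A (chart_inv c y)" "c' \<in> charts_at A (chart_inv c y)"
    "snd c (chart_inv c y) = y" "snd c' (chart_inv c y) = transition c c' y"
  using assms by (auto simp: charts_at_def transition_def)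

lemma local1_change:
  assumes "c \<in> A" "c' \<in> A" "y \<in> coords c (fst c')"
  shows "local1 A c \<alpha> y a = local1 A c' \<alpha> (transition c c' y) (D (transition c c') y a)"
  using coord_vector_change[OF overlap_charts_at(1,2)[OF assms]] assms
  by (simp add: local1_def chart_inv_transition overlap_charts_at(3))

lemma local2_change:
  assumes "c \<in> A" "c' \<in> A" "y \<in> coords c (fst c')"
  shows "local2 A c \<sigma> y a b =
    local2 A c' \<sigma> (transition c c' y) (D (transition c c') y a) (D (transition c c') y b)"
  using coord_vector_change[OF overlap_charts_at(1,2)[OF assms]] assms
  by (simp add: local2_def chart_inv_transition overlap_charts_at(3))

lemma one_form_lin_field:
  assumes "one_form A U \<alpha>" "c \<in> A"
  shows "lin_field (coords c U) (local1 A c \<alpha>)"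
  unfolding lin_field_def
proof (intro conjI ballI allI)
  show "linear (local1 A c \<alpha> y)" if "y \<in> coords c U" for y
    using cotangent_linear[of "\<alpha> (chart_inv c y)" "chart_inv c y" c] assms that coordsD[OF assms(2) that]
    by (auto simp: one_form_def local1_def[abs_def] charts_at_def)
  show "smooth_on (coords c U) (\<lambda>y. local1 A c \<alpha> y a)" for a
    using assms by (auto simp: one_form_def)
qed

lemma two_formD:
  assumes "two_form A U \<sigma>" "x \<in> U"
  shows "\<And>u v w. u \<in> tangent_space A x \<Longrightarrow> v \<in> tangent_space A x \<Longrightarrow> w \<in> tangent_space A x \<Longrightarrow>
      \<sigma> x u (v + w) = \<sigma> x u v + \<sigma> x u w"
    "\<And>u v w. u \<in> tangent_space A x \<Longrightarrow> v \<in> tangent_space A x \<Longrightarrow> w \<in> tangent_space A x \<Longrightarrow>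
      \<sigma> x (v + w) u = \<sigma> x v u + \<sigma> x w u"
    "\<And>u v r. u \<in> tangent_space A x \<Longrightarrow> v \<in> tangent_space A x \<Longrightarrow> \<sigma> x u (r *\<^sub>R v) = r * \<sigma> x u v"
    "\<And>u v r. u \<in> tangent_space A x \<Longrightarrow> v \<in> tangent_space A x \<Longrightarrow> \<sigma> x (r *\<^sub>R v) u = r * \<sigma> x v u"
    "\<And>u. u \<in> tangent_space A x \<Longrightarrow> \<sigma> x u u = 0"
  using assms by (auto simp: two_form_def linear_on_def)

lemma two_form_skew:
  assumes "two_form A U \<sigma>" "x \<in> U" "u \<in> tangent_space A x" "v \<in> tangent_space A x"
  shows "\<sigma> x u v = - \<sigma> x v u"
proof -
  have "\<sigma> x (u + v) (u + v) = \<sigma> x u u + \<sigma> x u v + (\<sigma> x v u + \<sigma> x v v)"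
    using assms(3,4) by (simp add: two_formD(1,2)[OF assms(1,2)] tangent_add)
  then show ?thesis
    using assms(3,4) by (simp add: two_formD(5)[OF assms(1,2)] tangent_add)
qed

lemma two_form_bilin_field:
  assumes s: "two_form A U \<sigma>" and c: "c \<in> A"
  shows "bilin_field (coords c U) (local2 A c \<sigma>)"
  unfolding bilin_field_def lin_field_def
proof (intro conjI ballI allI)
  fix y a assume y: "y \<in> coords c U"
  note x = coordsD(2)[OF c y] and ca = charts_at_coords[OF c y]
  show "linear (local2 A c \<sigma> y a)" "linear (\<lambda>b. local2 A c \<sigma> y b a)"
    by (intro linearI; simp add: local2_def coord_vector_add[OF ca] coord_vector_scaleR[OF ca]
        two_formD[OF s x] ca)+
qed (use s c in \<open>auto simp: two_form_def\<close>)

lemma local2_skew: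
  assumes "two_form A U \<sigma>" "c \<in> A" "y \<in> coords c U"
  shows "local2 A c \<sigma> y a b = - local2 A c \<sigma> y b a"
  unfolding local2_def
  by (rule two_form_skew[OF assms(1) coordsD(2)[OF assms(2,3)]])
    (simp_all add: charts_at_coords[OF assms(2,3)])

text \<open>The operators are defined in a chart that varies with the point.  To differentiate or integrate
  their values over a neighbourhood, one fixed chart has to serve for all points of it.\<close>

lemma d0_chart:
  assumes c: "c \<in> charts_at A x" and f: "(f \<circ> chart_inv c) differentiable at (snd c x)"
    and v: "v \<in> tangent_space A x"
  shows "d0 A f x v = D (f \<circ> chart_inv c) (snd c x) (v c)"
proof -
  define c0 where "c0 = chart_at A x"
  have c0: "c0 \<in> charts_at A x" using chart_at charts_at_point[OF c] by (simp add: c0_def)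
  note A = charts_atD(1)[OF c0] charts_atD(1)[OF c]
  have "D (f \<circ> chart_inv c0) (snd c0 x) = D (\<lambda>z. (f \<circ> chart_inv c) (transition c0 c z)) (snd c0 x)"
    by (rule D_cong_open[OF open_overlap[OF A]])
      (use c c0 in \<open>auto simp: chart_inv_transition[OF A] charts_at_def\<close>)
  moreover have "D (\<lambda>z. (f \<circ> chart_inv c) (transition c0 c z)) (snd c0 x) (v c0) =
      D (f \<circ> chart_inv c) (snd c x) (D (transition c0 c) (snd c0 x) (v c0))"
  proof -
    have "((f \<circ> chart_inv c) has_derivative D (f \<circ> chart_inv c) (snd c x)) (at (transition c0 c (snd c0 x)))"
      using has_derivative_D[OF f] c0 by (simp add: transition_chart charts_at_def)
    from D_eqI[OF has_derivative_compose[OF transition_has_derivative[OF c0 c] this]]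
    show ?thesis by simp
  qed
  ultimately show ?thesis
    using v tangent_component[OF v c0 c] by (simp add: d0_def restrict0_def c0_def Let_def)
qed

lemma d1_chart:
  assumes U: "openin (atlas_topology A) U" and a: "one_form A U \<alpha>" and x: "x \<in> U"
    and c: "c \<in> charts_at A x" and u: "u \<in> tangent_space A x" and v: "v \<in> tangent_space A x"
  shows "d1 A \<alpha> x u v = D (\<lambda>z. local1 A c \<alpha> z (v c)) (snd c x) (u c)
    - D (\<lambda>z. local1 A c \<alpha> z (u c)) (snd c x) (v c)"
proof -
  define c0 where "c0 = chart_at A x"
  have c0: "c0 \<in> charts_at A x" using chart_at charts_at_point[OF c] by (simp add: c0_def)
  note A = charts_atD(1)[OF c0] charts_atD(1)[OF c]
  let ?S = "coords c0 (fst c \<inter> U)" and ?\<phi> = "transition c0 c"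
  have S: "open ?S" using open_overlap[OF A] open_coords[OF A(1) U] by (simp add: coords_Int[OF A(1)] open_Int)
  have xS: "snd c0 x \<in> ?S" using c c0 x by (auto simp: charts_at_def)
  have \<phi>: "smooth_on ?S ?\<phi>" by (rule smooth_on_subset[OF transition_smooth[OF A]]) auto
  have im: "?\<phi> ` ?S \<subseteq> coords c U" using transition_in_coords[OF A] by blast
  have "D (\<lambda>z. local1 A c0 \<alpha> z b) (snd c0 x) =
      D (\<lambda>z. local1 A c \<alpha> (?\<phi> z) (D ?\<phi> z b)) (snd c0 x)" for b
    by (rule D_cong_open[OF S xS], rule local1_change[OF A]) auto
  then have "d1 A \<alpha> x u v = D (\<lambda>z. local1 A c \<alpha> (?\<phi> z) (D ?\<phi> z (v c0))) (snd c0 x) (u c0)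
      - D (\<lambda>z. local1 A c \<alpha> (?\<phi> z) (D ?\<phi> z (u c0))) (snd c0 x) (v c0)"
    by (simp add: d1_def c0_def Let_def)
  also have "\<dots> = D (\<lambda>z. local1 A c \<alpha> z (v c)) (snd c x) (u c)
      - D (\<lambda>z. local1 A c \<alpha> z (u c)) (snd c x) (v c)"
    unfolding d1_pullback[OF S \<phi> im one_form_lin_field[OF a A(2)] xS]
      tangent_component[OF u c0 c] tangent_component[OF v c0 c]
    using c0 by (simp add: transition_chart charts_at_def)
  finally show ?thesis .
qed

lemma d2_chart:
  assumes U: "openin (atlas_topology A) U" and s: "two_form A U \<sigma>" and x: "x \<in> U"
    and c: "c \<in> charts_at A x" and u: "u \<in> tangent_space A x" and v: "v \<in> tangent_space A x"
    and w: "w \<in> tangent_space A x"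
  shows "d2 A \<sigma> x u v w = D (\<lambda>z. local2 A c \<sigma> z (v c) (w c)) (snd c x) (u c)
    - D (\<lambda>z. local2 A c \<sigma> z (u c) (w c)) (snd c x) (v c)
    + D (\<lambda>z. local2 A c \<sigma> z (u c) (v c)) (snd c x) (w c)"
proof -
  define c0 where "c0 = chart_at A x"
  have c0: "c0 \<in> charts_at A x" using chart_at charts_at_point[OF c] by (simp add: c0_def)
  note A = charts_atD(1)[OF c0] charts_atD(1)[OF c]
  let ?S = "coords c0 (fst c \<inter> U)" and ?\<phi> = "transition c0 c"
  have S: "open ?S" using open_overlap[OF A] open_coords[OF A(1) U] by (simp add: coords_Int[OF A(1)] open_Int)
  have xS: "snd c0 x \<in> ?S" using c c0 x by (auto simp: charts_at_def)
  have \<phi>: "smooth_on ?S ?\<phi>" by (rule smooth_on_subset[OF transition_smooth[OF A]]) auto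
  have im: "?\<phi> ` ?S \<subseteq> coords c U" using transition_in_coords[OF A] by blast
  have "D (\<lambda>z. local2 A c0 \<sigma> z a b) (snd c0 x) =
      D (\<lambda>z. local2 A c \<sigma> (?\<phi> z) (D ?\<phi> z a) (D ?\<phi> z b)) (snd c0 x)" for a b
    by (rule D_cong_open[OF S xS], rule local2_change[OF A]) auto
  then have "d2 A \<sigma> x u v w =
      D (\<lambda>z. local2 A c \<sigma> (?\<phi> z) (D ?\<phi> z (v c0)) (D ?\<phi> z (w c0))) (snd c0 x) (u c0)
      - D (\<lambda>z. local2 A c \<sigma> (?\<phi> z) (D ?\<phi> z (u c0)) (D ?\<phi> z (w c0))) (snd c0 x) (v c0)
      + D (\<lambda>z. local2 A c \<sigma> (?\<phi> z) (D ?\<phi> z (u c0)) (D ?\<phi> z (v c0))) (snd c0 x) (w c0)"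
    by (simp add: d2_def c0_def Let_def)
  also have "\<dots> = D (\<lambda>z. local2 A c \<sigma> z (v c) (w c)) (snd c x) (u c)
    - D (\<lambda>z. local2 A c \<sigma> z (u c) (w c)) (snd c x) (v c)
    + D (\<lambda>z. local2 A c \<sigma> z (u c) (v c)) (snd c x) (w c)"
    unfolding d2_pullback[OF S \<phi> im two_form_bilin_field[OF s A(2)] xS
        local2_skew[OF s A(2) subsetD[OF im imageI[OF xS]]]]
      tangent_component[OF u c0 c] tangent_component[OF v c0 c] tangent_component[OF w c0 c]
    using c0 by (simp add: transition_chart charts_at_def)
  finally show ?thesis .
qed

lemma vector_fieldD:
  assumes "vector_field A U X"
  shows "x \<in> U \<Longrightarrow> X x \<in> tangent_space A x"
    "c \<in> A \<Longrightarrow> smooth_on (coords c U) (\<lambda>y. X (chart_inv c y) c)"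
  using assms by (auto simp: vector_field_def)

lemma lie_bracket_chart:
  assumes U: "openin (atlas_topology A) U" and X: "vector_field A U X" and Y: "vector_field A U Y"
    and x: "x \<in> U" and c: "c \<in> charts_at A x"
  shows "lie_bracket A X Y x = coord_vector A c x
    (D (\<lambda>z. Y (chart_inv c z) c) (snd c x) (X x c) - D (\<lambda>z. X (chart_inv c z) c) (snd c x) (Y x c))"
proof -
  define c0 where "c0 = chart_at A x"
  have c0: "c0 \<in> charts_at A x" using chart_at charts_at_point[OF c] by (simp add: c0_def)
  note A = charts_atD(1)[OF c0] charts_atD(1)[OF c]
  let ?S = "coords c0 (fst c \<inter> U)" and ?\<phi> = "transition c0 c"
  have S: "open ?S" using open_overlap[OF A] open_coords[OF A(1) U] by (simp add: coords_Int[OF A(1)] open_Int)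
  have xS: "snd c0 x \<in> ?S" using c c0 x by (auto simp: charts_at_def)
  have \<phi>: "smooth_on ?S ?\<phi>" by (rule smooth_on_subset[OF transition_smooth[OF A]]) auto
  have im: "?\<phi> ` ?S \<subseteq> coords c U" using transition_in_coords[OF A] by blast
  have sub: "?S \<subseteq> coords c0 U" by auto
  have rel: "Z (chart_inv c (?\<phi> z)) c = D ?\<phi> z (Z (chart_inv c0 z) c0)"
    if "vector_field A U Z" "z \<in> ?S" for Z z
  proof -
    have z: "z \<in> coords c0 (fst c)" using that by auto
    have "Z (chart_inv c0 z) \<in> tangent_space A (chart_inv c0 z)"
      using that coordsD(2)[OF A(1), of z U] sub by (intro vector_fieldD(1)) auto
    from tangent_component[OF this overlap_charts_at(1,2)[OF A z]]
    show ?thesis using overlap_charts_at(3)[OF A z] chart_inv_transition[OF A z] by simp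
  qed
  have "snd c x = ?\<phi> (snd c0 x)" using c0 by (simp add: transition_chart charts_at_def)
  moreover have "chart_inv c (?\<phi> (snd c0 x)) = x" "chart_inv c0 (snd c0 x) = x"
    using c c0 by (simp_all add: charts_at_def flip: calculation)
  ultimately have "D (\<lambda>z. Y (chart_inv c z) c) (snd c x) (X x c)
      - D (\<lambda>z. X (chart_inv c z) c) (snd c x) (Y x c) =
    D ?\<phi> (snd c0 x) (D (\<lambda>z. Y (chart_inv c0 z) c0) (snd c0 x) (X x c0)
      - D (\<lambda>z. X (chart_inv c0 z) c0) (snd c0 x) (Y x c0))"
    using lie_bracket_pushforward[OF S \<phi> im xS
        smooth_on_subset[OF vector_fieldD(2)[OF X A(1)] sub] vector_fieldD(2)[OF X A(2)] rel[OF X]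
        smooth_on_subset[OF vector_fieldD(2)[OF Y A(1)] sub] vector_fieldD(2)[OF Y A(2)] rel[OF Y]]
    by simp
  then show ?thesis
    using coord_vector_change[OF c0 c] by (simp add: lie_bracket_def c0_def Let_def)
qed

lemma vector_field_lie_bracket:
  assumes U: "openin (atlas_topology A) U" and X: "vector_field A U X" and Y: "vector_field A U Y"
  shows "vector_field A U (lie_bracket A X Y)"
  unfolding vector_field_def
proof (intro conjI ballI)
  show "lie_bracket A X Y x \<in> tangent_space A x" if "x \<in> U" for x
    using chart_at[of x] that openin_subset_points[OF U] by (auto simp: lie_bracket_def Let_def)
  fix c assume c: "c \<in> A"
  let ?X = "\<lambda>z. X (chart_inv c z) c" and ?Y = "\<lambda>z. Y (chart_inv c z) c"
  note S = open_coords[OF c U] and sX = vector_fieldD(2)[OF X c] and sY = vector_fieldD(2)[OF Y c]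
  have "smooth_on (coords c U) (\<lambda>z. D ?Y z (?X z) - D ?X z (?Y z))"
    by (intro smooth_on_diff S smooth_on_lin_field[OF S lin_field_D] sX sY)
  then show "smooth_on (coords c U) (\<lambda>y. lie_bracket A X Y (chart_inv c y) c)"
    by (rule smooth_on_cong[OF S, rotated])
      (auto simp: lie_bracket_chart[OF U X Y _ charts_atI[OF c]] charts_atI[OF c] c)
qed

lemma vector_field_lincomb:
  assumes U: "openin (atlas_topology A) U" and X: "vector_field A U X" and Y: "vector_field A U Y"
  shows "vector_field A U (\<lambda>x. r *\<^sub>R X x + s *\<^sub>R Y x)"
  unfolding vector_field_def
proof (intro conjI ballI)
  fix c assume c: "c \<in> A"
  note S = open_coords[OF c U]
  show "smooth_on (coords c U) (\<lambda>y. (r *\<^sub>R X (chart_inv c y) + s *\<^sub>R Y (chart_inv c y)) c)"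
    using vector_fieldD(2)[OF X c] vector_fieldD(2)[OF Y c]
    by (simp add: scaleR_fun_apply) (intro smooth_on_add smooth_on_scaleR smooth_on_const S)
qed (use vector_fieldD(1)[OF X] vector_fieldD(1)[OF Y] in \<open>auto intro: tangent_add tangent_scaleR\<close>)

lemma one_form_lincomb:
  assumes U: "openin (atlas_topology A) U" and a: "one_form A U \<alpha>" and b: "one_form A U \<beta>"
  shows "one_form A U (\<lambda>x. r *\<^sub>R \<alpha> x + s *\<^sub>R \<beta> x)"
  unfolding one_form_def
proof (intro conjI ballI allI)
  fix c e assume c: "c \<in> A"
  note S = open_coords[OF c U]
  show "smooth_on (coords c U) (\<lambda>y. local1 A c (\<lambda>x. r *\<^sub>R \<alpha> x + s *\<^sub>R \<beta> x) y e)"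
    using a b c by (simp add: scaleR_fun_apply one_form_def local1_def)
      (intro smooth_on_add smooth_on_mult smooth_on_const S; simp)
next
  fix x assume "x \<in> U"
  then show "r *\<^sub>R \<alpha> x + s *\<^sub>R \<beta> x \<in> cotangent_space A x"
    using a b by (intro cotangent_add cotangent_scaleR) (simp_all add: one_form_def)
qed

lemma one_form_cong:
  assumes U: "openin (atlas_topology A) U" and a: "one_form A U \<alpha>" and eq: "\<And>x. x \<in> U \<Longrightarrow> \<beta> x = \<alpha> x"
  shows "one_form A U \<beta>"
  unfolding one_form_def
proof (intro conjI ballI allI)
  fix c e assume c: "c \<in> A"
  show "smooth_on (coords c U) (\<lambda>y. local1 A c \<beta> y e)"
    by (rule smooth_on_cong[OF open_coords[OF c U], of "\<lambda>y. local1 A c \<alpha> y e"])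
      (use a c eq in \<open>auto simp: one_form_def local1_def\<close>)
qed (use a eq in \<open>auto simp: one_form_def\<close>)

lemma vector_field_cong:
  assumes U: "openin (atlas_topology A) U" and X: "vector_field A U X" and eq: "\<And>x. x \<in> U \<Longrightarrow> Y x = X x"
  shows "vector_field A U Y"
  unfolding vector_field_def
proof (intro conjI ballI allI)
  fix c assume c: "c \<in> A"
  show "smooth_on (coords c U) (\<lambda>y. Y (chart_inv c y) c)"
    by (rule smooth_on_cong[OF open_coords[OF c U] _ vector_fieldD(2)[OF X c]])
      (use c eq in auto)
qed (use X eq in \<open>auto simp: vector_field_def\<close>)

section \<open>Contraction of a two-form with a vector field\<close>

lemma flat_cotangent:
  assumes "two_form A U \<sigma>" "x \<in> U" "X \<in> tangent_space A x"
  shows "flat A \<sigma> x X \<in> cotangent_space A x"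
  using assms two_formD[OF assms(1,2)]
  by (auto simp: flat_def cotangent_space_def restrict0_def linear_on_def tangent_add tangent_scaleR)

lemma flat_apply: "v \<in> tangent_space A x \<Longrightarrow> flat A \<sigma> x X v = \<sigma> x X v"
  by (simp add: flat_def restrict0_def)

lemma flat_lincomb:
  assumes "two_form A U \<sigma>" "x \<in> U" "X \<in> tangent_space A x" "Y \<in> tangent_space A x"
  shows "flat A \<sigma> x (r *\<^sub>R X + s *\<^sub>R Y) = r *\<^sub>R flat A \<sigma> x X + s *\<^sub>R flat A \<sigma> x Y"
  using assms two_formD[OF assms(1,2)]
  by (auto simp: flat_def restrict0_def tangent_add tangent_scaleR scaleR_fun_apply fun_eq_iff)

lemma local1_flat:
  assumes X: "vector_field A U X" and c: "c \<in> A" and y: "y \<in> coords c U"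
  shows "local1 A c (\<lambda>x. flat A \<sigma> x (X x)) y a = local2 A c \<sigma> y (X (chart_inv c y) c) a"
  using vector_fieldD(1)[OF X] charts_at_coords[OF c y] coordsD(2)[OF c y]
  by (simp add: local1_def local2_def flat_apply coord_vector_components)

lemma one_form_flat:
  assumes U: "openin (atlas_topology A) U" and s: "two_form A U \<sigma>" and X: "vector_field A U X"
  shows "one_form A U (\<lambda>x. flat A \<sigma> x (X x))"
  unfolding one_form_def
proof (intro conjI ballI allI)
  fix c a assume c: "c \<in> A"
  note S = open_coords[OF c U]
  show "smooth_on (coords c U) (\<lambda>y. local1 A c (\<lambda>x. flat A \<sigma> x (X x)) y a)"
    by (rule smooth_on_cong[OF S _ smooth_on_lin_field[OF S bilin_fieldD(2)[OF two_form_bilin_field[OF s c]]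
            vector_fieldD(2)[OF X c]]])
      (simp add: local1_flat[OF X c])
qed (use s vector_fieldD(1)[OF X] in \<open>auto intro: flat_cotangent\<close>)

end

context atlas
begin

lemma one_form_subset: "one_form A U \<alpha> \<Longrightarrow> V \<subseteq> U \<Longrightarrow> one_form A V \<alpha>"
  unfolding one_form_def by (fast intro: smooth_on_subset)

lemma two_form_subset: "two_form A U \<sigma> \<Longrightarrow> V \<subseteq> U \<Longrightarrow> two_form A V \<sigma>"
  unfolding two_form_def by (fast intro: smooth_on_subset)

section \<open>The Courant bracket of graphs of closed two-forms\<close>

text \<open>The operator \<open>\<eta> \<mapsto> L\<^sub>X \<eta> - d(\<eta>(X))/2\<close>, of which the covector part of the Courant bracket is an
  antisymmetrization.\<close>
definition half_lie :: "('m \<Rightarrow> ('m, 'e) tvec) \<Rightarrow> ('m \<Rightarrow> ('m, 'e) covec) \<Rightarrow> 'm \<Rightarrow> ('m, 'e) covec"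
  where "half_lie X \<eta> x = lie_derivative A X \<eta> x - (1 / 2) *\<^sub>R d0 A (\<lambda>p. \<eta> p (X p)) x"

lemma half_lie_outside: "v \<notin> tangent_space A x \<Longrightarrow> half_lie X \<eta> x v = 0"
  by (simp add: half_lie_def lie_derivative_def d0_def flat_def restrict0_def scaleR_fun_apply)

lemma contraction_chart:
  assumes X: "vector_field A U X" and c: "c \<in> A" and z: "z \<in> coords c U"
  shows "\<eta> (chart_inv c z) (X (chart_inv c z)) = local1 A c \<eta> z (X (chart_inv c z) c)"
  using vector_fieldD(1)[OF X coordsD(2)[OF c z]] charts_at_coords[OF c z]
  by (simp add: local1_def coord_vector_components)

lemma contraction_has_derivative:
  assumes U: "openin (atlas_topology A) U" and X: "vector_field A U X" and e: "one_form A U \<eta>"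
    and x: "x \<in> U" and c: "c \<in> charts_at A x"
  shows "(((\<lambda>p. \<eta> p (X p)) \<circ> chart_inv c) has_derivative
    (\<lambda>w. D (\<lambda>z. local1 A c \<eta> z (X x c)) (snd c x) w +
      \<eta> x (coord_vector A c x (D (\<lambda>z. X (chart_inv c z) c) (snd c x) w)))) (at (snd c x))"
proof -
  note cA = charts_atD[OF c]
  note S = open_coords[OF cA(1) U] and y = snd_in_coords[OF c x]
  have "((\<lambda>z. local1 A c \<eta> z (X (chart_inv c z) c)) has_derivative
    (\<lambda>w. D (\<lambda>z. local1 A c \<eta> z (X (chart_inv c (snd c x)) c)) (snd c x) w +
      local1 A c \<eta> (snd c x) (D (\<lambda>z. X (chart_inv c z) c) (snd c x) w))) (at (snd c x))"
    by (rule lin_field_has_derivative[OF S one_form_lin_field[OF e cA(1)] y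
          smooth_on_has_derivative[OF vector_fieldD(2)[OF X cA(1)] y]])
  then have "(((\<lambda>p. \<eta> p (X p)) \<circ> chart_inv c) has_derivative
    (\<lambda>w. D (\<lambda>z. local1 A c \<eta> z (X (chart_inv c (snd c x)) c)) (snd c x) w +
      local1 A c \<eta> (snd c x) (D (\<lambda>z. X (chart_inv c z) c) (snd c x) w))) (at (snd c x))"
    by (rule has_derivative_transform_within_open[OF _ S y])
      (simp add: contraction_chart[OF X cA(1)])
  then show ?thesis using cA by (simp add: local1_chart[OF c])
qed

lemma d0_contraction:
  assumes U: "openin (atlas_topology A) U" and X: "vector_field A U X" and e: "one_form A U \<eta>"
    and x: "x \<in> U" and c: "c \<in> charts_at A x" and v: "v \<in> tangent_space A x"
  shows "d0 A (\<lambda>p. \<eta> p (X p)) x v = D (\<lambda>z. local1 A c \<eta> z (X x c)) (snd c x) (v c) +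
      \<eta> x (coord_vector A c x (D (\<lambda>z. X (chart_inv c z) c) (snd c x) (v c)))"
  using contraction_has_derivative[OF U X e x c] D_eqI[OF contraction_has_derivative[OF U X e x c]]
  by (subst d0_chart[OF c _ v]) (auto simp: differentiable_def)

lemma d0_diff:
  assumes "c \<in> charts_at A x" "(f \<circ> chart_inv c) differentiable at (snd c x)"
    "(g \<circ> chart_inv c) differentiable at (snd c x)"
  shows "d0 A (\<lambda>p. f p - g p) x = d0 A f x - d0 A g x"
proof
  fix v
  have h: "(((\<lambda>p. f p - g p) \<circ> chart_inv c) has_derivative
      (\<lambda>w. D (f \<circ> chart_inv c) (snd c x) w - D (g \<circ> chart_inv c) (snd c x) w)) (at (snd c x))"
    using has_derivative_diff[OF has_derivative_D[OF assms(2)] has_derivative_D[OF assms(3)]]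
    by (simp add: o_def)
  show "d0 A (\<lambda>p. f p - g p) x v = (d0 A f x - d0 A g x) v"
  proof (cases "v \<in> tangent_space A x")
    case True
    have "((\<lambda>p. f p - g p) \<circ> chart_inv c) differentiable at (snd c x)"
      using h by (auto simp: differentiable_def)
    from d0_chart[OF assms(1) this True] show ?thesis
      using D_eqI[OF h] by (simp add: d0_chart[OF assms(1,2) True] d0_chart[OF assms(1,3) True])
  qed (simp add: d0_def restrict0_def)
qed

text \<open>The covector part of the Courant bracket splits into two terms, each of which sees only one
  of the two vector fields and the covector part of the other section.  For a complex section the
  covector part mixes the real and imaginary vector parts, and the splitting allows each resulting
  pair of real fields to be treated on its own.\<close>

lemma courant_half_lie:
  assumes U: "openin (atlas_topology A) U" and S: "gsection A U S" and T: "gsection A U T" and x: "x \<in> U"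
  shows "courant A S T x = (lie_bracket A (fst \<circ> S) (fst \<circ> T) x,
    half_lie (fst \<circ> S) (snd \<circ> T) x - half_lie (fst \<circ> T) (snd \<circ> S) x)"
proof -
  define c where "c = chart_at A x"
  have c: "c \<in> charts_at A x"
    using chart_at openin_subset_points[OF U] x by (auto simp: c_def)
  note S' = S[unfolded gsection_def] and T' = T[unfolded gsection_def]
  have "((\<lambda>p. (snd \<circ> T) p ((fst \<circ> S) p)) \<circ> chart_inv c) differentiable at (snd c x)"
    "((\<lambda>p. (snd \<circ> S) p ((fst \<circ> T) p)) \<circ> chart_inv c) differentiable at (snd c x)"
    using contraction_has_derivative[OF U _ _ x c] S' T' unfolding differentiable_def by blast+
  from d0_diff[OF c this]
  show ?thesis by (simp add: courant_def Let_def half_lie_def scaleR_diff_right)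
qed

lemma half_lie_chart:
  assumes U: "openin (atlas_topology A) U" and X: "vector_field A U X" and e: "one_form A U \<eta>"
    and x: "x \<in> U" and c: "c \<in> charts_at A x" and v: "v \<in> tangent_space A x"
  shows "half_lie X \<eta> x v = D (\<lambda>z. local1 A c \<eta> z (v c)) (snd c x) (X x c)
    - 1 / 2 * D (\<lambda>z. local1 A c \<eta> z (X x c)) (snd c x) (v c)
    + 1 / 2 * local1 A c \<eta> (snd c x) (D (\<lambda>z. X (chart_inv c z) c) (snd c x) (v c))"
  using v by (simp add: half_lie_def lie_derivative_def flat_apply scaleR_fun_apply local1_chart[OF c]
      d1_chart[OF U e x c vector_fieldD(1)[OF X x] v] d0_contraction[OF U X e x c v] field_simps)

text \<open>Linearity and locality in one statement: \<open>\<zeta>\<close> need only be given by the formula on the open set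
  \<open>U\<close>, where the sections under consideration are known.\<close>
lemma half_lie_lincomb:
  assumes U: "openin (atlas_topology A) U" and X: "vector_field A U X"
    and e: "one_form A U \<eta>" and t: "one_form A U \<theta>"
    and eq: "\<And>p. p \<in> U \<Longrightarrow> \<zeta> p = r *\<^sub>R \<eta> p + s *\<^sub>R \<theta> p" and x: "x \<in> U"
  shows "half_lie X \<zeta> x = r *\<^sub>R half_lie X \<eta> x + s *\<^sub>R half_lie X \<theta> x"
proof
  fix v
  show "half_lie X \<zeta> x v = (r *\<^sub>R half_lie X \<eta> x + s *\<^sub>R half_lie X \<theta> x) v"
  proof (cases "v \<in> tangent_space A x")
    case True
    define c where "c = chart_at A x"
    have c: "c \<in> charts_at A x"
      using chart_at openin_subset_points[OF U] x by (auto simp: c_def)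
    note cA = charts_atD(1)[OF c]
    note S = open_coords[OF cA U] and y = snd_in_coords[OF c x]
    have z: "one_form A U \<zeta>"
      by (rule one_form_cong[OF U one_form_lincomb[OF U e t] eq])
    have l: "local1 A c \<zeta> z a = r * local1 A c \<eta> z a + s * local1 A c \<theta> z a"
      if "z \<in> coords c U" for z a
      using eq[OF coordsD(2)[OF cA that]] by (simp add: local1_def scaleR_fun_apply)
    have "D (\<lambda>z. local1 A c \<zeta> z a) (snd c x) w =
        r * D (\<lambda>z. local1 A c \<eta> z a) (snd c x) w + s * D (\<lambda>z. local1 A c \<theta> z a) (snd c x) w" for a w
    proof -
      have h: "((\<lambda>z. local1 A c \<alpha> z a) has_derivative D (\<lambda>z. local1 A c \<alpha> z a) (snd c x)) (at (snd c x))"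
        if "one_form A U \<alpha>" for \<alpha>
        by (rule smooth_on_has_derivative[OF lin_fieldD(2)[OF one_form_lin_field[OF that cA]] y])
      have "((\<lambda>z. local1 A c \<zeta> z a) has_derivative
        (\<lambda>w. r * D (\<lambda>z. local1 A c \<eta> z a) (snd c x) w + s * D (\<lambda>z. local1 A c \<theta> z a) (snd c x) w))
        (at (snd c x))"
        by (rule has_derivative_transform_within_open[OF _ S y l[symmetric]])
          (intro has_derivative_add has_derivative_mult_right h e t)
      from D_eqI[OF this] show ?thesis by simp
    qed
    then show ?thesis
      by (simp add: half_lie_chart[OF U X z x c True] half_lie_chart[OF U X e x c True]
          half_lie_chart[OF U X t x c True] l[OF y] scaleR_fun_apply algebra_simps)
  qed (simp add: half_lie_outside scaleR_fun_apply)
qed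

text \<open>The graph of a closed two-form is closed under the Courant bracket: in coordinates the two sides
  differ by \<open>d\<sigma>(X, Y, _)\<close>, all terms with derivatives of the fields matching by skewness.\<close>

lemma half_lie_flat_closed:
  assumes U: "openin (atlas_topology A) U" and s: "two_form A U \<sigma>" and cl: "closed2 A U \<sigma>"
    and X: "vector_field A U X" and Y: "vector_field A U Y" and x: "x \<in> U"
  shows "half_lie X (\<lambda>p. flat A \<sigma> p (Y p)) x - half_lie Y (\<lambda>p. flat A \<sigma> p (X p)) x =
    flat A \<sigma> x (lie_bracket A X Y x)"
proof
  fix v
  show "(half_lie X (\<lambda>p. flat A \<sigma> p (Y p)) x - half_lie Y (\<lambda>p. flat A \<sigma> p (X p)) x) v =
    flat A \<sigma> x (lie_bracket A X Y x) v"
  proof (cases "v \<in> tangent_space A x")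
    case v: True
    define c where "c = chart_at A x"
    have c: "c \<in> charts_at A x"
      using chart_at openin_subset_points[OF U] x by (auto simp: c_def)
    note cA = charts_atD(1)[OF c]
    note S = open_coords[OF cA U] and y = snd_in_coords[OF c x]
    note bs = two_form_bilin_field[OF s cA]
    let ?s = "local2 A c \<sigma>" and ?y = "snd c x"
    let ?X = "\<lambda>z. X (chart_inv c z) c" and ?Y = "\<lambda>z. Y (chart_inv c z) c"
    have inv: "chart_inv c ?y = x" using charts_atD[OF c] by simp
    note Xx = vector_fieldD(1)[OF X x] and Yx = vector_fieldD(1)[OF Y x]
    have sk: "?s ?y a b = - ?s ?y b a" for a b by (rule local2_skew[OF s cA y])
    have skD: "D (\<lambda>z. ?s z a b) ?y w = - D (\<lambda>z. ?s z b a) ?y w" for a b w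
    proof -
      have "D (\<lambda>z. ?s z a b) ?y = D (\<lambda>z. - ?s z b a) ?y"
        by (rule D_cong_open[OF S y]) (rule local2_skew[OF s cA])
      also have "\<dots> = (\<lambda>w. - D (\<lambda>z. ?s z b a) ?y w)"
        by (rule D_eqI) (intro has_derivative_minus
            smooth_on_has_derivative[OF lin_fieldD(2)[OF bilin_fieldD(1)[OF bs]] y])
      finally show ?thesis by simp
    qed
    have DY: "D (\<lambda>z. local1 A c (\<lambda>p. flat A \<sigma> p (Z p)) z a) ?y w =
        D (\<lambda>z. ?s z (Z x c) a) ?y w + ?s ?y (D (\<lambda>z. Z (chart_inv c z) c) ?y w) a"
      if Z: "vector_field A U Z" for Z a w
    proof -
      have "D (\<lambda>z. local1 A c (\<lambda>p. flat A \<sigma> p (Z p)) z a) ?y =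
          D (\<lambda>z. ?s z (Z (chart_inv c z) c) a) ?y"
        by (rule D_cong_open[OF S y]) (rule local1_flat[OF Z cA])
      then show ?thesis
        using lin_field_D_apply[OF S bilin_fieldD(2)[OF bs] y vector_fieldD(2)[OF Z cA], of a w] inv
        by simp
    qed
    have l: "local1 A c (\<lambda>p. flat A \<sigma> p (Y p)) ?y a = ?s ?y (Y x c) a" if "vector_field A U Y" for Y a
      using local1_flat[OF that cA y] inv by simp
    have "d2 A \<sigma> x (X x) (Y x) v = 0" using cl x Xx Yx v by (auto simp: closed2_def)
    then have closed: "D (\<lambda>z. ?s z (Y x c) (v c)) ?y (X x c) - D (\<lambda>z. ?s z (X x c) (v c)) ?y (Y x c)
        + D (\<lambda>z. ?s z (X x c) (Y x c)) ?y (v c) = 0"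
      using d2_chart[OF U s x c Xx Yx v] by simp
    have "?s ?y (a - b) (v c) = ?s ?y a (v c) - ?s ?y b (v c)" for a b
      by (rule linear_diff[OF lin_fieldD(1)[OF bilin_fieldD(2)[OF bs] y]])
    then have "flat A \<sigma> x (lie_bracket A X Y x) v =
        ?s ?y (D ?Y ?y (X x c)) (v c) - ?s ?y (D ?X ?y (Y x c)) (v c)"
      using local2_components[OF c _ v, of "lie_bracket A X Y x" \<sigma>, symmetric] c
      by (simp add: flat_apply[OF v] lie_bracket_chart[OF U X Y x c])
    moreover have "half_lie X (\<lambda>p. flat A \<sigma> p (Y p)) x v =
        D (\<lambda>z. ?s z (Y x c) (v c)) ?y (X x c) + ?s ?y (D ?Y ?y (X x c)) (v c)
        - 1 / 2 * (D (\<lambda>z. ?s z (Y x c) (X x c)) ?y (v c) + ?s ?y (D ?Y ?y (v c)) (X x c))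
        + 1 / 2 * ?s ?y (Y x c) (D ?X ?y (v c))"
      by (simp add: half_lie_chart[OF U X one_form_flat[OF U s Y] x c v] DY[OF Y] l[OF Y])
    moreover have "half_lie Y (\<lambda>p. flat A \<sigma> p (X p)) x v =
        D (\<lambda>z. ?s z (X x c) (v c)) ?y (Y x c) + ?s ?y (D ?X ?y (Y x c)) (v c)
        - 1 / 2 * (D (\<lambda>z. ?s z (X x c) (Y x c)) ?y (v c) + ?s ?y (D ?X ?y (v c)) (Y x c))
        + 1 / 2 * ?s ?y (X x c) (D ?Y ?y (v c))"
      by (simp add: half_lie_chart[OF U Y one_form_flat[OF U s X] x c v] DY[OF X] l[OF X])
    ultimately show ?thesis
      using closed skD[of "Y x c" "X x c" "v c"] sk[of "D ?Y ?y (v c)" "X x c"]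
        sk[of "D ?X ?y (v c)" "Y x c"]
      by (simp add: algebra_simps)
  qed (simp add: half_lie_outside flat_def restrict0_def)
qed

end

section \<open>The generalized complex structure of a Hitchin pair\<close>

locale symplectic = atlas A for A :: "('m, 'e::euclidean_space) chart set" +
  fixes U :: "'m set" and \<Omega> :: "('m, 'e) form2"
  assumes U: "openin (atlas_topology A) U"
    and symplectic: "symplectic_form A U \<Omega>"
begin

lemma symplectic_two_form: "two_form A U \<Omega>"
  using symplectic by (simp add: symplectic_form_def)

lemma nondegenerate:
  assumes "x \<in> U" "u \<in> tangent_space A x" "\<And>v. v \<in> tangent_space A x \<Longrightarrow> \<Omega> x u v = 0"
  shows "u = 0"
  using symplectic assms by (auto simp: symplectic_form_def)

lemma chart_exists: "x \<in> U \<Longrightarrow> chart_at A x \<in> charts_at A x"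
  using chart_at openin_subset_points[OF U] by blast

lemma flat_inj:
  assumes x: "x \<in> U" shows "inj_on (flat A \<Omega> x) (tangent_space A x)"
proof (rule inj_onI)
  fix u v assume u: "u \<in> tangent_space A x" and v: "v \<in> tangent_space A x"
    and eq: "flat A \<Omega> x u = flat A \<Omega> x v"
  have "flat A \<Omega> x (1 *\<^sub>R u + (- 1) *\<^sub>R v) = 0"
    by (simp only: flat_lincomb[OF symplectic_two_form x u v] eq) simp
  then have "u - v = 0"
    using flat_apply[of _ x \<Omega> "u - v"] by (intro nondegenerate[OF x] tangent_diff u v) auto
  then show "u = v" by simp
qed

text \<open>An injective linear map between spaces of the same finite dimension is onto.\<close>

lemma flat_surj:
  assumes x: "x \<in> U" and \<xi>: "\<xi> \<in> cotangent_space A x"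
  shows "\<exists>u\<in>tangent_space A x. flat A \<Omega> x u = \<xi>"
proof -
  define c where "c = chart_at A x"
  have c: "c \<in> charts_at A x" using chart_exists[OF x] by (simp add: c_def)
  let ?e = "coord_vector A c x"
  define f where "f a = (\<Sum>b\<in>Basis. \<Omega> x (?e a) (?e b) *\<^sub>R b)" for a
  have f: "f a \<bullet> b = \<Omega> x (?e a) (?e b)" if "b \<in> Basis" for a b
    using that by (simp add: f_def)
  have ext: "\<eta> = \<theta>" if "\<eta> \<in> cotangent_space A x" "\<theta> \<in> cotangent_space A x"
    "\<And>b. b \<in> Basis \<Longrightarrow> \<eta> (?e b) = \<theta> (?e b)" for \<eta> \<theta>
  proof (rule cotangent_eqI[OF that(1,2)])
    fix v assume v: "v \<in> tangent_space A x"
    have "(\<lambda>a. \<eta> (?e a)) = (\<lambda>a. \<theta> (?e a))"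
      using that(3) by (intro linear_eq_stdbasis cotangent_linear[OF _ c] that(1,2))
    then have "\<eta> (?e (v c)) = \<theta> (?e (v c))" by metis
    then show "\<eta> v = \<theta> v" by (simp add: coord_vector_components[OF c v])
  qed
  have fl: "flat A \<Omega> x (?e a) \<in> cotangent_space A x" for a
    using c by (intro flat_cotangent[OF symplectic_two_form x]) simp
  have lin: "linear f"
    unfolding f_def using two_formD[OF symplectic_two_form x] c
    by (intro linearI)
      (simp_all add: coord_vector_add[OF c] coord_vector_scaleR[OF c] scaleR_left_distrib
        sum.distrib scaleR_sum_right)
  moreover have "inj f"
  proof (rule injI)
    fix a b assume "f a = f b"
    then have "\<Omega> x (?e a) (?e d) = \<Omega> x (?e b) (?e d)" if "d \<in> Basis" for d
      using f[OF that] by metis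
    then have "flat A \<Omega> x (?e a) = flat A \<Omega> x (?e b)"
      using c by (intro ext fl) (simp_all add: flat_apply)
    then have "?e a = ?e b"
      using flat_inj[OF x] c by (auto dest: inj_onD)
    then have "?e a c = ?e b c" by simp
    then show "a = b" using c by simp
  qed
  ultimately have "surj f" by (rule linear_injective_imp_surjective) (rule refl)
  then obtain a where a: "f a = (\<Sum>b\<in>Basis. \<xi> (?e b) *\<^sub>R b)" by (metis surjD)
  have "flat A \<Omega> x (?e a) = \<xi>"
  proof (rule ext[OF fl \<xi>])
    fix b :: 'e assume b: "b \<in> Basis"
    then have "f a \<bullet> b = \<xi> (?e b)" by (simp add: a)
    then show "flat A \<Omega> x (?e a) (?e b) = \<xi> (?e b)" using f[OF b] c by (simp add: flat_apply)
  qed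
  then show ?thesis using c by (intro bexI[of _ "?e a"]) simp_all
qed

lemma flat_inv_tangent [simp]:
  assumes "x \<in> U" "\<xi> \<in> cotangent_space A x"
  shows "flat_inv A \<Omega> x \<xi> \<in> tangent_space A x"
  unfolding flat_inv_def using flat_surj[OF assms]
  by (intro the_inv_into_into[OF flat_inj[OF assms(1)]]) auto

lemma flat_flat_inv [simp]:
  assumes "x \<in> U" "\<xi> \<in> cotangent_space A x"
  shows "flat A \<Omega> x (flat_inv A \<Omega> x \<xi>) = \<xi>"
  unfolding flat_inv_def using flat_surj[OF assms]
  by (intro f_the_inv_into_f[OF flat_inj[OF assms(1)]]) auto

lemma flat_inv_flat [simp]:
  "x \<in> U \<Longrightarrow> u \<in> tangent_space A x \<Longrightarrow> flat_inv A \<Omega> x (flat A \<Omega> x u) = u"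
  unfolding flat_inv_def by (rule the_inv_into_f_f[OF flat_inj])

lemma flat_inv_eqI:
  "x \<in> U \<Longrightarrow> u \<in> tangent_space A x \<Longrightarrow> flat A \<Omega> x u = \<xi> \<Longrightarrow> flat_inv A \<Omega> x \<xi> = u"
  using flat_inv_flat by blast

lemma flat_inv_lincomb:
  assumes "x \<in> U" "\<xi> \<in> cotangent_space A x" "\<eta> \<in> cotangent_space A x"
  shows "flat_inv A \<Omega> x (r *\<^sub>R \<xi> + s *\<^sub>R \<eta>) = r *\<^sub>R flat_inv A \<Omega> x \<xi> + s *\<^sub>R flat_inv A \<Omega> x \<eta>"
  using assms by (intro flat_inv_eqI) (simp_all add: tangent_add tangent_scaleR flat_lincomb[OF symplectic_two_form])

end

text \<open>Smoothness of \<open>J\<close> requires the inverse of \<open>\<Omega>\<close> to preserve smoothness.  For the canonical form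
  this follows from its constant coefficients, so it is made a hypothesis rather than derived from
  the smoothness of matrix inversion.\<close>
locale hitchin = symplectic A U \<Omega>
  for A :: "('m, 'e::euclidean_space) chart set" and U :: "'m set" and \<Omega> :: "('m, 'e) form2" +
  fixes \<omega> :: "('m, 'e) form2"
  assumes closed_form: "two_form A U \<omega>" "closed2 A U \<omega>"
    and smooth_flat_inv: "\<And>V \<alpha>. openin (atlas_topology A) V \<Longrightarrow> V \<subseteq> U \<Longrightarrow> one_form A V \<alpha> \<Longrightarrow>
      vector_field A V (\<lambda>x. flat_inv A \<Omega> x (\<alpha> x))"
begin

lemma forms: "two_form A U \<omega>" "two_form A U \<Omega>" "closed2 A U \<omega>" "closed2 A U \<Omega>"
  using closed_form symplectic by (auto simp: symplectic_form_def)

lemma endo_eq: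
  assumes x: "x \<in> U" and X: "X \<in> tangent_space A x"
  shows "endo A \<Omega> \<omega> x X = flat_inv A \<Omega> x (flat A \<omega> x X)"
  unfolding endo_def
proof (rule the_equality)
  note P = flat_cotangent[OF forms(1) x X]
  let ?Y = "flat_inv A \<Omega> x (flat A \<omega> x X)"
  have "flat A \<Omega> x ?Y Z = flat A \<omega> x X Z" for Z using flat_flat_inv[OF x P] by simp
  then show "?Y \<in> tangent_space A x \<and> (\<forall>Z\<in>tangent_space A x. \<omega> x X Z = \<Omega> x ?Y Z)"
    using flat_inv_tangent[OF x P] flat_apply by metis
  fix Y assume Y: "Y \<in> tangent_space A x \<and> (\<forall>Z\<in>tangent_space A x. \<omega> x X Z = \<Omega> x Y Z)"
  then have "flat A \<Omega> x Y = flat A \<omega> x X"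
    by (auto simp: flat_def restrict0_def fun_eq_iff)
  then show "Y = ?Y" using Y flat_inv_eqI[OF x] by metis
qed

text \<open>Eliminating the endomorphism, \<open>J (X + \<xi>) = W - \<Omega> X - \<omega> W\<close> where \<open>\<Omega> W = \<omega> X + \<xi>\<close>.  In this
  form the algebraic properties of \<open>J\<close> are immediate.\<close>

lemma gcs_map_eq:
  assumes x: "x \<in> U" and X: "X \<in> tangent_space A x" and \<xi>: "\<xi> \<in> cotangent_space A x"
    and W: "W = flat_inv A \<Omega> x (flat A \<omega> x X + \<xi>)"
  shows "gcs_map A \<Omega> \<omega> x (X, \<xi>) = (W, - flat A \<Omega> x X - flat A \<omega> x W)"
proof -
  let ?B = "endo A \<Omega> \<omega> x" and ?S = "flat_inv A \<Omega> x \<xi>"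
  note P = flat_cotangent[OF forms(1) x X]
  have BT: "?B Y \<in> tangent_space A x" if "Y \<in> tangent_space A x" for Y
    using endo_eq[OF x that] flat_inv_tangent[OF x flat_cotangent[OF forms(1) x that]] by simp
  have OB: "\<Omega> x (?B Y) Z = \<omega> x Y Z" if "Y \<in> tangent_space A x" "Z \<in> tangent_space A x" for Y Z
    using endo_eq[OF x that(1)] flat_flat_inv[OF x flat_cotangent[OF forms(1) x that(1)]] that(2)
    by (metis flat_apply)
  have W': "W = ?B X + ?S"
    using flat_inv_lincomb[OF x P \<xi>, of 1 1] by (simp add: W endo_eq[OF x X])
  note ST = flat_inv_tangent[OF x \<xi>]
  have "restrict0 (tangent_space A x) (\<lambda>Y. - \<Omega> x (X + ?B (?B X)) Y) v - dual_map A (endo A \<Omega> \<omega>) x \<xi> v =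
      (- flat A \<Omega> x X - flat A \<omega> x W) v" for v
  proof (cases "v \<in> tangent_space A x")
    case v: True
    have "\<xi> (?B v) = \<Omega> x ?S (?B v)"
      using flat_flat_inv[OF x \<xi>] flat_apply[OF BT[OF v]] by metis
    also have "\<dots> = \<omega> x ?S v"
      using two_form_skew[OF forms(2) x ST BT[OF v]] two_form_skew[OF forms(1) x ST v] OB[OF v ST] by simp
    finally have "\<xi> (?B v) = \<omega> x ?S v" .
    then show ?thesis
      using v X ST by (simp add: dual_map_def restrict0_def flat_apply W' BT OB
          two_formD(2)[OF forms(1) x] two_formD(2)[OF forms(2) x])
  qed (simp add: restrict0_def dual_map_def flat_def)
  then show ?thesis
    by (simp add: gcs_map_def Let_def W' flat_def[of A "\<lambda>p X Y. - \<Omega> p (X + endo A \<Omega> \<omega> p (endo A \<Omega> \<omega> p X)) Y"]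
        fun_eq_iff)
qed

lemma gspaceD: "z \<in> gspace A x \<Longrightarrow> fst z \<in> tangent_space A x" "z \<in> gspace A x \<Longrightarrow> snd z \<in> cotangent_space A x"
  by (auto simp: gspace_def)

definition gcs_vector :: "'m \<Rightarrow> ('m, 'e) gvec \<Rightarrow> ('m, 'e) tvec"
  where "gcs_vector x z = flat_inv A \<Omega> x (flat A \<omega> x (fst z) + snd z)"

lemma gcs_vector_cotangent:
  "x \<in> U \<Longrightarrow> z \<in> gspace A x \<Longrightarrow> flat A \<omega> x (fst z) + snd z \<in> cotangent_space A x"
  by (intro cotangent_add flat_cotangent[OF forms(1)] gspaceD)

lemma gcs_vector_tangent: "x \<in> U \<Longrightarrow> z \<in> gspace A x \<Longrightarrow> gcs_vector x z \<in> tangent_space A x"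
  unfolding gcs_vector_def by (intro flat_inv_tangent gcs_vector_cotangent)

lemma flat_gcs_vector: "x \<in> U \<Longrightarrow> z \<in> gspace A x \<Longrightarrow> flat A \<Omega> x (gcs_vector x z) = flat A \<omega> x (fst z) + snd z"
  unfolding gcs_vector_def by (intro flat_flat_inv gcs_vector_cotangent)

lemma gcs_map_components:
  "x \<in> U \<Longrightarrow> z \<in> gspace A x \<Longrightarrow>
    gcs_map A \<Omega> \<omega> x z = (gcs_vector x z, - flat A \<Omega> x (fst z) - flat A \<omega> x (gcs_vector x z))"
  using gcs_map_eq[of x "fst z" "snd z" "gcs_vector x z"] gspaceD[of z x] by (simp add: gcs_vector_def)

lemma gcs_map_gspace: "x \<in> U \<Longrightarrow> z \<in> gspace A x \<Longrightarrow> gcs_map A \<Omega> \<omega> x z \<in> gspace A x"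
  by (simp add: gcs_map_components gcs_vector_tangent gspace_def)
    (intro cotangent_diff cotangent_minus flat_cotangent[OF forms(1)] flat_cotangent[OF forms(2)]
      gcs_vector_tangent; simp add: gspace_def mem_Times_iff)

lemma gcs_vector_lincomb:
  assumes "x \<in> U" "z \<in> gspace A x" "w \<in> gspace A x"
  shows "gcs_vector x (r *\<^sub>R z + s *\<^sub>R w) = r *\<^sub>R gcs_vector x z + s *\<^sub>R gcs_vector x w"
proof -
  have "flat A \<omega> x (fst (r *\<^sub>R z + s *\<^sub>R w)) + snd (r *\<^sub>R z + s *\<^sub>R w) =
      r *\<^sub>R (flat A \<omega> x (fst z) + snd z) + s *\<^sub>R (flat A \<omega> x (fst w) + snd w)"
    using flat_lincomb[OF forms(1) assms(1) gspaceD(1)[OF assms(2)] gspaceD(1)[OF assms(3)]]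
    by (simp add: scaleR_add_right)
  then show ?thesis
    unfolding gcs_vector_def by (simp only: flat_inv_lincomb[OF assms(1) gcs_vector_cotangent[OF assms(1,2)]
          gcs_vector_cotangent[OF assms(1,3)]])
qed

lemma gspace_lincomb: "z \<in> gspace A x \<Longrightarrow> w \<in> gspace A x \<Longrightarrow> r *\<^sub>R z + s *\<^sub>R w \<in> gspace A x"
  by (auto simp: gspace_def intro!: tangent_add tangent_scaleR cotangent_add cotangent_scaleR)

lemma gcs_map_lincomb:
  assumes x: "x \<in> U" and z: "z \<in> gspace A x" and w: "w \<in> gspace A x"
  shows "gcs_map A \<Omega> \<omega> x (r *\<^sub>R z + s *\<^sub>R w) = r *\<^sub>R gcs_map A \<Omega> \<omega> x z + s *\<^sub>R gcs_map A \<Omega> \<omega> x w"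
  using gcs_vector_tangent[OF x z] gcs_vector_tangent[OF x w] z w
  by (simp add: gcs_map_components gspace_lincomb x gcs_vector_lincomb prod_eq_iff flat_lincomb[OF forms(1) x]
      flat_lincomb[OF forms(2) x] gspaceD algebra_simps)

text \<open>Applying the formula for \<open>J\<close> to \<open>W - \<Omega> X - \<omega> W\<close>, the two terms \<open>\<omega> W\<close> cancel and the new
  vector component is \<open>- X\<close>.\<close>
lemma gcs_map_square:
  assumes x: "x \<in> U" and z: "z \<in> gspace A x"
  shows "gcs_map A \<Omega> \<omega> x (gcs_map A \<Omega> \<omega> x z) = - z"
proof -
  let ?w = "gcs_map A \<Omega> \<omega> x z"
  note w = gcs_map_gspace[OF x z] and X = gspaceD(1)[OF z]
  have "gcs_vector x ?w = - fst z"
    unfolding gcs_vector_def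
  proof (rule flat_inv_eqI[OF x])
    show "flat A \<Omega> x (- fst z) = flat A \<omega> x (fst ?w) + snd ?w"
      using flat_lincomb[OF forms(2) x X X, of "-1" 0] by (simp add: gcs_map_components[OF x z])
  qed (intro tangent_minus X)
  then show ?thesis
    using flat_lincomb[OF forms(1) x X X, of "-1" 0] flat_gcs_vector[OF x z]
    unfolding gcs_map_components[OF x w] by (simp add: gcs_map_components[OF x z] prod_eq_iff)
qed

text \<open>Writing \<open>\<xi> = \<Omega> W - \<omega> X\<close> and \<open>\<eta> = \<Omega> W' - \<omega> Y\<close> for the covector parts of \<open>z\<close> and \<open>w\<close>, both
  sides become half of \<open>\<Omega>(W', W) - \<Omega>(X, Y)\<close>.\<close>
lemma gcs_map_skew:
  assumes x: "x \<in> U" and z: "z \<in> gspace A x" and w: "w \<in> gspace A x"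
  shows "pairing (gcs_map A \<Omega> \<omega> x z) w = - pairing z (gcs_map A \<Omega> \<omega> x w)"
proof -
  have e: "snd z (gcs_vector x w) = \<Omega> x (gcs_vector x z) (gcs_vector x w) - \<omega> x (fst z) (gcs_vector x w)"
    if "z \<in> gspace A x" "w \<in> gspace A x" for z w
    using fun_cong[OF flat_gcs_vector[OF x that(1)], of "gcs_vector x w"] gcs_vector_tangent[OF x that(2)]
    by (simp add: flat_apply)
  show ?thesis
    using two_form_skew[OF forms(2) x gcs_vector_tangent[OF x z] gcs_vector_tangent[OF x w]]
      two_form_skew[OF forms(2) x gspaceD(1)[OF z] gspaceD(1)[OF w]]
      two_form_skew[OF forms(1) x gspaceD(1)[OF z] gcs_vector_tangent[OF x w]]
      two_form_skew[OF forms(1) x gspaceD(1)[OF w] gcs_vector_tangent[OF x z]]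
      e[OF z w] e[OF w z]
    by (simp add: pairing_def gcs_map_components[OF x z] gcs_map_components[OF x w] flat_apply gspaceD(1)[OF z]
        gspaceD(1)[OF w] field_simps)
qed

lemma gcs_map_smooth:
  assumes V: "openin (atlas_topology A) V" "V \<subseteq> U" and S: "gsection A V S"
  shows "gsection A V (\<lambda>x. gcs_map A \<Omega> \<omega> x (S x))"
proof -
  have X: "vector_field A V (fst \<circ> S)" and \<xi>: "one_form A V (snd \<circ> S)"
    using S by (auto simp: gsection_def)
  have z: "S x \<in> gspace A x" if "x \<in> V" for x
    using vector_fieldD(1)[OF X that] \<xi> that by (auto simp: gspace_def one_form_def mem_Times_iff)
  note \<omega>V = two_form_subset[OF forms(1) V(2)] and \<Omega>V = two_form_subset[OF forms(2) V(2)]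
  have W: "vector_field A V (\<lambda>x. gcs_vector x (S x))"
    unfolding gcs_vector_def
    using smooth_flat_inv[OF V one_form_lincomb[OF V(1) one_form_flat[OF V(1) \<omega>V X] \<xi>, of 1 1]]
    by simp
  have "one_form A V (\<lambda>x. (- 1) *\<^sub>R flat A \<Omega> x ((fst \<circ> S) x) + (- 1) *\<^sub>R flat A \<omega> x (gcs_vector x (S x)))"
    by (intro one_form_lincomb[OF V(1)] one_form_flat[OF V(1)] \<Omega>V \<omega>V X W)
  then have "one_form A V (snd \<circ> (\<lambda>x. gcs_map A \<Omega> \<omega> x (S x)))"
    by (rule one_form_cong[OF V(1)]) (use gcs_map_components[OF _ z] V(2) in auto)
  moreover have "vector_field A V (fst \<circ> (\<lambda>x. gcs_map A \<Omega> \<omega> x (S x)))"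
    by (rule vector_field_cong[OF V(1) W]) (use gcs_map_components[OF _ z] V(2) in auto)
  ultimately show ?thesis by (simp add: gsection_def)
qed

lemma almost_generalized_complex: "almost_generalized_complex A U (gcs_map A \<Omega> \<omega>)"
proof -
  have "linear_on (gspace A x) (gcs_map A \<Omega> \<omega> x)" if "x \<in> U" for x
    unfolding linear_on_def
    using gcs_map_lincomb[OF that, of _ _ 1 1] gcs_map_lincomb[OF that, of _ _ _ 0] by auto
  then show ?thesis
    unfolding almost_generalized_complex_def bundle_map_def
    by (auto intro: gcs_map_gspace gcs_map_smooth gcs_map_square gcs_map_skew)
qed

text \<open>The right-hand side gives the real and imaginary covector parts of a point of the graph of the
  complex two-form \<open>i \<epsilon> \<Omega> - \<omega>\<close>.  The vector component of the eigenvalue equation is equivalent to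
  it and implies the covector component.\<close>

lemma eigenvector_iff_graph:
  assumes x: "x \<in> U" and z: "z \<in> gspace A x" "w \<in> gspace A x" and \<epsilon>: "\<epsilon> = 1 \<or> \<epsilon> = - 1"
  shows "(gcs_map A \<Omega> \<omega> x z, gcs_map A \<Omega> \<omega> x w) = cscale (Complex 0 \<epsilon>) (z, w) \<longleftrightarrow>
    snd z = (- \<epsilon>) *\<^sub>R flat A \<Omega> x (fst w) + (- 1) *\<^sub>R flat A \<omega> x (fst z) \<and>
    snd w = \<epsilon> *\<^sub>R flat A \<Omega> x (fst z) + (- 1) *\<^sub>R flat A \<omega> x (fst w)"
proof -
  note X = gspaceD(1)[OF z(1)] gspaceD(1)[OF z(2)]
  have iff: "gcs_vector x z = r *\<^sub>R Y \<longleftrightarrow> snd z = r *\<^sub>R flat A \<Omega> x Y + (- 1) *\<^sub>R flat A \<omega> x (fst z)"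
    if z: "z \<in> gspace A x" and Y: "Y \<in> tangent_space A x" for z Y r
  proof -
    have "gcs_vector x z = r *\<^sub>R Y \<longleftrightarrow> flat A \<Omega> x (gcs_vector x z) = flat A \<Omega> x (r *\<^sub>R Y)"
      using inj_onD[OF flat_inj[OF x] _ gcs_vector_tangent[OF x z] tangent_scaleR[OF Y]] by auto
    also have "\<dots> \<longleftrightarrow> flat A \<omega> x (fst z) + snd z = r *\<^sub>R flat A \<Omega> x Y"
      using flat_lincomb[OF forms(2) x Y Y, of r 0] by (simp add: flat_gcs_vector[OF x z])
    also have "\<dots> \<longleftrightarrow> snd z = r *\<^sub>R flat A \<Omega> x Y + (- 1) *\<^sub>R flat A \<omega> x (fst z)"
      by (auto simp: algebra_simps)
    finally show ?thesis .
  qed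
  have "(gcs_map A \<Omega> \<omega> x z, gcs_map A \<Omega> \<omega> x w) = cscale (Complex 0 \<epsilon>) (z, w) \<longleftrightarrow>
      gcs_vector x z = (- \<epsilon>) *\<^sub>R fst w \<and> gcs_vector x w = \<epsilon> *\<^sub>R fst z \<and>
      - flat A \<Omega> x (fst z) - flat A \<omega> x (gcs_vector x z) = (- \<epsilon>) *\<^sub>R snd w \<and>
      - flat A \<Omega> x (fst w) - flat A \<omega> x (gcs_vector x w) = \<epsilon> *\<^sub>R snd z"
    by (auto simp: cscale_def gcs_map_components[OF x z(1)] gcs_map_components[OF x z(2)] prod_eq_iff)
  also have "\<dots> \<longleftrightarrow> gcs_vector x z = (- \<epsilon>) *\<^sub>R fst w \<and> gcs_vector x w = \<epsilon> *\<^sub>R fst z"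
  proof -
    \<comment> \<open>the covector components follow, because \<open>\<epsilon>\<^sup>2 = 1\<close>\<close>
    have "- flat A \<Omega> x (fst z) - flat A \<omega> x (gcs_vector x z) = (- \<epsilon>) *\<^sub>R snd w \<and>
        - flat A \<Omega> x (fst w) - flat A \<omega> x (gcs_vector x w) = \<epsilon> *\<^sub>R snd z"
      if W: "gcs_vector x z = (- \<epsilon>) *\<^sub>R fst w" "gcs_vector x w = \<epsilon> *\<^sub>R fst z"
    proof -
      have P: "flat A \<omega> x (r *\<^sub>R Y) = r *\<^sub>R flat A \<omega> x Y" if "Y \<in> tangent_space A x" for r Y
        using flat_lincomb[OF forms(1) x that that, of r 0] by simp
      show ?thesis
        unfolding W iff[OF z(1) X(2), THEN iffD1, OF W(1)] iff[OF z(2) X(1), THEN iffD1, OF W(2)]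
          P[OF X(1)] P[OF X(2)]
        using \<epsilon> by (auto simp: scaleR_add_right)
    qed
    then show ?thesis by blast
  qed
  finally show ?thesis by (simp only: iff[OF z(1) X(2)] iff[OF z(2) X(1)])
qed

lemma eigen_section_iff_graph:
  assumes \<epsilon>: "\<epsilon> = 1 \<or> \<epsilon> = - 1"
  shows "eigen_section A U (gcs_map A \<Omega> \<omega>) (Complex 0 \<epsilon>) Z \<longleftrightarrow>
    gsection A U (fst Z) \<and> gsection A U (snd Z) \<and>
    (\<forall>x\<in>U. snd (fst Z x) = (- \<epsilon>) *\<^sub>R flat A \<Omega> x (fst (snd Z x)) + (- 1) *\<^sub>R flat A \<omega> x (fst (fst Z x)) \<and>
      snd (snd Z x) = \<epsilon> *\<^sub>R flat A \<Omega> x (fst (fst Z x)) + (- 1) *\<^sub>R flat A \<omega> x (fst (snd Z x)))"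
proof -
  have "S x \<in> gspace A x" if "gsection A U S" "x \<in> U" for S x
    using that by (auto simp: gsection_def vector_field_def one_form_def gspace_def mem_Times_iff)
  then show ?thesis
    unfolding eigen_section_def
    by (intro conj_cong refl ball_cong eigenvector_iff_graph[OF _ _ _ \<epsilon>])
qed

text \<open>Writing sections of the eigenbundle as graphs, the complex bracket is expanded into brackets of
  real fields, and each is evaluated with the closedness of \<open>\<Omega>\<close> or of \<open>\<omega>\<close>.  The smoothness of the
  bracket comes for free, since its covector part is again a contraction of smooth forms.\<close>
lemma eigen_section_ccourant:
  assumes \<epsilon>: "\<epsilon> = 1 \<or> \<epsilon> = - 1"
    and Z: "eigen_section A U (gcs_map A \<Omega> \<omega>) (Complex 0 \<epsilon>) Z"
    and W: "eigen_section A U (gcs_map A \<Omega> \<omega>) (Complex 0 \<epsilon>) W"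
  shows "eigen_section A U (gcs_map A \<Omega> \<omega>) (Complex 0 \<epsilon>) (ccourant A Z W)"
proof -
  define X1 X2 Y1 Y2 where "X1 = fst \<circ> fst Z" and "X2 = fst \<circ> snd Z"
    and "Y1 = fst \<circ> fst W" and "Y2 = fst \<circ> snd W"
  note XY = X1_def X2_def Y1_def Y2_def
  note Z' = Z[unfolded eigen_section_iff_graph[OF \<epsilon>]] and W' = W[unfolded eigen_section_iff_graph[OF \<epsilon>]]
  have sec: "gsection A U (fst Z)" "gsection A U (snd Z)" "gsection A U (fst W)" "gsection A U (snd W)"
    using Z' W' by auto
  have vf: "vector_field A U X1" "vector_field A U X2" "vector_field A U Y1" "vector_field A U Y2"
    using sec by (auto simp: gsection_def XY)
  let ?G = "\<lambda>X p. flat A \<Omega> p (X p)" and ?P = "\<lambda>X p. flat A \<omega> p (X p)"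
  have graph: "\<And>p. p \<in> U \<Longrightarrow> (snd \<circ> fst Z) p = (- \<epsilon>) *\<^sub>R ?G X2 p + (- 1) *\<^sub>R ?P X1 p"
    "\<And>p. p \<in> U \<Longrightarrow> (snd \<circ> snd Z) p = \<epsilon> *\<^sub>R ?G X1 p + (- 1) *\<^sub>R ?P X2 p"
    "\<And>p. p \<in> U \<Longrightarrow> (snd \<circ> fst W) p = (- \<epsilon>) *\<^sub>R ?G Y2 p + (- 1) *\<^sub>R ?P Y1 p"
    "\<And>p. p \<in> U \<Longrightarrow> (snd \<circ> snd W) p = \<epsilon> *\<^sub>R ?G Y1 p + (- 1) *\<^sub>R ?P Y2 p"
    using Z' W' by (auto simp: XY)
  note G = one_form_flat[OF U forms(2)] and P = one_form_flat[OF U forms(1)]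
  note hl = half_lie_lincomb[OF U _ G P]
  \<comment> \<open>the real and imaginary parts of \<open>[X1 + i X2, Y1 + i Y2]\<close>, with explicit coefficients so that
    the rules for linear combinations apply\<close>
  let ?R = "\<lambda>x. 1 *\<^sub>R lie_bracket A X1 Y1 x + (- 1) *\<^sub>R lie_bracket A X2 Y2 x"
    and ?I = "\<lambda>x. 1 *\<^sub>R lie_bracket A X1 Y2 x + 1 *\<^sub>R lie_bracket A X2 Y1 x"
  have vR: "vector_field A U ?R" and vI: "vector_field A U ?I"
    by (intro vector_field_lincomb[OF U] vector_field_lie_bracket[OF U] vf)+
  have re: "fst (ccourant A Z W) x = (?R x, (- \<epsilon>) *\<^sub>R ?G ?I x + (- 1) *\<^sub>R ?P ?R x)"
    and im: "snd (ccourant A Z W) x = (?I x, \<epsilon> *\<^sub>R ?G ?R x + (- 1) *\<^sub>R ?P ?I x)"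
    if x: "x \<in> U" for x
  proof -
    have br: "lie_bracket A X Y x \<in> tangent_space A x" if "vector_field A U X" "vector_field A U Y" for X Y
      by (rule vector_fieldD(1)[OF vector_field_lie_bracket[OF U that] x])
    have flat: "flat A \<sigma> x (r *\<^sub>R lie_bracket A X Y x + s *\<^sub>R lie_bracket A X' Y' x) =
        r *\<^sub>R (half_lie X (\<lambda>p. flat A \<sigma> p (Y p)) x - half_lie Y (\<lambda>p. flat A \<sigma> p (X p)) x)
        + s *\<^sub>R (half_lie X' (\<lambda>p. flat A \<sigma> p (Y' p)) x - half_lie Y' (\<lambda>p. flat A \<sigma> p (X' p)) x)"
      if "two_form A U \<sigma>" "closed2 A U \<sigma>" and v: "vector_field A U X" "vector_field A U Y"
        "vector_field A U X'" "vector_field A U Y'" for \<sigma> r s X Y X' Y'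
      by (simp only: flat_lincomb[OF that(1) x br[OF v(1,2)] br[OF v(3,4)]]
          half_lie_flat_closed[OF U that(1,2) _ _ x] v)
    note flatG = flat[OF forms(2,4), where r=1 and s=1, simplified]
        flat[OF forms(2,4), where r=1 and s="-1", simplified]
      and flatP = flat[OF forms(1,3), where r=1 and s=1, simplified]
        flat[OF forms(1,3), where r=1 and s="-1", simplified]
    note cov = courant_half_lie[OF U _ _ x]
    note h = hl[OF _ vf(2) vf(1) graph(1) x] hl[OF _ vf(1) vf(2) graph(2) x]
      hl[OF _ vf(4) vf(3) graph(3) x] hl[OF _ vf(3) vf(4) graph(4) x]
    show "fst (ccourant A Z W) x = (?R x, (- \<epsilon>) *\<^sub>R ?G ?I x + (- 1) *\<^sub>R ?P ?R x)"
      by (simp add: ccourant_def cov sec XY[symmetric] h vf flatG flatP) (simp add: algebra_simps)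
    show "snd (ccourant A Z W) x = (?I x, \<epsilon> *\<^sub>R ?G ?R x + (- 1) *\<^sub>R ?P ?I x)"
      by (simp add: ccourant_def cov sec XY[symmetric] h vf flatG flatP) (simp add: algebra_simps)
  qed
  have "gsection A U (fst (ccourant A Z W))"
    unfolding gsection_def
    using vector_field_cong[OF U vR, of "fst \<circ> fst (ccourant A Z W)"]
      one_form_cong[OF U one_form_lincomb[OF U G[OF vI] P[OF vR], of "- \<epsilon>" "- 1"], of "snd \<circ> fst (ccourant A Z W)"]
    by (simp add: re)
  moreover have "gsection A U (snd (ccourant A Z W))"
    unfolding gsection_def
    using vector_field_cong[OF U vI, of "fst \<circ> snd (ccourant A Z W)"]
      one_form_cong[OF U one_form_lincomb[OF U G[OF vR] P[OF vI], of \<epsilon> "- 1"], of "snd \<circ> snd (ccourant A Z W)"]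
    by (simp add: im)
  ultimately show ?thesis
    unfolding eigen_section_iff_graph[OF \<epsilon>] using re im by simp
qed

theorem generalized_complex_structure: "generalized_complex_structure A U (gcs_map A \<Omega> \<omega>)"
proof -
  have "\<i> = Complex 0 1" "- \<i> = Complex 0 (- 1)" by (simp_all add: complex_eq_iff)
  then show ?thesis
    unfolding generalized_complex_structure_def integrable_gcs_def
    using almost_generalized_complex eigen_section_ccourant[of 1] eigen_section_ccourant[of "- 1"] by auto
qed

end

section \<open>The Poincare lemma in a convex chart\<close>

context atlas
begin

lemma d0_outside: "v \<notin> tangent_space A x \<Longrightarrow> d0 A f x v = 0"
  by (simp add: d0_def restrict0_def)

lemma d0_cotangent:
  assumes c: "c \<in> charts_at A x" and f: "(f \<circ> chart_inv c) differentiable at (snd c x)"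
  shows "d0 A f x \<in> cotangent_space A x"
proof -
  have "d0 A f x = restrict0 (tangent_space A x) (d0 A f x)"
    by (auto simp: restrict0_def d0_outside fun_eq_iff)
  also have "\<dots> \<in> cotangent_space A x"
    by (rule restrict0_linear_cotangent[OF c linear_frechet_derivative[OF f]]) (rule d0_chart[OF c f])
  finally show ?thesis .
qed

lemma smooth_funD:
  assumes "smooth_fun A U f" "c \<in> A"
  shows "smooth_on (coords c U) (f \<circ> chart_inv c)"
  using assms by (simp add: smooth_fun_def)

lemma smooth_fun_differentiable:
  assumes "smooth_fun A U f" "c \<in> charts_at A x" "x \<in> U"
  shows "(f \<circ> chart_inv c) differentiable at (snd c x)"
  using smooth_on_imp_differentiable[OF smooth_funD[OF assms(1) charts_atD(1)[OF assms(2)]]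
      snd_in_coords[OF assms(2,3)]] .

lemma closed_one_forms_exact_convex:
  assumes c: "c \<in> A" and U: "openin (atlas_topology A) U" "U \<subseteq> fst c" and conv: "convex (coords c U)"
  shows "closed_one_forms_exact A U"
  unfolding closed_one_forms_exact_def
proof (intro allI impI, elim conjE)
  fix \<alpha> assume a: "one_form A U \<alpha>" and cl: "closed1 A U \<alpha>"
  note S = open_coords[OF c U(1)]
  have "\<exists>f. smooth_on (coords c U) f \<and> (\<forall>z\<in>coords c U. \<forall>v. D f z v = local1 A c \<alpha> z v)"
  proof (rule poincare_lemma_convex[OF S conv one_form_lin_field[OF a c]])
    fix z u v assume z: "z \<in> coords c U"
    let ?x = "chart_inv c z"
    note ca = charts_at_coords[OF c z] and x = coordsD[OF c z]
    have "d1 A \<alpha> ?x (coord_vector A c ?x u) (coord_vector A c ?x v) = 0"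
      using cl x(2) ca by (simp add: closed1_def)
    then show "D (\<lambda>z. local1 A c \<alpha> z v) z u = D (\<lambda>z. local1 A c \<alpha> z u) z v"
      using d1_chart[OF U(1) a x(2) ca coord_vector_tangent[OF ca] coord_vector_tangent[OF ca]] ca x(3)
      by simp
  qed
  then obtain f where f: "smooth_on (coords c U) f"
    "\<And>z v. z \<in> coords c U \<Longrightarrow> D f z v = local1 A c \<alpha> z v" by blast
  let ?f = "f \<circ> snd c"
  have sf: "smooth_fun A U ?f"
    unfolding smooth_fun_def
  proof
    fix c' assume c': "c' \<in> A"
    have sub: "coords c' U \<subseteq> coords c' (fst c)" using U(2) by auto
    have "smooth_on (coords c' U) (\<lambda>z. f (transition c' c z))"
      by (rule smooth_on_compose[OF open_coords[OF c' U(1)] _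
            smooth_on_subset[OF transition_smooth[OF c' c] sub] f(1)])
        (use transition_in_coords[OF c' c] U(2) in auto)
    then show "smooth_on (coords c' U) (?f \<circ> chart_inv c')"
      by (simp add: transition_def o_def)
  qed
  moreover have "d0 A ?f x = \<alpha> x" if x: "x \<in> U" for x
  proof (rule cotangent_eqI)
    have cx: "c \<in> charts_at A x" using x U(2) c by (auto simp: charts_at_def)
    note y = snd_in_coords[OF cx x] and df = smooth_fun_differentiable[OF sf cx x]
    show "d0 A ?f x \<in> cotangent_space A x" by (rule d0_cotangent[OF cx df])
    show "\<alpha> x \<in> cotangent_space A x" using a x by (simp add: one_form_def)
    fix v assume v: "v \<in> tangent_space A x"
    have "D (?f \<circ> chart_inv c) (snd c x) = D f (snd c x)"
      by (rule D_cong_open[OF S y]) (use c in auto)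
    then show "d0 A ?f x v = \<alpha> x v"
      using f(2)[OF y] local1_components[OF cx v, of \<alpha>] by (simp add: d0_chart[OF cx df v])
  qed
  ultimately show "\<exists>f. smooth_fun A U f \<and> (\<forall>x\<in>U. d0 A f x = \<alpha> x)" by blast
qed

text \<open>A convex coordinate neighbourhood, as the Poincare lemma requires.  Openness in the atlas
  topology has to be checked in all charts, through the transition maps.\<close>

lemma ball_neighbourhood:
  assumes x: "x \<in> points A"
  obtains c V r where "c \<in> A" "openin (atlas_topology A) V" "x \<in> V" "V \<subseteq> fst c"
    "coords c V = ball (snd c x) r"
proof -
  define c where "c = chart_at A x"
  have ca: "c \<in> charts_at A x" using chart_at[OF x] by (simp add: c_def)
  note c = charts_atD[OF ca]
  have "open (snd c ` fst c)" using atlas c by (auto simp: smooth_atlas_def)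
  then obtain r where r: "r > 0" "ball (snd c x) r \<subseteq> snd c ` fst c"
    using c openE by blast
  let ?V = "chart_inv c ` ball (snd c x) r"
  have inv: "chart_inv c y \<in> fst c" "snd c (chart_inv c y) = y" if "y \<in> ball (snd c x) r" for y
    using r(2) that c by auto
  have co: "coords c ?V = ball (snd c x) r"
    using inv by force
  have "open (coords c' ?V)" if c': "c' \<in> A" for c'
  proof -
    have "coords c' ?V = coords c' (fst c) \<inter> transition c' c -` ball (snd c x) r"
    proof (intro equalityI subsetI)
      fix y assume "y \<in> coords c' ?V"
      then obtain b where b: "b \<in> ball (snd c x) r" "chart_inv c b \<in> fst c'" "y = snd c' (chart_inv c b)"
        by auto
      then show "y \<in> coords c' (fst c) \<inter> transition c' c -` ball (snd c x) r"
        using inv[OF b(1)] c' by (auto simp: transition_def)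
    next
      fix y assume y: "y \<in> coords c' (fst c) \<inter> transition c' c -` ball (snd c x) r"
      then obtain p where p: "p \<in> fst c'" "p \<in> fst c" "y = snd c' p" by auto
      then have "snd c p \<in> ball (snd c x) r" using y c' by (auto simp: transition_def)
      then have "p \<in> ?V" using p(2) c by (intro image_eqI[of _ _ "snd c p"]) auto
      then show "y \<in> coords c' ?V" using p by auto
    qed
    moreover have "open (coords c' (fst c) \<inter> transition c' c -` ball (snd c x) r)"
      by (intro continuous_open_preimage smooth_on_imp_continuous_on transition_smooth
          open_overlap c' c open_ball)
    ultimately show ?thesis by simp
  qed
  moreover have Vc: "?V \<subseteq> fst c" using inv by blast
  moreover have "fst c \<subseteq> points A" using c by (auto simp: points_def)
  ultimately have "openin (atlas_topology A) ?V"
    unfolding openin_atlas_topology[OF atlas] by blast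
  moreover have "x \<in> ?V" using c r(1) by (intro image_eqI[of _ _ "snd c x"]) auto
  ultimately show ?thesis using that c(1) co Vc by blast
qed

end

section \<open>The atlas of the cotangent bundle\<close>

context atlas
begin

definition momentum :: "('m, 'e) chart \<Rightarrow> 'm \<Rightarrow> ('m, 'e) covec \<Rightarrow> 'e"
  where "momentum c x \<xi> = (\<Sum>b\<in>Basis. \<xi> (coord_vector A c x b) *\<^sub>R b)"

text \<open>The inverse of \<open>momentum c x\<close>: the covector at \<open>x\<close> with components \<open>p\<close> in the chart \<open>c\<close>.\<close>
definition covector :: "('m, 'e) chart \<Rightarrow> 'm \<Rightarrow> 'e \<Rightarrow> ('m, 'e) covec"
  where "covector c x p = restrict0 (tangent_space A x) (\<lambda>v. p \<bullet> v c)"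

lemma covector_cotangent: "c \<in> charts_at A x \<Longrightarrow> covector c x p \<in> cotangent_space A x"
  unfolding covector_def
  by (rule restrict0_linear_cotangent[where l="\<lambda>a. p \<bullet> a"])
    (auto intro: bounded_linear.linear bounded_linear_inner_right)

lemma momentum_inner:
  assumes c: "c \<in> charts_at A x" and \<xi>: "\<xi> \<in> cotangent_space A x"
  shows "momentum c x \<xi> \<bullet> a = \<xi> (coord_vector A c x a)"
  using linear_functional_expand[OF cotangent_linear[OF \<xi> c], of a] by (simp add: momentum_def)

lemma momentum_covector: "c \<in> charts_at A x \<Longrightarrow> momentum c x (covector c x p) = p"
  by (simp add: momentum_def covector_def restrict0_def euclidean_representation)

lemma covector_momentum:
  assumes c: "c \<in> charts_at A x" and \<xi>: "\<xi> \<in> cotangent_space A x"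
  shows "covector c x (momentum c x \<xi>) = \<xi>"
proof (rule cotangent_eqI[OF covector_cotangent[OF c] \<xi>])
  fix v assume "v \<in> tangent_space A x"
  then show "covector c x (momentum c x \<xi>) v = \<xi> v"
    by (simp add: covector_def restrict0_def momentum_inner[OF c \<xi>] coord_vector_components[OF c])
qed

lemma cotangent_chart_apply [simp]:
  "snd (cotangent_chart A c) (x, \<xi>) = (snd c x, momentum c x \<xi>)"
  by (simp add: cotangent_chart_def momentum_def)

lemma fst_cotangent_chart: "fst (cotangent_chart A c) = cotangent_over A (fst c)"
  by (simp add: cotangent_chart_def cotangent_over_def)

lemma mem_cotangent_over: "(x, \<xi>) \<in> cotangent_over A V \<longleftrightarrow> x \<in> V \<and> \<xi> \<in> cotangent_space A x"
  by (simp add: cotangent_over_def)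

lemma cotangent_chart_image:
  assumes c: "c \<in> A"
  shows "snd (cotangent_chart A c) ` (fst (cotangent_chart A c) \<inter> cotangent_over A V) = coords c V \<times> UNIV"
proof (intro equalityI subsetI)
  fix y assume "y \<in> coords c V \<times> (UNIV :: 'e set)"
  then obtain x p where x: "x \<in> fst c \<inter> V" "y = (snd c x, p)" by auto
  then have ca: "c \<in> charts_at A x" using c by (simp add: charts_at_def)
  show "y \<in> snd (cotangent_chart A c) ` (fst (cotangent_chart A c) \<inter> cotangent_over A V)"
    using x covector_cotangent[OF ca] momentum_covector[OF ca]
    by (intro image_eqI[of _ _ "(x, covector c x p)"])
      (auto simp: fst_cotangent_chart mem_cotangent_over)
qed (auto simp: fst_cotangent_chart mem_cotangent_over)

lemma cotangent_chart_inj: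
  assumes c: "c \<in> A" shows "inj_on (snd (cotangent_chart A c)) (fst (cotangent_chart A c))"
proof (rule inj_onI, clarify)
  fix x \<xi> x' \<xi>'
  assume "(x, \<xi>) \<in> fst (cotangent_chart A c)" "(x', \<xi>') \<in> fst (cotangent_chart A c)"
    and eq: "snd (cotangent_chart A c) (x, \<xi>) = snd (cotangent_chart A c) (x', \<xi>')"
  then have x: "x \<in> fst c" "x' \<in> fst c" and \<xi>: "\<xi> \<in> cotangent_space A x" "\<xi>' \<in> cotangent_space A x'"
    by (auto simp: fst_cotangent_chart mem_cotangent_over)
  have "snd c x = snd c x'" using eq by simp
  then have [simp]: "x' = x" using chart_inv_chart[OF c x(1)] chart_inv_chart[OF c x(2)] by metis
  have ca: "c \<in> charts_at A x" using c x by (simp add: charts_at_def)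
  show "x = x' \<and> \<xi> = \<xi>'"
    using eq covector_momentum[OF ca \<xi>(1)] covector_momentum[OF ca, of \<xi>'] \<xi>(2) by simp
qed

lemma cotangent_chart_inv:
  assumes c: "c \<in> A" and q: "q \<in> coords c V"
  shows "chart_inv (cotangent_chart A c) (q, p) = (chart_inv c q, covector c (chart_inv c q) p)"
proof -
  note ca = charts_at_coords[OF c q]
  have "(chart_inv c q, covector c (chart_inv c q) p) \<in> fst (cotangent_chart A c)"
    using covector_cotangent[OF ca] ca by (simp add: fst_cotangent_chart mem_cotangent_over charts_at_def)
  moreover have "snd (cotangent_chart A c) (chart_inv c q, covector c (chart_inv c q) p) = (q, p)"
    using momentum_covector[OF ca] coordsD(3)[OF c q] by simp
  ultimately show ?thesis
    unfolding chart_inv_def[of "cotangent_chart A c"]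
    by (intro inv_into_f_eq[OF cotangent_chart_inj[OF c]])
qed

text \<open>Momenta transform under the transposed derivative of the inverse transition.  That derivative is
  taken from the transition in the opposite direction, so no matrix has to be inverted and
  smoothness is evident.\<close>

lemma cotangent_transition:
  assumes c: "c \<in> A" "c' \<in> A" and q: "q \<in> coords c (fst c')"
  shows "transition (cotangent_chart A c) (cotangent_chart A c') (q, p) =
    (transition c c' q, \<Sum>b\<in>Basis. (p \<bullet> D (transition c' c) (transition c c' q) b) *\<^sub>R b)"
proof -
  note o = overlap_charts_at[OF c q]
  have "covector c (chart_inv c q) p (coord_vector A c' (chart_inv c q) b) =
      p \<bullet> D (transition c' c) (transition c c' q) b" for b
    using coord_vector_tangent[OF o(2)] coord_vector_component[OF o(1)] o(4)
    by (simp only: covector_def restrict0_def if_True)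
  then show ?thesis
    by (simp add: transition_def[of "cotangent_chart A c"] cotangent_chart_inv[OF c(1) q] momentum_def o(4))
qed

lemma cotangent_transition_smooth:
  assumes c: "c \<in> A" "c' \<in> A"
  shows "smooth_on (coords c (fst c') \<times> UNIV) (transition (cotangent_chart A c) (cotangent_chart A c'))"
proof (rule smooth_on_cong)
  let ?S = "coords c (fst c') \<times> (UNIV :: 'e set)" and ?\<phi> = "\<lambda>z::'e \<times> 'e. transition c c' (fst z)"
  show S: "open ?S" by (intro open_Times open_overlap c open_UNIV)
  have \<phi>: "smooth_on ?S ?\<phi>"
    by (rule smooth_on_compose[OF S _ smooth_on_linear[OF bounded_linear_fst] transition_smooth[OF c]]) auto
  have "smooth_on ?S (\<lambda>z. D (transition c' c) (?\<phi> z) b)" for b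
    by (rule smooth_on_compose[OF S _ \<phi> smooth_on_D[OF transition_smooth[OF c(2,1)]]])
      (auto simp: transition_def c)
  then show "smooth_on ?S (\<lambda>z. (?\<phi> z, \<Sum>b\<in>Basis. (snd z \<bullet> D (transition c' c) (?\<phi> z) b) *\<^sub>R b))"
    by (intro smooth_on_Pair S \<phi> smooth_on_sum smooth_on_scaleR smooth_on_const
        smooth_on_bounded_bilinear[OF S bounded_bilinear_inner] smooth_on_linear[OF bounded_linear_snd])
qed (auto simp: cotangent_transition[OF c])

lemma cotangent_atlas: "atlas (cotangent_bundle A)"
proof (unfold_locales, unfold smooth_atlas_def, intro conjI ballI)
  have over: "fst (cotangent_chart A c) \<inter> fst (cotangent_chart A c') =
      fst (cotangent_chart A c) \<inter> cotangent_over A (fst c')" for c c'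
    by (simp add: fst_cotangent_chart)
  fix C assume "C \<in> cotangent_bundle A"
  then obtain c where c: "c \<in> A" and C: "C = cotangent_chart A c" by (auto simp: cotangent_bundle_def)
  show "inj_on (snd C) (fst C)" unfolding C by (rule cotangent_chart_inj[OF c])
  show "open (snd C ` fst C)"
    using cotangent_chart_image[OF c, of "fst c"] open_overlap[OF c c]
    by (simp add: C fst_cotangent_chart open_Times)
  fix C' assume "C' \<in> cotangent_bundle A"
  then obtain c' where c': "c' \<in> A" and C': "C' = cotangent_chart A c'" by (auto simp: cotangent_bundle_def)
  show "open (snd C ` (fst C \<inter> fst C'))"
    unfolding C C' over cotangent_chart_image[OF c] by (intro open_Times open_overlap c c' open_UNIV)
  show "smooth_on (snd C ` (fst C \<inter> fst C')) (transition C C')"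
    unfolding C C' over cotangent_chart_image[OF c] by (rule cotangent_transition_smooth[OF c c'])
qed

end

section \<open>The canonical symplectic form\<close>

text \<open>The standard symplectic form \<open>\<Sum> dq\<^sub>i \<and> dp\<^sub>i\<close> on pairs \<open>(q, p)\<close>.\<close>
definition symp :: "'e::euclidean_space \<times> 'e \<Rightarrow> 'e \<times> 'e \<Rightarrow> real"
  where "symp u v = fst u \<bullet> snd v - fst v \<bullet> snd u"

lemma symp_linear:
  "symp (u + v) w = symp u w + symp v w" "symp u (v + w) = symp u v + symp u w"
  "symp (r *\<^sub>R u) w = r * symp u w" "symp u (r *\<^sub>R w) = r * symp u w" "symp u u = 0"
  by (simp_all add: symp_def algebra_simps)

lemma symp_nondegenerate:
  assumes "\<And>v. symp u v = 0" shows "u = 0"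
  using assms[of "(snd u, 0)"] assms[of "(0, fst u)"] by (simp add: symp_def prod_eq_iff)

locale cotangent = atlas A for A :: "('n, 'e::euclidean_space) chart set"
begin

sublocale T: atlas "cotangent_bundle A"
  by (rule cotangent_atlas)

lemma coords_cotangent_over:
  assumes "c \<in> A"
  shows "T.coords (cotangent_chart A c) (cotangent_over A V) = coords c V \<times> UNIV"
  using cotangent_chart_image[OF assms] .

lemma cotangent_bundleE:
  assumes "C \<in> cotangent_bundle A" obtains c where "c \<in> A" "C = cotangent_chart A c"
  using assms by (auto simp: cotangent_bundle_def)

lemma points_cotangent_bundle: "points (cotangent_bundle A) = cotangent_over A (points A)"
  by (force simp: points_def cotangent_bundle_def fst_cotangent_chart cotangent_over_def)

lemma openin_cotangent_over:
  assumes V: "openin (atlas_topology A) V"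
  shows "openin (atlas_topology (cotangent_bundle A)) (cotangent_over A V)"
proof -
  have "cotangent_over A V \<subseteq> points (cotangent_bundle A)"
    using openin_subset_points[OF V] by (auto simp: points_cotangent_bundle cotangent_over_def)
  moreover have "open (T.coords C (cotangent_over A V))" if "C \<in> cotangent_bundle A" for C
  proof -
    from that obtain c where c: "c \<in> A" "C = cotangent_chart A c" by (rule cotangent_bundleE)
    show ?thesis
      unfolding c(2) coords_cotangent_over[OF c(1)] by (intro open_Times open_coords[OF c(1) V] open_UNIV)
  qed
  ultimately show ?thesis by (simp add: openin_atlas_topology[OF T.atlas])
qed

text \<open>Transitions of the cotangent bundle are symplectic: differentiate the identity
  \<open>P \<bullet> D\<phi>(q) a = p \<bullet> a\<close> that defines the new momentum \<open>P\<close>, and use that the second derivative of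
  the base transition \<open>\<phi>\<close> is symmetric.\<close>

lemma cotangent_transition_symplectic:
  assumes c: "c \<in> A" "c' \<in> A" and y: "y \<in> coords c (fst c') \<times> UNIV"
  defines "\<Phi> \<equiv> transition (cotangent_chart A c) (cotangent_chart A c')"
  shows "symp (D \<Phi> y u) (D \<Phi> y v) = symp u v"
proof -
  let ?S = "coords c (fst c') \<times> (UNIV :: 'e set)" and ?\<phi> = "transition c c'"
  have S: "open ?S" by (intro open_Times open_overlap c open_UNIV)
  have sm: "smooth_on ?S \<Phi>" unfolding \<Phi>_def by (rule cotangent_transition_smooth[OF c])
  note h = smooth_on_has_derivative[OF sm y]
  have sb: "smooth_on (coords c (fst c')) ?\<phi>" by (rule transition_smooth[OF c])
  have q: "fst y \<in> coords c (fst c')" using y by auto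
  have fstD: "fst (D \<Phi> y w) = D ?\<phi> (fst y) (fst w)" for w
  proof -
    have "((\<lambda>z. fst (\<Phi> z)) has_derivative (\<lambda>w. fst (D \<Phi> y w))) (at y)"
      by (rule has_derivative_fst[OF h])
    moreover have "((\<lambda>z. ?\<phi> (fst z)) has_derivative (\<lambda>w. D ?\<phi> (fst y) (fst w))) (at y)"
      by (rule has_derivative_compose[OF has_derivative_fst[OF has_derivative_ident]
            smooth_on_has_derivative[OF sb q]])
    then have "((\<lambda>z. fst (\<Phi> z)) has_derivative (\<lambda>w. D ?\<phi> (fst y) (fst w))) (at y)"
      by (rule has_derivative_transform_within_open[OF _ S y]) (auto simp: \<Phi>_def cotangent_transition[OF c])
    ultimately show ?thesis by (metis has_derivative_unique)
  qed
  have mom: "snd (\<Phi> z) \<bullet> D ?\<phi> (fst z) a = snd z \<bullet> a" if z: "z \<in> ?S" for z a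
  proof -
    have qz: "fst z \<in> coords c (fst c')" using z by auto
    note o = overlap_charts_at[OF c qz]
    let ?L = "D (transition c' c) (?\<phi> (fst z))"
    have L: "linear ?L" using transition_D_linear[OF o(2,1)] o(4) by simp
    have "\<Phi> z = \<Phi> (fst z, snd z)" by simp
    then have "snd (\<Phi> z) \<bullet> d = (\<Sum>b\<in>Basis. (snd z \<bullet> ?L b) * (b \<bullet> d))" for d
      by (simp only: \<Phi>_def cotangent_transition[OF c qz]) (simp add: inner_sum_left)
    also have "\<dots> d = snd z \<bullet> ?L d" for d
      by (subst (2) linear_expand_Basis[OF L]) (simp add: inner_sum_right inner_commute mult.commute)
    finally have "snd (\<Phi> z) \<bullet> D ?\<phi> (fst z) a = snd z \<bullet> ?L (D ?\<phi> (fst z) a)" .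
    then show ?thesis
      using transition_D_compose[OF o(1,2,1), of a] transition_D_self[OF o(1)] o(3,4) by simp
  qed
  have key: "snd (D \<Phi> y u) \<bullet> D ?\<phi> (fst y) a + snd (\<Phi> y) \<bullet> D (\<lambda>q. D ?\<phi> q a) (fst y) (fst u) = snd u \<bullet> a"
    for u a
  proof -
    have 1: "((\<lambda>z. D ?\<phi> (fst z) a) has_derivative (\<lambda>w. D (\<lambda>q. D ?\<phi> q a) (fst y) (fst w))) (at y)"
      by (rule has_derivative_compose[OF has_derivative_fst[OF has_derivative_ident]
            smooth_on_has_derivative[OF smooth_on_D[OF sb] q]])
    have 2: "((\<lambda>z. snd (\<Phi> z) \<bullet> D ?\<phi> (fst z) a) has_derivative
      (\<lambda>w. snd (\<Phi> y) \<bullet> D (\<lambda>q. D ?\<phi> q a) (fst y) (fst w) + snd (D \<Phi> y w) \<bullet> D ?\<phi> (fst y) a)) (at y)"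
      by (rule has_derivative_inner[OF has_derivative_snd[OF h] 1])
    have "((\<lambda>z::'e \<times> 'e. snd z \<bullet> a) has_derivative (\<lambda>w. snd w \<bullet> a)) (at y)"
      by (intro has_derivative_inner_left has_derivative_snd has_derivative_ident)
    then have "((\<lambda>z. snd (\<Phi> z) \<bullet> D ?\<phi> (fst z) a) has_derivative (\<lambda>w. snd w \<bullet> a)) (at y)"
      by (rule has_derivative_transform_within_open[OF _ S y]) (rule mom[symmetric])
    from fun_cong[OF has_derivative_unique[OF 2 this], of u] show ?thesis by simp
  qed
  show ?thesis
    using key[of u "fst v"] key[of v "fst u"]
      second_derivative_symmetric[OF open_overlap[OF c] sb q, of "fst v" "fst u"]
    by (simp add: symp_def fstD inner_commute)
qed

lemma canonical_form_chart:
  assumes C: "C \<in> charts_at (cotangent_bundle A) m"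
    and u: "u \<in> tangent_space (cotangent_bundle A) m" and v: "v \<in> tangent_space (cotangent_bundle A) m"
  shows "canonical_form A m u v = symp (u C) (v C)"
proof -
  define C0 where "C0 = chart_at (cotangent_bundle A) m"
  have C0: "C0 \<in> charts_at (cotangent_bundle A) m"
    using T.chart_at T.charts_at_point[OF C] by (simp add: C0_def)
  obtain c0 where c0: "c0 \<in> A" "C0 = cotangent_chart A c0"
    using T.charts_atD(1)[OF C0] by (rule cotangent_bundleE)
  obtain c where c: "c \<in> A" "C = cotangent_chart A c"
    using T.charts_atD(1)[OF C] by (rule cotangent_bundleE)
  have y: "snd C m \<in> coords c (fst c0) \<times> UNIV"
    using T.charts_atD(2)[OF C] T.charts_atD(2)[OF C0]
    unfolding coords_cotangent_over[OF c(1), symmetric] by (auto simp: c(2) c0(2) fst_cotangent_chart)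
  have "canonical_form A m u v = symp (u C0) (v C0)"
    by (simp add: canonical_form_def Let_def C0_def[symmetric] symp_def sum_subtractf euclidean_inner[symmetric])
  also have "\<dots> = symp (u C) (v C)"
    unfolding T.tangent_component[OF u C C0] T.tangent_component[OF v C C0]
    using cotangent_transition_symplectic[OF c(1) c0(1) y] by (simp add: c(2) c0(2))
  finally show ?thesis .
qed

lemma local2_canonical_form:
  assumes C: "C \<in> cotangent_bundle A" and y: "y \<in> T.coords C U"
  shows "local2 (cotangent_bundle A) C (canonical_form A) y a b = symp a b"
  using T.charts_at_coords[OF C y] by (simp add: local2_def canonical_form_chart)

lemma symplectic_canonical_form:
  assumes U: "openin (atlas_topology (cotangent_bundle A)) U"
  shows "symplectic_form (cotangent_bundle A) U (canonical_form A)"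
proof -
  let ?T = "cotangent_bundle A"
  have ca: "chart_at ?T x \<in> charts_at ?T x" if "x \<in> U" for x
    using that T.chart_at T.openin_subset_points[OF U] by blast
  have two: "two_form ?T U (canonical_form A)"
    unfolding two_form_def
  proof (intro conjI ballI allI)
    fix x u assume x: "x \<in> U" and u: "u \<in> tangent_space ?T x"
    note can = canonical_form_chart[OF ca[OF x]]
    show "linear_on (tangent_space ?T x) (canonical_form A x u)"
      "linear_on (tangent_space ?T x) (\<lambda>v. canonical_form A x v u)"
      using u by (simp_all add: linear_on_def can T.tangent_add T.tangent_scaleR symp_linear scaleR_fun_apply)
    show "canonical_form A x u u = 0" using u by (simp add: can symp_linear)
  next
    fix C a b assume C: "C \<in> ?T"
    show "smooth_on (T.coords C U) (\<lambda>y. local2 ?T C (canonical_form A) y a b)"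
      by (rule smooth_on_cong[OF T.open_coords[OF C U] _ smooth_on_const[of _ "symp a b"]])
        (rule local2_canonical_form[OF C, symmetric])
  qed
  moreover have "closed2 ?T U (canonical_form A)"
    unfolding closed2_def
  proof (intro ballI)
    fix x u v w assume x: "x \<in> U" and t: "u \<in> tangent_space ?T x" "v \<in> tangent_space ?T x" "w \<in> tangent_space ?T x"
    let ?C = "chart_at ?T x"
    note C = ca[OF x] and CT = T.charts_atD(1)[OF ca[OF x]]
    have "D (\<lambda>z. local2 ?T ?C (canonical_form A) z a b) (snd ?C x) = D (\<lambda>z. symp a b) (snd ?C x)" for a b
      by (rule D_cong_open[OF T.open_coords[OF CT U] T.snd_in_coords[OF C x]])
        (rule local2_canonical_form[OF CT])
    then show "d2 ?T (canonical_form A) x u v w = 0"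
      by (simp add: T.d2_chart[OF U two x C t])
  qed
  moreover have "u = 0"
    if x: "x \<in> U" and u: "u \<in> tangent_space ?T x" and z: "\<forall>v\<in>tangent_space ?T x. canonical_form A x u v = 0"
    for x u
  proof -
    note C = ca[OF x]
    have "symp (u (chart_at ?T x)) b = 0" for b
      using bspec[OF z T.coord_vector_tangent[OF C, of b]] C u by (simp add: canonical_form_chart[OF C])
    then have "u (chart_at ?T x) = 0" by (rule symp_nondegenerate)
    then have "coord_vector ?T (chart_at ?T x) x (0 *\<^sub>R 0) = u"
      using T.coord_vector_components[OF C u] by simp
    then show ?thesis by (simp only: T.coord_vector_scaleR[OF C]) simp
  qed
  ultimately show ?thesis by (auto simp: symplectic_form_def)
qed

lemma symplectic_locale:
  "openin (atlas_topology (cotangent_bundle A)) U \<Longrightarrow>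
    symplectic (cotangent_bundle A) U (canonical_form A)"
  by unfold_locales (auto intro: symplectic_canonical_form)

text \<open>\<open>\<Omega>\<close> has constant coefficients in the induced charts, so its inverse is explicit and smooth.\<close>

lemma flat_inv_canonical_form:
  assumes U: "openin (atlas_topology (cotangent_bundle A)) U" and m: "m \<in> U"
    and C: "C \<in> charts_at (cotangent_bundle A) m" and \<xi>: "\<xi> \<in> cotangent_space (cotangent_bundle A) m"
  shows "flat_inv (cotangent_bundle A) (canonical_form A) m \<xi> =
    coord_vector (cotangent_bundle A) C m
      (\<Sum>b\<in>Basis. \<xi> (coord_vector (cotangent_bundle A) C m (0, b)) *\<^sub>R b,
       - (\<Sum>b\<in>Basis. \<xi> (coord_vector (cotangent_bundle A) C m (b, 0)) *\<^sub>R b))"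
proof -
  interpret S: symplectic "cotangent_bundle A" U "canonical_form A" by (rule symplectic_locale[OF U])
  let ?e = "coord_vector (cotangent_bundle A) C m"
  let ?p = "(\<Sum>b\<in>Basis. \<xi> (?e (0, b)) *\<^sub>R b, - (\<Sum>b\<in>Basis. \<xi> (?e (b, 0)) *\<^sub>R b))"
  have lin: "linear (\<lambda>a. \<xi> (?e a))" by (rule T.cotangent_linear[OF \<xi> C])
  have "linear (\<lambda>b::'e. (b, 0::'e))" "linear (\<lambda>b::'e. (0::'e, b))" by (auto intro!: linearI)
  note lin12 = linear_compose[OF this(1) lin, unfolded o_def] linear_compose[OF this(2) lin, unfolded o_def]
  have "symp ?p a = \<xi> (?e a)" for a
  proof -
    have "symp ?p a = \<xi> (?e (0, snd a)) + \<xi> (?e (fst a, 0))"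
      using linear_functional_expand[OF lin12(2), of "snd a"]
        linear_functional_expand[OF lin12(1), of "fst a"]
      by (simp add: symp_def inner_commute[of "fst a"])
    also have "\<dots> = \<xi> (?e ((0, snd a) + (fst a, 0)))" by (rule linear_add[OF lin, symmetric])
    finally show ?thesis by simp
  qed
  then have "flat (cotangent_bundle A) (canonical_form A) m (?e ?p) = \<xi>"
    using C \<xi> by (intro T.cotangent_eqI[OF T.flat_cotangent[OF S.symplectic_two_form m] \<xi>])
      (simp_all add: T.flat_apply canonical_form_chart[OF C] T.coord_vector_components)
  then show ?thesis using C by (intro S.flat_inv_eqI[OF m]) simp_all
qed

lemma flat_inv_smooth:
  assumes U: "openin (atlas_topology (cotangent_bundle A)) U" and a: "one_form (cotangent_bundle A) U \<alpha>"
  shows "vector_field (cotangent_bundle A) U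
    (\<lambda>m. flat_inv (cotangent_bundle A) (canonical_form A) m (\<alpha> m))"
  unfolding vector_field_def
proof (intro conjI ballI)
  let ?T = "cotangent_bundle A"
  interpret S: symplectic ?T U "canonical_form A" by (rule symplectic_locale[OF U])
  have am: "\<alpha> m \<in> cotangent_space ?T m" if "m \<in> U" for m using a that by (simp add: one_form_def)
  then show "flat_inv ?T (canonical_form A) m (\<alpha> m) \<in> tangent_space ?T m" if "m \<in> U" for m
    using that by simp
  fix C assume C: "C \<in> ?T"
  note V = T.open_coords[OF C U]
  have l: "smooth_on (T.coords C U) (\<lambda>y. local1 ?T C \<alpha> y b)" for b
    by (rule lin_fieldD(2)[OF T.one_form_lin_field[OF a C]])
  show "smooth_on (T.coords C U) (\<lambda>y. flat_inv ?T (canonical_form A) (chart_inv C y) (\<alpha> (chart_inv C y)) C)"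
  proof (rule smooth_on_cong[OF V])
    show "smooth_on (T.coords C U) (\<lambda>y. (\<Sum>b\<in>Basis. local1 ?T C \<alpha> y (0, b) *\<^sub>R b,
        - (\<Sum>b\<in>Basis. local1 ?T C \<alpha> y (b, 0) *\<^sub>R b)))"
      by (intro smooth_on_Pair smooth_on_minus smooth_on_sum smooth_on_scaleR smooth_on_const V l)
    fix y assume y: "y \<in> T.coords C U"
    note Cy = T.charts_at_coords[OF C y] and m = T.coordsD(2)[OF C y]
    show "(\<Sum>b\<in>Basis. local1 ?T C \<alpha> y (0, b) *\<^sub>R b, - (\<Sum>b\<in>Basis. local1 ?T C \<alpha> y (b, 0) *\<^sub>R b)) =
        flat_inv ?T (canonical_form A) (chart_inv C y) (\<alpha> (chart_inv C y)) C"
      using Cy by (simp add: flat_inv_canonical_form[OF U m Cy am[OF m]] local1_def)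
  qed
qed

text \<open>The graph of \<open>df\<close> is Lagrangian: in coordinates it is \<open>q \<mapsto> (q, grad f)\<close>, and the pullback of
  \<open>\<Omega>\<close> is the antisymmetric part of the Hessian.\<close>

lemma pullback_canonical_form_diff_section:
  assumes V: "openin (atlas_topology A) V" and f: "smooth_fun A V f" and x: "x \<in> V"
  shows "canonical_form A (diff_section A f x)
    (pushforward A (cotangent_bundle A) (diff_section A f) x u)
    (pushforward A (cotangent_bundle A) (diff_section A f) x v) = 0"
proof -
  let ?T = "cotangent_bundle A" and ?F = "diff_section A f"
  have xp: "x \<in> points A" using openin_subset_points[OF V] x by blast
  define c0 where "c0 = chart_at A x"
  have c0: "c0 \<in> charts_at A x" using chart_at[OF xp] by (simp add: c0_def)
  have "?F x \<in> points ?T"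
    using xp d0_cotangent[OF c0 smooth_fun_differentiable[OF f c0 x]]
    by (simp add: points_cotangent_bundle diff_section_def mem_cotangent_over)
  define C where "C = chart_at ?T (?F x)"
  have C: "C \<in> charts_at ?T (?F x)" using T.chart_at[OF \<open>?F x \<in> points ?T\<close>] by (simp add: C_def)
  obtain c where cA: "c \<in> A" and Cc: "C = cotangent_chart A c"
    using T.charts_atD(1)[OF C] by (rule cotangent_bundleE)
  have "x \<in> fst c"
    using T.charts_atD(2)[OF C] by (simp add: Cc fst_cotangent_chart diff_section_def mem_cotangent_over)
  then have c: "c \<in> charts_at A x" using cA by (simp add: charts_at_def)
  define g where "g = f \<circ> chart_inv c"
  have g: "smooth_on (coords c V) g" unfolding g_def by (rule smooth_funD[OF f cA])
  define H where "H y = (y, \<Sum>b\<in>Basis. D g y b *\<^sub>R b)" for y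
  note A = charts_atD(1)[OF c0] cA
  let ?\<psi> = "transition c0 c" and ?S = "coords c0 (fst c \<inter> V)"
  have S: "open ?S" using open_overlap[OF A] open_coords[OF A(1) V] by (simp add: coords_Int[OF A(1)] open_Int)
  have xS: "snd c0 x \<in> ?S" using c c0 x by (auto simp: charts_at_def)
  have y: "snd c x \<in> coords c V" by (rule snd_in_coords[OF c x])
  have hF: "snd C (?F (chart_inv c0 z)) = H (?\<psi> z)" if z: "z \<in> ?S" for z
  proof -
    have z': "z \<in> coords c0 (fst c)" using z by auto
    note o = overlap_charts_at[OF A z']
    have xV: "chart_inv c0 z \<in> V" using z A by auto
    have "d0 A f (chart_inv c0 z) (coord_vector A c (chart_inv c0 z) b) = D g (?\<psi> z) b" for b
      using d0_chart[OF o(2) smooth_fun_differentiable[OF f o(2) xV] coord_vector_tangent[OF o(2)]] o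
      by (simp add: g_def)
    then show ?thesis
      using o by (simp add: Cc diff_section_def H_def momentum_def)
  qed
  have hH: "(H has_derivative (\<lambda>w. (w, \<Sum>b\<in>Basis. D (\<lambda>z. D g z b) (snd c x) w *\<^sub>R b))) (at (snd c x))"
    unfolding H_def
    by (intro has_derivative_Pair has_derivative_ident has_derivative_sum has_derivative_scaleR_left
        smooth_on_has_derivative[OF smooth_on_D[OF g] y])
  have DF: "D (snd C \<circ> ?F \<circ> chart_inv c0) (snd c0 x) w =
      (D ?\<psi> (snd c0 x) w, \<Sum>b\<in>Basis. D (\<lambda>z. D g z b) (snd c x) (D ?\<psi> (snd c0 x) w) *\<^sub>R b)" for w
  proof -
    have e: "?\<psi> (snd c0 x) = snd c x" using c0 by (simp add: transition_chart charts_at_def)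
    have "((\<lambda>z. H (?\<psi> z)) has_derivative
      (\<lambda>w. (D ?\<psi> (snd c0 x) w, \<Sum>b\<in>Basis. D (\<lambda>z. D g z b) (snd c x) (D ?\<psi> (snd c0 x) w) *\<^sub>R b))) (at (snd c0 x))"
      by (rule has_derivative_compose[OF transition_has_derivative[OF c0 c], unfolded e, OF hH])
    then have "((snd C \<circ> ?F \<circ> chart_inv c0) has_derivative
      (\<lambda>w. (D ?\<psi> (snd c0 x) w, \<Sum>b\<in>Basis. D (\<lambda>z. D g z b) (snd c x) (D ?\<psi> (snd c0 x) w) *\<^sub>R b))) (at (snd c0 x))"
      by (rule has_derivative_transform_within_open[OF _ S xS]) (simp add: hF)
    from D_eqI[OF this] show ?thesis by simp
  qed
  have hess: "a \<bullet> (\<Sum>b\<in>Basis. D (\<lambda>z. D g z b) (snd c x) d *\<^sub>R b) = D (\<lambda>z. D g z a) (snd c x) d" for a d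
  proof -
    have "linear (\<lambda>b. D (\<lambda>z. D g z b) (snd c x) d)"
      by (rule lin_fieldD(1)[OF lin_field_deriv[OF open_coords[OF cA V] lin_field_D[OF g]] y])
    from linear_functional_expand[OF this, of a] show ?thesis by (simp add: inner_commute)
  qed
  have pf: "pushforward A ?T ?F x w =
      coord_vector ?T C (?F x) (D (snd C \<circ> ?F \<circ> chart_inv c0) (snd c0 x) (w c0))" for w
    by (simp add: pushforward_def Let_def c0_def[symmetric] C_def[symmetric])
  show ?thesis
    unfolding pf using C second_derivative_symmetric[OF open_coords[OF cA V] g y,
        of "D ?\<psi> (snd c0 x) (u c0)" "D ?\<psi> (snd c0 x) (v c0)"]
    by (simp add: canonical_form_chart[OF C] DF symp_def hess)
qed

end

section \<open>The wedge product with the symplectic form in dimension four\<close>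

lemma linear_zero_on_Basis:
  fixes f :: "'a::euclidean_space \<Rightarrow> real"
  assumes "linear f" "\<And>b. b \<in> Basis \<Longrightarrow> f b = 0" shows "f x = 0"
  using linear_expand_Basis[OF assms(1), of x] assms(2) by simp

text \<open>The contraction of a three-form with the bivector dual to \<open>symp\<close>, the vectors \<open>(b, 0)\<close>, \<open>(0, b)\<close>
  forming a symplectic basis.\<close>
definition symp_contraction ::
    "('e::euclidean_space \<times> 'e \<Rightarrow> 'e \<times> 'e \<Rightarrow> 'e \<times> 'e \<Rightarrow> real) \<Rightarrow> 'e \<times> 'e \<Rightarrow> real"
  where "symp_contraction \<tau> a = (\<Sum>b\<in>Basis. \<tau> a (b, 0) (0, b))"

text \<open>Contracting \<open>l \<and> symp\<close> gives \<open>(n - 1) l\<close> in dimension \<open>2 n\<close>: the first term of the wedge product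
  contributes \<open>n l\<close>, the other two together \<open>- l\<close>.  Hence for \<open>n = 2\<close> contraction is a left inverse
  of the wedge product with \<open>symp\<close>.\<close>
lemma symp_contraction_wedge:
  fixes l :: "(real^2) \<times> (real^2) \<Rightarrow> real"
  assumes l: "linear l" and \<tau>: "\<And>u v w. l u * symp v w - l v * symp u w + l w * symp u v = \<tau> u v w"
  shows "symp_contraction \<tau> a = l a"
proof -
  have "linear (\<lambda>b::real^2. (b, 0::real^2))" "linear (\<lambda>b::real^2. (0::real^2, b))"
    by (auto intro!: linearI)
  note lin12 = linear_compose[OF this(1) l, unfolded o_def] linear_compose[OF this(2) l, unfolded o_def]
  have "symp_contraction \<tau> a =
      (\<Sum>b\<in>Basis. l a * 1 - l (b, 0) * (b \<bullet> fst a) - l (0, b) * (b \<bullet> snd a))"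
    unfolding symp_contraction_def \<tau>[symmetric]
    by (intro sum.cong refl) (simp add: symp_def inner_Basis inner_commute)
  also have "\<dots> = 2 * l a - l (fst a, 0) - l (0, snd a)"
    using linear_functional_expand[OF lin12(1), of "fst a"] linear_functional_expand[OF lin12(2), of "snd a"]
    by (simp add: sum_subtractf inner_sum_left)
  also have "l (0, snd a) = l a - l (fst a, 0)"
    using linear_add[OF l, of "(fst a, 0)" "(0, snd a)"] by simp
  finally show ?thesis by simp
qed

text \<open>On a four-dimensional space contraction is also a right inverse.  Both sides are alternating, so
  only triples of distinct basis vectors matter; three distinct vectors out of four contain exactly
  one symplectic pair, and both sides reduce to the same value.\<close>

lemma wedge_symp_contraction:
  fixes \<tau> :: "(real^2) \<times> (real^2) \<Rightarrow> (real^2) \<times> (real^2) \<Rightarrow> (real^2) \<times> (real^2) \<Rightarrow> real"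
  assumes lin: "\<And>b c. linear (\<lambda>a. \<tau> a b c)" "\<And>a c. linear (\<lambda>b. \<tau> a b c)" "\<And>a b. linear (\<tau> a b)"
    and alt: "\<And>a c. \<tau> a a c = 0" "\<And>a b. \<tau> a b b = 0"
  defines "l \<equiv> symp_contraction \<tau>"
  shows "l u * symp v w - l v * symp u w + l w * symp u v = \<tau> u v w"
proof -
  have sk12: "\<tau> a b c = - \<tau> b a c" for a b c
    using alt(1)[of "a + b" c] alt(1)[of a c] alt(1)[of b c] linear_add[OF lin(1)[of "a + b" c], of a b]
      linear_add[OF lin(2)[of a c], of a b] linear_add[OF lin(2)[of b c], of a b] by simp
  have sk23: "\<tau> a b c = - \<tau> a c b" for a b c
    using alt(2)[of a "b + c"] alt(2)[of a b] alt(2)[of a c] linear_add[OF lin(2)[of a "b + c"], of b c]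
      linear_add[OF lin(3)[of a b], of b c] linear_add[OF lin(3)[of a c], of b c] by simp
  have alt13: "\<tau> a b a = 0" for a b using sk12[of a b a] alt(2) by simp
  have lin_l: "linear l"
    unfolding l_def symp_contraction_def[abs_def] by (intro linear_compose_sum ballI lin)
  have lin_s: "linear (\<lambda>v. symp v w)" "linear (symp w)" for w :: "(real^2) \<times> (real^2)"
    by (intro linearI; simp add: symp_linear)+
  define \<beta> where "\<beta> u v w = l u * symp v w - l v * symp u w + l w * symp u v - \<tau> u v w" for u v w
  have \<beta>1: "linear (\<lambda>u. \<beta> u v w)" and \<beta>2: "linear (\<lambda>v. \<beta> u v w)" and \<beta>3: "linear (\<beta> u v)" for u v w
    unfolding \<beta>_def[abs_def]
    by (intro linearI; simp add: linear_add[OF lin_l] linear_scale[OF lin_l] symp_linear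
        linear_add[OF lin(1)] linear_scale[OF lin(1)] linear_add[OF lin(2)] linear_scale[OF lin(2)]
        linear_add[OF lin(3)] linear_scale[OF lin(3)] algebra_simps)+
  let ?x = "axis 1 1 :: real^2" and ?y = "axis 2 1 :: real^2"
  have B: "(Basis :: (real^2) set) = {?x, ?y}" "?x \<noteq> ?y"
    by (auto simp: Basis_vec_def UNIV_2 axis_eq_axis)
  let ?E1 = "(?x, 0 :: real^2)" and ?E2 = "(?y, 0 :: real^2)"
    and ?F1 = "(0 :: real^2, ?x)" and ?F2 = "(0 :: real^2, ?y)"
  have BP: "(Basis :: ((real^2) \<times> (real^2)) set) = {?E1, ?E2, ?F1, ?F2}"
    by (auto simp: Basis_prod_def B)
  have l: "l a = \<tau> a ?E1 ?F1 + \<tau> a ?E2 ?F2" for a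
    using B(2) by (simp add: l_def symp_contraction_def B(1))
  have "\<beta> a b c = 0" if "a \<in> Basis" "b \<in> Basis" "c \<in> Basis" for a b c
    using that unfolding BP
    \<comment> \<open>the instances of skewness sort the arguments into the order \<open>E1\<close>, \<open>E2\<close>, \<open>F1\<close>, \<open>F2\<close>\<close>
    by (elim insertE emptyE; simp add: \<beta>_def l symp_def inner_axis_axis alt alt13
        sk12[of ?E2 ?E1] sk12[of ?F1 ?E1] sk12[of ?F2 ?E1] sk12[of ?F1 ?E2] sk12[of ?F2 ?E2] sk12[of ?F2 ?F1]
        sk23[of _ ?E2 ?E1] sk23[of _ ?F1 ?E1] sk23[of _ ?F2 ?E1] sk23[of _ ?F1 ?E2] sk23[of _ ?F2 ?E2]
        sk23[of _ ?F2 ?F1])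
  then have "\<beta> a b w = 0" if "a \<in> Basis" "b \<in> Basis" for a b w
    using linear_zero_on_Basis[OF \<beta>3] that by blast
  then have "\<beta> a v w = 0" if "a \<in> Basis" for a v w
    using linear_zero_on_Basis[OF \<beta>2, of a] that by blast
  then have "\<beta> u v w = 0" for u v w
    using linear_zero_on_Basis[OF \<beta>1] by blast
  from this[of u v w] show ?thesis by (simp add: \<beta>_def)
qed

section \<open>Equations of divergent type\<close>

context atlas
begin

lemma d2_coord_vectors:
  assumes U: "openin (atlas_topology A) U" and s: "two_form A U \<sigma>" and x: "x \<in> U"
    and c: "c \<in> charts_at A x"
  shows "d2 A \<sigma> x (coord_vector A c x u) (coord_vector A c x v) (coord_vector A c x w) =
    D (\<lambda>z. local2 A c \<sigma> z v w) (snd c x) u - D (\<lambda>z. local2 A c \<sigma> z u w) (snd c x) v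
    + D (\<lambda>z. local2 A c \<sigma> z u v) (snd c x) w"
  using d2_chart[OF U s x c coord_vector_tangent[OF c] coord_vector_tangent[OF c] coord_vector_tangent[OF c]] c
  by simp

lemma d2_trilinear_alternating:
  assumes U: "openin (atlas_topology A) U" and s: "two_form A U \<sigma>" and x: "x \<in> U"
    and c: "c \<in> charts_at A x"
  defines "\<tau> \<equiv> \<lambda>u v w. d2 A \<sigma> x (coord_vector A c x u) (coord_vector A c x v) (coord_vector A c x w)"
  shows "linear (\<lambda>a. \<tau> a b d)" "linear (\<lambda>b. \<tau> a b d)" "linear (\<tau> a b)" "\<tau> a a d = 0" "\<tau> a b b = 0"
proof -
  let ?y = "snd c x" and ?s = "local2 A c \<sigma>"
  note cA = charts_atD(1)[OF c]
  note S = open_coords[OF cA U] and y = snd_in_coords[OF c x]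
  note bs = two_form_bilin_field[OF s cA]
  have \<tau>: "\<tau> u v w = D (\<lambda>z. ?s z v w) ?y u - D (\<lambda>z. ?s z u w) ?y v + D (\<lambda>z. ?s z u v) ?y w" for u v w
    unfolding \<tau>_def by (rule d2_coord_vectors[OF U s x c])
  have l: "linear (D (\<lambda>z. ?s z u v) ?y)" "linear (\<lambda>u. D (\<lambda>z. ?s z u v) ?y w)"
    "linear (\<lambda>v. D (\<lambda>z. ?s z u v) ?y w)" for u v w
    using lin_fieldD(1)[OF lin_field_D[OF lin_fieldD(2)[OF bilin_fieldD(1)[OF bs]]] y]
      lin_fieldD(1)[OF lin_field_deriv[OF S bilin_fieldD(2)[OF bs]] y]
      lin_fieldD(1)[OF lin_field_deriv[OF S bilin_fieldD(1)[OF bs]] y] by blast+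
  show "linear (\<lambda>a. \<tau> a b d)" "linear (\<lambda>b. \<tau> a b d)" "linear (\<tau> a b)"
    unfolding \<tau>[abs_def] by (intro linear_compose_add linear_compose_sub l)+
  have "D (\<lambda>z. ?s z u u) ?y w = 0" for u w
  proof -
    have "D (\<lambda>z. ?s z u u) ?y = D (\<lambda>z. 0) ?y"
      by (rule D_cong_open[OF S y]) (use local2_skew[OF s cA, of _ u u] in simp)
    then show ?thesis by simp
  qed
  then show "\<tau> a a d = 0" "\<tau> a b b = 0" by (simp_all add: \<tau>)
qed

end

locale cotangent_surface = cotangent A for A :: "('n, real^2) chart set" +
  fixes \<omega> :: "(('n, real^2) cpoint, (real^2) \<times> (real^2)) form2"
  assumes \<omega>: "two_form (cotangent_bundle A) (points (cotangent_bundle A)) \<omega>"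
begin

abbreviation "T \<equiv> cotangent_bundle A"

abbreviation "bot_d \<equiv> wedge_inv T (canonical_form A) (d2 T \<omega>)"

text \<open>The description in \<open>wedge_inv\<close> is met by exactly one covector, and in a chart this covector is the
  contraction of \<open>d\<omega>\<close>.\<close>
lemma bot_d_eq:
  assumes C: "C \<in> charts_at T m"
  shows "bot_d m \<in> cotangent_space T m"
    and "bot_d m (coord_vector T C m a) =
      symp_contraction (\<lambda>u v w. d2 T \<omega> m (coord_vector T C m u) (coord_vector T C m v) (coord_vector T C m w)) a"
    and "\<And>u v w. u \<in> tangent_space T m \<Longrightarrow> v \<in> tangent_space T m \<Longrightarrow> w \<in> tangent_space T m \<Longrightarrow>
      wedge12 bot_d (canonical_form A) m u v w = d2 T \<omega> m u v w"
proof -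
  let ?e = "coord_vector T C m"
  let ?t = "\<lambda>u v w. d2 T \<omega> m (?e u) (?e v) (?e w)"
  let ?l = "symp_contraction ?t"
  have m: "m \<in> points T" by (rule T.charts_at_point[OF C])
  note tri = T.d2_trilinear_alternating[OF T.openin_points \<omega> m C]
  define \<xi> where "\<xi> = restrict0 (tangent_space T m) (\<lambda>v. ?l (v C))"
  have lin: "linear ?l"
    unfolding symp_contraction_def[abs_def] by (intro linear_compose_sum ballI tri)
  have \<xi>: "\<xi> \<in> cotangent_space T m"
    unfolding \<xi>_def by (rule T.restrict0_linear_cotangent[OF C lin]) simp
  have \<xi>_wedge: "wedge12 (\<lambda>_. \<xi>) (canonical_form A) m u v w = d2 T \<omega> m u v w"
    if t: "u \<in> tangent_space T m" "v \<in> tangent_space T m" "w \<in> tangent_space T m" for u v w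
    using wedge_symp_contraction[of ?t, OF tri, of "u C" "v C" "w C"] t
    by (simp add: wedge12_def \<xi>_def restrict0_def canonical_form_chart[OF C] T.coord_vector_components[OF C])
  have uniq: "\<eta> (?e a) = ?l a"
    if \<eta>: "\<eta> \<in> cotangent_space T m" and w: "\<forall>u\<in>tangent_space T m. \<forall>v\<in>tangent_space T m. \<forall>w\<in>tangent_space T m.
      wedge12 (\<lambda>_. \<eta>) (canonical_form A) m u v w = d2 T \<omega> m u v w" for \<eta> a
  proof -
    have "\<eta> (?e u) * symp v w - \<eta> (?e v) * symp u w + \<eta> (?e w) * symp u v = ?t u v w" for u v w
      using w[rule_format, of "?e u" "?e v" "?e w"] C by (simp add: wedge12_def canonical_form_chart[OF C])
    from symp_contraction_wedge[OF T.cotangent_linear[OF \<eta> C] this] show ?thesis by simp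
  qed
  have "bot_d m = \<xi>"
    unfolding wedge_inv_def
  proof (rule the_equality)
    fix \<eta> assume \<eta>: "\<eta> \<in> cotangent_space T m \<and> (\<forall>u\<in>tangent_space T m. \<forall>v\<in>tangent_space T m. \<forall>w\<in>tangent_space T m.
      wedge12 (\<lambda>_. \<eta>) (canonical_form A) m u v w = d2 T \<omega> m u v w)"
    show "\<eta> = \<xi>"
    proof (rule T.cotangent_eqI)
      fix v assume v: "v \<in> tangent_space T m"
      show "\<eta> v = \<xi> v"
        using uniq[of \<eta> "v C"] \<eta> v T.coord_vector_components[OF C v] by (simp add: \<xi>_def restrict0_def)
    qed (use \<eta> \<xi> in auto)
  qed (use \<xi> \<xi>_wedge in blast)
  then show "bot_d m \<in> cotangent_space T m" "bot_d m (?e a) = ?l a"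
    "\<And>u v w. u \<in> tangent_space T m \<Longrightarrow> v \<in> tangent_space T m \<Longrightarrow> w \<in> tangent_space T m \<Longrightarrow>
      wedge12 bot_d (canonical_form A) m u v w = d2 T \<omega> m u v w"
    using \<xi> \<xi>_wedge C by (simp_all add: wedge12_def) (simp add: \<xi>_def restrict0_def)
qed

lemma one_form_bot_d: "one_form T (points T) bot_d"
  unfolding one_form_def
proof (intro conjI ballI allI)
  show "bot_d m \<in> cotangent_space T m" if "m \<in> points T" for m
    by (rule bot_d_eq(1)[OF T.chart_at[OF that]])
  fix C a assume C: "C \<in> T"
  let ?S = "T.coords C (points T)" and ?s = "local2 T C \<omega>"
  note S = T.open_coords[OF C T.openin_points]
  have s: "smooth_on ?S (\<lambda>z. ?s z u v)" for u v
    by (rule lin_fieldD(2)[OF bilin_fieldD(1)[OF T.two_form_bilin_field[OF \<omega> C]]])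
  show "smooth_on ?S (\<lambda>y. local1 T C bot_d y a)"
  proof (rule smooth_on_cong[OF S])
    show "smooth_on ?S (\<lambda>y. \<Sum>b\<in>Basis. D (\<lambda>z. ?s z (b, 0) (0, b)) y a
        - D (\<lambda>z. ?s z a (0, b)) y (b, 0) + D (\<lambda>z. ?s z a (b, 0)) y (0, b))"
      by (intro smooth_on_sum smooth_on_add smooth_on_diff S smooth_on_D s)
    fix y assume y: "y \<in> ?S"
    note Cy = T.charts_at_coords[OF C y] and m = T.coordsD(2,3)[OF C y]
    show "(\<Sum>b\<in>Basis. D (\<lambda>z. ?s z (b, 0) (0, b)) y a
        - D (\<lambda>z. ?s z a (0, b)) y (b, 0) + D (\<lambda>z. ?s z a (b, 0)) y (0, b)) = local1 T C bot_d y a"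
      by (simp add: local1_def bot_d_eq(2)[OF Cy] symp_contraction_def
          T.d2_coord_vectors[OF T.openin_points \<omega> m(1) Cy] m(2))
  qed
qed

lemma two_form_add_multiple:
  assumes U: "openin (atlas_topology T) U" and \<mu>: "smooth_fun T U \<mu>"
  shows "two_form T U (add_multiple \<omega> \<mu> (canonical_form A))"
proof -
  interpret S: symplectic T U "canonical_form A" by (rule symplectic_locale[OF U])
  note w = T.two_form_subset[OF \<omega> T.openin_subset_points[OF U]] and O = S.symplectic_two_form
  show ?thesis
    unfolding two_form_def
  proof (intro conjI ballI allI)
    fix x u assume "x \<in> U" "u \<in> tangent_space T x"
    then show "linear_on (tangent_space T x) (add_multiple \<omega> \<mu> (canonical_form A) x u)"
      "linear_on (tangent_space T x) (\<lambda>v. add_multiple \<omega> \<mu> (canonical_form A) x v u)"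
      "add_multiple \<omega> \<mu> (canonical_form A) x u u = 0"
      by (simp_all add: linear_on_def add_multiple_def T.two_formD[OF w] T.two_formD[OF O] algebra_simps)
  next
    fix C a b assume C: "C \<in> T"
    note V = T.open_coords[OF C U]
    have "smooth_on (T.coords C U) (\<lambda>y. local2 T C \<omega> y a b + (\<mu> \<circ> chart_inv C) y * symp a b)"
      by (intro smooth_on_add smooth_on_mult V smooth_on_const T.smooth_funD[OF \<mu> C]
          lin_fieldD(2)[OF bilin_fieldD(1)[OF T.two_form_bilin_field[OF w C]]])
    then show "smooth_on (T.coords C U) (\<lambda>y. local2 T C (add_multiple \<omega> \<mu> (canonical_form A)) y a b)"
      by (rule smooth_on_cong[OF V, rotated])
        (simp add: local2_canonical_form[OF C, symmetric], simp add: local2_def add_multiple_def)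
  qed
qed

text \<open>Since \<open>d\<Omega> = 0\<close>, \<open>d(\<omega> - f \<Omega>) = d\<omega> - df \<and> \<Omega>\<close>, which vanishes when \<open>df = \<bottom>d\<omega>\<close>.\<close>

lemma closed_add_multiple:
  assumes U: "openin (atlas_topology T) U" and f: "smooth_fun T U f"
    and df: "\<And>x. x \<in> U \<Longrightarrow> d0 T f x = bot_d x"
  defines "\<mu> \<equiv> \<lambda>x. - f x"
  shows "smooth_fun T U \<mu>" "closed2 T U (add_multiple \<omega> \<mu> (canonical_form A))"
proof -
  show \<mu>: "smooth_fun T U \<mu>"
    unfolding smooth_fun_def
  proof
    fix C assume C: "C \<in> T"
    show "smooth_on (T.coords C U) (\<mu> \<circ> chart_inv C)"
      using smooth_on_minus[OF T.open_coords[OF C U] T.smooth_funD[OF f C]] by (simp add: \<mu>_def o_def)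
  qed
  show "closed2 T U (add_multiple \<omega> \<mu> (canonical_form A))"
    unfolding closed2_def
  proof (intro ballI)
    fix x u v w assume x: "x \<in> U" and t: "u \<in> tangent_space T x" "v \<in> tangent_space T x" "w \<in> tangent_space T x"
    have xp: "x \<in> points T" using T.openin_subset_points[OF U] x by blast
    define C where "C = chart_at T x"
    have C: "C \<in> charts_at T x" using T.chart_at[OF xp] by (simp add: C_def)
    note CT = T.charts_atD(1)[OF C] and y = T.snd_in_coords[OF C x]
    note V = T.open_coords[OF CT U]
    let ?s = "local2 T C \<omega>" and ?f = "f \<circ> chart_inv C"
    note w' = T.two_form_subset[OF \<omega> T.openin_subset_points[OF U]]
    have hs: "((\<lambda>z. ?s z a b) has_derivative D (\<lambda>z. ?s z a b) (snd C x)) (at (snd C x))" for a b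
      by (rule smooth_on_has_derivative[OF lin_fieldD(2)[OF bilin_fieldD(1)[OF T.two_form_bilin_field[OF w' CT]]] y])
    have hf: "(?f has_derivative D ?f (snd C x)) (at (snd C x))"
      by (rule smooth_on_has_derivative[OF T.smooth_funD[OF f CT] y])
    have D: "D (\<lambda>z. local2 T C (add_multiple \<omega> \<mu> (canonical_form A)) z a b) (snd C x) e =
        D (\<lambda>z. ?s z a b) (snd C x) e - D ?f (snd C x) e * symp a b" for a b e
    proof -
      have "((\<lambda>z. ?s z a b - ?f z * symp a b) has_derivative
          (\<lambda>e. D (\<lambda>z. ?s z a b) (snd C x) e - D ?f (snd C x) e * symp a b)) (at (snd C x))"
        by (intro has_derivative_diff hs has_derivative_mult_left hf)
      then have "((\<lambda>z. local2 T C (add_multiple \<omega> \<mu> (canonical_form A)) z a b) has_derivative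
          (\<lambda>e. D (\<lambda>z. ?s z a b) (snd C x) e - D ?f (snd C x) e * symp a b)) (at (snd C x))"
        by (rule has_derivative_transform_within_open[OF _ V y])
          (simp add: local2_canonical_form[OF CT, symmetric], simp add: local2_def add_multiple_def \<mu>_def)
      from D_eqI[OF this] show ?thesis by simp
    qed
    have df': "D ?f (snd C x) (e C) = bot_d x e" if "e \<in> tangent_space T x" for e
      using T.d0_chart[OF C T.smooth_fun_differentiable[OF f C x] that] df[OF x] by simp
    have "d2 T (add_multiple \<omega> \<mu> (canonical_form A)) x u v w =
        d2 T \<omega> x u v w - wedge12 bot_d (canonical_form A) x u v w"
      using t by (simp add: T.d2_chart[OF U two_form_add_multiple[OF U \<mu>] x C]
          T.d2_chart[OF U w' x C] D df' wedge12_def canonical_form_chart[OF C])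
    then show "d2 T (add_multiple \<omega> \<mu> (canonical_form A)) x u v w = 0"
      using bot_d_eq(3)[OF C t] by simp
  qed
qed

lemma closed_multiple_exists:
  assumes div: "divergent_type T (canonical_form A) \<omega>"
    and U: "openin (atlas_topology T) U" and ex: "closed_one_forms_exact T U"
  shows "\<exists>\<mu>. smooth_fun T U \<mu> \<and> closed2 T U (add_multiple \<omega> \<mu> (canonical_form A))"
proof -
  note sub = T.openin_subset_points[OF U]
  have "closed1 T U bot_d"
    using div sub by (auto simp: closed1_def divergent_type_def euler_def)
  then obtain f where "smooth_fun T U f" "\<And>x. x \<in> U \<Longrightarrow> d0 T f x = bot_d x"
    using ex T.one_form_subset[OF one_form_bot_d sub] unfolding closed_one_forms_exact_def by blast
  from closed_add_multiple[OF U this] show ?thesis by blast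
qed

lemma same_equation_add_multiple:
  "same_equation A U \<omega> (add_multiple \<omega> \<mu> (canonical_form A))"
  unfolding same_equation_def generalized_solution_def isotropic_at_def
  by (auto simp: monge_ampere_def pullback2_def add_multiple_def pullback_canonical_form_diff_section)

lemma hitchin_locale:
  assumes U: "openin (atlas_topology T) U" and \<mu>: "smooth_fun T U \<mu>"
    and cl: "closed2 T U (add_multiple \<omega> \<mu> (canonical_form A))"
  shows "hitchin T U (canonical_form A) (add_multiple \<omega> \<mu> (canonical_form A))"
proof -
  interpret S: symplectic T U "canonical_form A" by (rule symplectic_locale[OF U])
  show ?thesis
    by unfold_locales (use two_form_add_multiple[OF U \<mu>] cl flat_inv_smooth in auto)
qed

end

theorem proposition5:
  fixes A :: "('n, real^2) chart set"
    and \<omega> :: "(('n, real^2) cpoint, (real^2) \<times> (real^2)) form2"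
  assumes "smooth_manifold A"
    and "two_form (cotangent_bundle A) (points (cotangent_bundle A)) \<omega>"
    and "divergent_type (cotangent_bundle A) (canonical_form A) \<omega>"
  shows
    "(\<forall>x\<in>points A. \<exists>V \<mu>. openin (atlas_topology A) V \<and> x \<in> V \<and>
        smooth_fun (cotangent_bundle A) (cotangent_over A V) \<mu> \<and>
        closed2 (cotangent_bundle A) (cotangent_over A V)
          (add_multiple \<omega> \<mu> (canonical_form A))) \<and>
     (\<forall>U. openin (atlas_topology (cotangent_bundle A)) U \<and>
        closed_one_forms_exact (cotangent_bundle A) U \<longrightarrow>
        (\<exists>\<mu>. smooth_fun (cotangent_bundle A) U \<mu> \<and>
           closed2 (cotangent_bundle A) U (add_multiple \<omega> \<mu> (canonical_form A)))) \<and>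
     (\<forall>U \<mu>. openin (atlas_topology (cotangent_bundle A)) U \<and>
        smooth_fun (cotangent_bundle A) U \<mu> \<and>
        closed2 (cotangent_bundle A) U (add_multiple \<omega> \<mu> (canonical_form A)) \<longrightarrow>
        same_equation A U \<omega> (add_multiple \<omega> \<mu> (canonical_form A)) \<and>
        hitchin_pair (cotangent_bundle A) U
          (add_multiple \<omega> \<mu> (canonical_form A)) (canonical_form A) \<and>
        generalized_complex_structure (cotangent_bundle A) U
          (gcs_map (cotangent_bundle A) (canonical_form A)
             (add_multiple \<omega> \<mu> (canonical_form A))))"
proof (intro conjI)
  interpret cotangent_surface A \<omega>
    by unfold_locales (use assms in \<open>auto simp: smooth_manifold_def\<close>)
  note exists = closed_multiple_exists[OF assms(3)]
  show "\<forall>x\<in>points A. \<exists>V \<mu>. openin (atlas_topology A) V \<and> x \<in> V \<and>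
        smooth_fun T (cotangent_over A V) \<mu> \<and>
        closed2 T (cotangent_over A V) (add_multiple \<omega> \<mu> (canonical_form A))"
  proof
    fix x assume "x \<in> points A"
    then obtain c V r where c: "c \<in> A" and V: "openin (atlas_topology A) V" "x \<in> V" "V \<subseteq> fst c"
      and ball: "coords c V = ball (snd c x) r"
      by (rule ball_neighbourhood)
    have "closed_one_forms_exact T (cotangent_over A V)"
    proof (rule T.closed_one_forms_exact_convex[OF _ openin_cotangent_over[OF V(1)]])
      show "cotangent_chart A c \<in> T" using c by (simp add: cotangent_bundle_def)
      show "cotangent_over A V \<subseteq> fst (cotangent_chart A c)"
        using V(3) by (auto simp: fst_cotangent_chart cotangent_over_def)
      show "convex (T.coords (cotangent_chart A c) (cotangent_over A V))"
        unfolding coords_cotangent_over[OF c] ball by (intro convex_Times convex_ball convex_UNIV)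
    qed
    from exists[OF openin_cotangent_over[OF V(1)] this] V
    show "\<exists>V \<mu>. openin (atlas_topology A) V \<and> x \<in> V \<and> smooth_fun T (cotangent_over A V) \<mu> \<and>
        closed2 T (cotangent_over A V) (add_multiple \<omega> \<mu> (canonical_form A))"
      by blast
  qed
  show "\<forall>U. openin (atlas_topology T) U \<and> closed_one_forms_exact T U \<longrightarrow>
      (\<exists>\<mu>. smooth_fun T U \<mu> \<and> closed2 T U (add_multiple \<omega> \<mu> (canonical_form A)))"
    using exists by blast
  show "\<forall>U \<mu>. openin (atlas_topology T) U \<and> smooth_fun T U \<mu> \<and>
      closed2 T U (add_multiple \<omega> \<mu> (canonical_form A)) \<longrightarrow>
      same_equation A U \<omega> (add_multiple \<omega> \<mu> (canonical_form A)) \<and>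
      hitchin_pair T U (add_multiple \<omega> \<mu> (canonical_form A)) (canonical_form A) \<and>
      generalized_complex_structure T U
        (gcs_map T (canonical_form A) (add_multiple \<omega> \<mu> (canonical_form A)))"
  proof (intro allI impI, elim conjE)
    fix U \<mu> assume U: "openin (atlas_topology T) U" and \<mu>: "smooth_fun T U \<mu>"
      and cl: "closed2 T U (add_multiple \<omega> \<mu> (canonical_form A))"
    interpret H: hitchin T U "canonical_form A" "add_multiple \<omega> \<mu> (canonical_form A)"
      by (rule hitchin_locale[OF U \<mu> cl])
    show "same_equation A U \<omega> (add_multiple \<omega> \<mu> (canonical_form A)) \<and>
      hitchin_pair T U (add_multiple \<omega> \<mu> (canonical_form A)) (canonical_form A) \<and>
      generalized_complex_structure T U
        (gcs_map T (canonical_form A) (add_multiple \<omega> \<mu> (canonical_form A)))"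
      using same_equation_add_multiple H.symplectic H.forms H.generalized_complex_structure
      by (simp add: hitchin_pair_def)
  qed
qed

end
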